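(* Let $1\le p<\infty$, $0<q<\infty$ and $\nu\in\mathcal{D}$. Then $\nu\in\widehat{\mathcal{D}}_q$ if and only if there exists a constant $C=C(p,q,\nu)>0$ such that $$\int_{1/2}^1 \omega_p(1-r,f)^q\,\frac{\nu(r)}{(1-r)^q}\,dr\le C\,\|f'\|_{A^{p,q}_\nu}^q$$ for all $f\in H^p$.
   Context: $\mathbb{D}$ is the open unit disc of $\mathbb{C}$, $\mathbb{T}$ its boundary, and $\mathcal{H}(\mathbb{D})$ the set of analytic functions in $\mathbb{D}$. For $f\in\mathcal{H}(\mathbb{D})$, $0<p<\infty$ and $0\le r<1$ let $M_p(r,f)=\left(\frac1{2\pi}\int_0^{2\pi}|f(re^{i\theta})|^p\,d\theta\right)^{1/p}$. The Hardy space $H^p$ consists of $f\in\mathcal{H}(\mathbb{D})$ with $\|f\|_{H^p}=\sup_{0\le r<1}M_p(r,f)<\infty$; for $f\in H^p$, $f(e^{i\theta})$ denotes the non-tangential limit, which exists almost everywhere. A weight is a function $\nu:\mathbb{D}\to[0,\infty)$ that is integrable over $\mathbb{D}$ and radial, $\nu(z)=\nu(|z|)$. Put $\widehat\nu(z)=\widehat\nu(|z|)=\int_{|z|}^1\nu(s)\,ds$; it is understood that $\widehat\nu(r)>0$ for all $0\le r<1$. Write $\nu\in\widehat{\mathcal{D}}$ if there is $C=C(\nu)>0$ with $\widehat\nu(r)\le C\,\widehat\nu\left(\frac{1+r}{2}\right)$ for all $0\le r<1$. Write $\nu\in\check{\mathcal{D}}$ if there are $K=K(\nu)>1$ and $C=C(\nu)>1$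 with $\widehat\nu(r)\ge C\,\widehat\nu\left(1-\frac{1-r}{K}\right)$ for all $0\le r<1$. Set $\mathcal{D}=\widehat{\mathcal{D}}\cap\check{\mathcal{D}}$. For $0<q<\infty$, $\widehat{\mathcal{D}}_q$ is the subclass of those $\nu\in\widehat{\mathcal{D}}$ with $$\sup_{0\le r<1}\frac{(1-r)^q}{\widehat\nu(r)}\int_0^r\frac{\nu(s)}{(1-s)^q}\,ds<\infty.$$ For $g\in\mathcal{H}(\mathbb{D})$, $\|g\|_{A^{p,q}_\nu}^q=\int_0^1M_p(r,g)^q\,\nu(r)\,dr\in[0,\infty]$. The $L^p$ modulus of continuity is $\omega_p(t,f)=\sup_{0<h<t}\left(\int_0^{2\pi}|f(e^{i(\theta+h)})-f(e^{i\theta})|^p\,d\theta\right)^{1/p}$ for $0<t\le2\pi$. *)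

theory Defs
  imports "HOL-Analysis.Analysis"
begin

abbreviation unit_disc :: "complex set" where
  "unit_disc \<equiv> ball 0 1"

definition integral_mean :: "real \<Rightarrow> real \<Rightarrow> (complex \<Rightarrow> complex) \<Rightarrow> real" where
  "integral_mean p r f =
     (1 / (2 * pi) *
       (LINT \<theta>:{0..2*pi}|lebesgue. cmod (f (of_real r * cis \<theta>)) powr p)) powr (1 / p)"

definition hardy_norm :: "real \<Rightarrow> (complex \<Rightarrow> complex) \<Rightarrow> ennreal" where
  "hardy_norm p f = (SUP r\<in>{0..<1}. ennreal (integral_mean p r f))"

definition hardy_space :: "real \<Rightarrow> (complex \<Rightarrow> complex) set" where
  "hardy_space p = {f. f holomorphic_on unit_disc \<and> hardy_norm p f < \<infinity>}"

definition stolz_region :: "real \<Rightarrow> complex \<Rightarrow> complex set" where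
  "stolz_region a \<zeta> = {z \<in> unit_disc. cmod (z - \<zeta>) < a * (1 - cmod z)}"

definition has_nontangential_limit ::
    "(complex \<Rightarrow> complex) \<Rightarrow> complex \<Rightarrow> complex \<Rightarrow> bool" where
  "has_nontangential_limit f L \<zeta> \<longleftrightarrow>
     (\<forall>a>1. (f \<longlongrightarrow> L) (at \<zeta> within stolz_region a \<zeta>))"

(* Where the limit does not exist (a null set of the circle if f is in a Hardy space),
   this is a fixed unspecified value.  The values of f itself outside the open unit
   disc play no role. *)
definition boundary_value :: "(complex \<Rightarrow> complex) \<Rightarrow> complex \<Rightarrow> complex" where
  "boundary_value f \<zeta> = (THE L. has_nontangential_limit f L \<zeta>)"

(* For f in the Hardy space of exponent p the integrals are finite and bounded in h,
   so the real-valued integral and supremum agree with the extended ones. *)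
definition modulus_of_continuity :: "real \<Rightarrow> real \<Rightarrow> (complex \<Rightarrow> complex) \<Rightarrow> real" where
  "modulus_of_continuity p t f =
     (SUP h\<in>{0<..<t}.
        (LINT \<theta>:{0..2*pi}|lebesgue.
           cmod (boundary_value f (cis (\<theta> + h)) - boundary_value f (cis \<theta>)) powr p)
        powr (1 / p))"

(* Extended-valued: integrability of \<nu> over the disc only controls s * \<nu> s near s = 0,
   so the tail at r = 0 may be infinite for a general weight.  Membership in
   upper_doubling below excludes this. *)
definition tail_integral :: "(complex \<Rightarrow> real) \<Rightarrow> real \<Rightarrow> ennreal" where
  "tail_integral \<nu> r = (\<integral>\<^sup>+ s\<in>{r..<1}. ennreal (\<nu> (of_real s)) \<partial>lebesgue)"

definition radial_weight :: "(complex \<Rightarrow> real) \<Rightarrow> bool" where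
  "radial_weight \<nu> \<longleftrightarrow>
     (\<forall>z\<in>unit_disc. 0 \<le> \<nu> z) \<and>
     set_integrable lebesgue unit_disc \<nu> \<and>
     (\<forall>z\<in>unit_disc. \<nu> z = \<nu> (of_real (cmod z))) \<and>
     (\<forall>r\<in>{0..<1}. 0 < tail_integral \<nu> r)"

definition upper_doubling :: "(complex \<Rightarrow> real) set" where
  "upper_doubling = {\<nu>. radial_weight \<nu> \<and>
     (\<exists>C>0. \<forall>r\<in>{0..<1}. tail_integral \<nu> r \<le> ennreal C * tail_integral \<nu> ((1 + r) / 2))}"

definition lower_doubling :: "(complex \<Rightarrow> real) set" where
  "lower_doubling = {\<nu>. radial_weight \<nu> \<and>
     (\<exists>K>1. \<exists>C>1. \<forall>r\<in>{0..<1}.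
        ennreal C * tail_integral \<nu> (1 - (1 - r) / K) \<le> tail_integral \<nu> r)}"

definition two_sided_doubling :: "(complex \<Rightarrow> real) set" where
  "two_sided_doubling = upper_doubling \<inter> lower_doubling"

definition upper_doubling_q :: "real \<Rightarrow> (complex \<Rightarrow> real) set" where
  "upper_doubling_q q = {\<nu> \<in> upper_doubling.
     (SUP r\<in>{0..<1}. ennreal ((1 - r) powr q) / tail_integral \<nu> r *
        (\<integral>\<^sup>+ s\<in>{0..r}. ennreal (\<nu> (of_real s) / (1 - s) powr q) \<partial>lebesgue)) < \<infinity>}"

(* The q-th power of the mixed norm. *)
definition mixed_norm_pow ::
    "real \<Rightarrow> real \<Rightarrow> (complex \<Rightarrow> real) \<Rightarrow> (complex \<Rightarrow> complex) \<Rightarrow> ennreal" where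
  "mixed_norm_pow p q \<nu> g =
     (\<integral>\<^sup>+ r\<in>{0..<1}. ennreal (integral_mean p r g powr q * \<nu> (of_real r)) \<partial>lebesgue)"

end

theory Submission
  imports Defs "HOL-Complex_Analysis.Complex_Analysis"
begin

text \<open>
Write \<open>x\<^sub>n = 1 - 2\<^sup>-\<^sup>n\<close> and \<open>m(r) = M\<^sub>p(r, f')\<close>. On the part of a Stolz region with vertex \<open>e\<^sup>i\<^sup>\<theta>\<close>
between the radii \<open>x\<^sub>n\<close> and \<open>x\<^sub>n\<^sub>+\<^sub>1\<close> the derivative is dominated by \<open>U\<^sub>n(\<theta>)\<close>, the Poisson integral at
\<open>x\<^sub>n e\<^sup>i\<^sup>\<theta>\<close> of \<open>|f'|\<close> restricted to the circle of radius \<open>x\<^sub>n\<^sub>+\<^sub>2\<close>, and \<open>U\<^sub>n\<close> has \<open>L\<^sup>p\<close> mean at most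
\<open>m(x\<^sub>n\<^sub>+\<^sub>2)\<close> by Minkowski's integral inequality. Hence, as soon as \<open>\<Sum>\<^sub>j 2\<^sup>-\<^sup>j m(x\<^sub>j\<^sub>+\<^sub>2)\<close> is finite,
non-tangential limits exist almost everywhere (without Fatou's theorem), and
\<open>\<omega>\<^sub>p(t, f)\<close> is at most a constant times \<open>\<Sum>\<^sub>j\<^sub>\<ge>\<^sub>k 2\<^sup>-\<^sup>j m(x\<^sub>j\<^sub>+\<^sub>2)\<close> for \<open>t \<le> 2\<^sup>-\<^sup>k\<close>.

In terms of the tails \<open>V\<^sub>k\<close> of the weight at \<open>x\<^sub>k\<close>, the class condition makes
\<open>2\<^sup>k\<^sup>q V\<^sub>k\<close> grow geometrically, so that the inequality becomes a discrete Hardy inequality.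
Conversely, testing with \<open>z\<^sup>n\<close>, \<open>n = 2\<^sup>k\<^sup>+\<^sup>2\<close>, gives back the class condition at \<open>x\<^sub>k\<close>.
\<close>

section \<open>Minkowski's integral inequality\<close>

text \<open>In the sufficiency the right-hand side is either infinite, or finite; in the latter case
  the discrete Hardy inequality itself yields convergence of the series that produces the boundary
  values. Two losses shape the discretisation. A single block mass \<open>W k\<close> may vanish, so
  lower doubling is used to bound the tail \<open>V k\<close> by \<open>L\<close> consecutive
  masses; with the monotonicity of m this turns sums over masses into sums over tails. The majorant
  on block n lives on the circle of radius x_(n+2), and this shift by two is paid for by upper
  doubling. Conversely, upper doubling gives V_j \<le> C^(k-j) V_k for j < k, a growth beaten by the
  decay of z^n inside the circle of radius x_k. The degree is 2^(k+2) because pi < 4 puts the half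
  period pi/n below 2^-k. The integral starts at 1/2, so block 0 is invisible to the tests and its
  mass must be compared with that of a later block. The weight is integrable over the disc, and a
  radius is a null set there; its measurability along a radius must be derived before integrals can
  be split into blocks.\<close>

lemma powr_tangent_bound:
  fixes p b x :: real
  assumes "1 \<le> p" "0 \<le> x" "0 \<le> b"
  shows "p * (b powr (p - 1) * x) \<le> x powr p + (p - 1) * b powr p"
proof (cases "x = 0 \<or> b = 0")
  case False
  have "(x powr p) powr (1/p) * (b powr p) powr (1 - 1/p) \<le> 1/p * x powr p + (1 - 1/p) * b powr p"
    using assms False by (intro Youngs_inequality_0) auto
  also have "(x powr p) powr (1/p) * (b powr p) powr (1 - 1/p) = b powr (p - 1) * x"
  proof -
    have "p * (1 - 1 / p) = p - 1" using assms by (simp add: field_simps)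
    then show ?thesis using assms by (simp add: powr_powr)
  qed
  finally have "p * (b powr (p - 1) * x) \<le> p * (1/p * x powr p + (1 - 1/p) * b powr p)"
    using assms by (intro mult_left_mono) auto
  also have "\<dots> = x powr p + (p - 1) * b powr p"
    using assms by (simp add: field_simps)
  finally show ?thesis .
qed (use assms in auto)

text \<open>The line tangent to x^p at b, taken at x/c and multiplied by c. For c = 0 both sides
  vanish, because \<open>0 powr (1 - p) = 0\<close> and x = 0 by hypothesis.\<close>

lemma weighted_powr_tangent_bound:
  fixes p b c x :: real
  assumes p: "1 \<le> p" and "0 \<le> x" "0 \<le> b" "0 \<le> c" and "c = 0 \<Longrightarrow> x = 0"
  shows "p * b powr (p - 1) * x \<le> c powr (1 - p) * x powr p + (p - 1) * b powr p * c"
proof (cases "c = 0")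
  case False
  then have c: "c > 0" using assms by simp
  have "p * (b powr (p - 1) * (x / c)) \<le> (x / c) powr p + (p - 1) * b powr p"
    using assms by (intro powr_tangent_bound) auto
  then have "c * (p * (b powr (p - 1) * (x / c))) \<le> c * ((x / c) powr p + (p - 1) * b powr p)"
    using c by (intro mult_left_mono) auto
  moreover have "c * (p * (b powr (p - 1) * (x / c))) = p * b powr (p - 1) * x"
    using c by simp
  moreover have "c * (x / c) powr p = c powr (1 - p) * x powr p"
    using c assms(2) by (simp add: powr_divide powr_diff)
  ultimately show ?thesis by (simp add: algebra_simps)
qed (use assms in auto)

text \<open>Lets the proof of Minkowski's inequality divide by some B > A, so that A = 0 is no
  special case.\<close>

lemma ennreal_le_powr_limit:
  fixes A p :: real
  assumes "0 < p" "0 \<le> A" and le: "\<And>B. A < B \<Longrightarrow> X \<le> ennreal (B powr p)"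
  shows "X \<le> ennreal (A powr p)"
proof (rule tendsto_lowerbound)
  show "((\<lambda>n. ennreal ((A + inverse (real (Suc n))) powr p)) \<longlongrightarrow> ennreal (A powr p)) sequentially"
  proof (intro tendsto_ennrealI)
    have "(\<lambda>n. (A + inverse (real (Suc n))) powr p) \<longlonglongrightarrow> (A + 0) powr p"
      using assms(1,2)
      by (intro tendsto_powr' tendsto_add tendsto_const LIMSEQ_inverse_real_of_nat)
         (auto intro!: always_eventually)
    then show "(\<lambda>n. (A + inverse (real (Suc n))) powr p) \<longlonglongrightarrow> A powr p" by simp
  qed
  show "\<forall>\<^sub>F n in sequentially. X \<le> ennreal ((A + inverse (real (Suc n))) powr p)"
    by (intro always_eventually allI le) simp
qed simp

text \<open>The proof replaces duality by tangent lines. With I(t) the integral of G(s,t) over s and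
  J(t) that of c(s)^(1-p) G(s,t)^p, Fubini bounds the integral of J by A, and the weighted tangent
  bound integrated over s gives p b^(p-1) I \<le> J + (p-1) b^p A for every b. Choosing b = I/B with
  B > A yields I^p \<le> B^(p-1) J. Finiteness of I is a separate conclusion because
  \<open>enn2real\<close> sends infinity to 0.\<close>

lemma Minkowski_integral_inequality:
  fixes G :: "'a \<Rightarrow> 'b \<Rightarrow> real" and c :: "'a \<Rightarrow> real"
  assumes M: "sigma_finite_measure M" and N: "sigma_finite_measure N" and p: "1 \<le> p"
    and G: "(\<lambda>(s, t). G s t) \<in> borel_measurable (M \<Otimes>\<^sub>M N)" "\<And>s t. 0 \<le> G s t"
    and c: "c \<in> borel_measurable M" "\<And>s. 0 \<le> c s"
    and bound: "\<And>s. s \<in> space M \<Longrightarrow> (\<integral>\<^sup>+ t. ennreal (G s t powr p) \<partial>N) \<le> ennreal (c s powr p)"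
    and A: "(\<integral>\<^sup>+ s. ennreal (c s) \<partial>M) \<le> ennreal A" "0 \<le> A"
  shows "AE t in N. (\<integral>\<^sup>+ s. ennreal (G s t) \<partial>M) < \<infinity>"
    and "(\<integral>\<^sup>+ t. ennreal (enn2real (\<integral>\<^sup>+ s. ennreal (G s t) \<partial>M) powr p) \<partial>N) \<le> ennreal (A powr p)"
proof -
  interpret M: sigma_finite_measure M by fact
  interpret N: sigma_finite_measure N by fact
  interpret pair_sigma_finite M N ..
  note [measurable] = G(1) c(1)
  define I where "I t = (\<integral>\<^sup>+ s. ennreal (G s t) \<partial>M)" for t
  define J where "J t = (\<integral>\<^sup>+ s. ennreal (c s powr (1 - p) * G s t powr p) \<partial>M)" for t
  have [measurable]: "I \<in> borel_measurable N" "J \<in> borel_measurable N"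
    unfolding I_def J_def by measurable
  \<comment> \<open>The tangent bound requires G to vanish where c does. The hypothesis gives this
    for each s and almost every t; it is used for almost every t and almost every s, hence the
    exchange of quantifiers.\<close>
  have AEs: "AE t in N. AE s in M. c s = 0 \<longrightarrow> G s t = 0"
  proof -
    have "AE s in M. AE t in N. c s = 0 \<longrightarrow> G s t = 0"
    proof (rule AE_I2)
      fix s assume s: "s \<in> space M"
      show "AE t in N. c s = 0 \<longrightarrow> G s t = 0"
      proof (cases "c s = 0")
        case True
        have [measurable]: "(\<lambda>t. G s t) \<in> borel_measurable N"
          using measurable_Pair2[OF G(1) s] by simp
        have "(\<integral>\<^sup>+ t. ennreal (G s t powr p) \<partial>N) = 0"
          using bound[OF s] True p by simp
        then have "AE t in N. ennreal (G s t powr p) = 0"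
          by (subst (asm) nn_integral_0_iff_AE) auto
        then show ?thesis using G(2) by (auto elim!: eventually_mono simp: ennreal_eq_0_iff)
      qed auto
    qed
    then show ?thesis
      by (subst AE_commute[symmetric]) auto
  qed
  have J_int: "(\<integral>\<^sup>+ t. J t \<partial>N) \<le> ennreal A"
  proof -
    have "(\<integral>\<^sup>+ t. J t \<partial>N) = (\<integral>\<^sup>+ s. (\<integral>\<^sup>+ t. ennreal (c s powr (1 - p) * G s t powr p) \<partial>N) \<partial>M)"
      unfolding J_def by (rule Fubini') measurable
    also have "\<dots> \<le> (\<integral>\<^sup>+ s. ennreal (c s) \<partial>M)"
    proof (rule nn_integral_mono)
      fix s assume s: "s \<in> space M"
      have [measurable]: "(\<lambda>t. G s t) \<in> borel_measurable N"
        using measurable_Pair2[OF G(1) s] by simp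
      have "(\<integral>\<^sup>+ t. ennreal (c s powr (1 - p) * G s t powr p) \<partial>N) =
          ennreal (c s powr (1 - p)) * (\<integral>\<^sup>+ t. ennreal (G s t powr p) \<partial>N)"
        by (subst nn_integral_cmult[symmetric]) (auto simp: ennreal_mult)
      also have "\<dots> \<le> ennreal (c s powr (1 - p)) * ennreal (c s powr p)"
        using bound[OF s] by (rule mult_left_mono) simp
      also have "\<dots> = ennreal (c s)"
        using c(2)[of s] by (cases "c s = 0") (auto simp: ennreal_mult[symmetric] powr_add[symmetric])
      finally show "(\<integral>\<^sup>+ t. ennreal (c s powr (1 - p) * G s t powr p) \<partial>N) \<le> ennreal (c s)" .
    qed
    also note A(1)
    finally show ?thesis .
  qed
  \<comment> \<open>The quantifier over b stands inside the almost-everywhere statement: the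
    exceptional set does not depend on b, and b will be chosen depending on t.\<close>
  have tangent: "AE t in N. \<forall>b\<ge>0. ennreal (p * b powr (p - 1)) * I t \<le> J t + ennreal ((p - 1) * b powr p * A)"
    using AEs AE_space
  proof eventually_elim
    case (elim t)
    note [measurable] = measurable_Pair1[OF G(1) elim(2), simplified]
    show ?case
    proof (intro allI impI)
      fix b :: real assume b: "0 \<le> b"
      have "ennreal (p * b powr (p - 1)) * I t = (\<integral>\<^sup>+ s. ennreal (p * b powr (p - 1)) * ennreal (G s t) \<partial>M)"
        unfolding I_def by (rule nn_integral_cmult[symmetric]) measurable
      also have "\<dots> \<le> (\<integral>\<^sup>+ s. ennreal (c s powr (1 - p) * G s t powr p) + ennreal ((p - 1) * b powr p) * ennreal (c s) \<partial>M)"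
        using elim(1)
      proof (intro nn_integral_mono_AE, eventually_elim)
        case (elim s)
        show ?case
          using weighted_powr_tangent_bound[of p "G s t" b "c s"] p b G(2) c(2) elim
          by (simp add: ennreal_mult[symmetric] ennreal_plus[symmetric] ennreal_leI del: ennreal_plus)
      qed
      also have "\<dots> = J t + ennreal ((p - 1) * b powr p) * (\<integral>\<^sup>+ s. ennreal (c s) \<partial>M)"
        unfolding J_def by (subst nn_integral_add) (auto simp: nn_integral_cmult)
      also have "\<dots> \<le> J t + ennreal ((p - 1) * b powr p) * ennreal A"
        using A by (intro add_left_mono mult_left_mono) auto
      also have "\<dots> = J t + ennreal ((p - 1) * b powr p * A)"
        using p A by (simp add: ennreal_mult)
      finally show "ennreal (p * b powr (p - 1)) * I t \<le> J t + ennreal ((p - 1) * b powr p * A)" .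
    qed
  qed
  have J_fin: "AE t in N. J t < \<infinity>"
  proof -
    have "(\<integral>\<^sup>+ t. J t \<partial>N) \<noteq> \<infinity>"
      using J_int by (metis ennreal_less_top infinity_ennreal_def leD)
    then show ?thesis using nn_integral_PInf_AE[of J N] by (simp add: less_top)
  qed
  have fin: "AE t in N. I t < \<infinity>"
    using tangent J_fin
  proof eventually_elim
    case (elim t)
    \<comment> \<open>The choice b = 1 already bounds I by J plus a constant.\<close>
    have "ennreal p * I t \<le> J t + ennreal ((p - 1) * A)"
      using elim(1)[rule_format, of 1] by simp
    also have "\<dots> < \<infinity>" using elim(2) by simp
    finally show ?case using p by (cases "I t") (auto simp: ennreal_mult_top)
  qed
  then show "AE t in N. (\<integral>\<^sup>+ s. ennreal (G s t) \<partial>M) < \<infinity>"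
    unfolding I_def .
  have pw: "AE t in N. ennreal (enn2real (I t) powr p) \<le> ennreal (B powr (p - 1)) * J t" if B: "A < B" for B
    using tangent J_fin fin
  proof eventually_elim
    case (elim t)
    define i where "i = enn2real (I t)"
    define j where "j = enn2real (J t)"
    have i: "I t = ennreal i" "0 \<le> i" using elim(3) by (auto simp: i_def)
    have j: "J t = ennreal j" "0 \<le> j" using elim(2) by (auto simp: j_def)
    have B0: "B > 0" using A(2) B by linarith
    \<comment> \<open>At b = i/B the last term becomes at most (p - 1) b^(p-1) i, which absorbs all
      but one of the p copies on the left.\<close>
    have "ennreal (p * (i / B) powr (p - 1)) * I t \<le> J t + ennreal ((p - 1) * (i / B) powr p * A)"
      using elim(1) i(2) B0 by auto
    moreover have "0 \<le> j + (p - 1) * (i / B) powr p * A"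
      using p A(2) j(2) by auto
    ultimately have "p * (i / B) powr (p - 1) * i \<le> j + (p - 1) * (i / B) powr p * A"
      unfolding i j using i(2) j(2) p A
      by (simp add: ennreal_mult[symmetric] ennreal_plus[symmetric] ennreal_le_iff del: ennreal_plus)
    also have "\<dots> \<le> j + (p - 1) * (i / B) powr p * B"
      using B p by (intro add_left_mono mult_left_mono) auto
    also have "\<dots> = j + (p - 1) * ((i / B) powr (p - 1) * i)"
      using i(2) B0 by (cases "i = 0") (auto simp: powr_diff)
    finally have "(i / B) powr (p - 1) * i \<le> j"
      by (simp add: algebra_simps)
    then have "B powr (p - 1) * ((i / B) powr (p - 1) * i) \<le> B powr (p - 1) * j"
      by (intro mult_left_mono) auto
    moreover have "B powr (p - 1) * ((i / B) powr (p - 1) * i) = i powr p"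
      using i(2) B0 by (cases "i = 0") (auto simp: powr_diff powr_divide)
    ultimately have "i powr p \<le> B powr (p - 1) * j" by simp
    then show ?case unfolding i_def[symmetric] j(1) using j(2) by (simp add: ennreal_mult[symmetric] ennreal_leI)
  qed
  show "(\<integral>\<^sup>+ t. ennreal (enn2real (\<integral>\<^sup>+ s. ennreal (G s t) \<partial>M) powr p) \<partial>N) \<le> ennreal (A powr p)"
  proof (rule ennreal_le_powr_limit)
    fix B assume B: "A < B"
    have "(\<integral>\<^sup>+ t. ennreal (enn2real (I t) powr p) \<partial>N) \<le> (\<integral>\<^sup>+ t. ennreal (B powr (p - 1)) * J t \<partial>N)"
      using pw[OF B] by (rule nn_integral_mono_AE)
    also have "\<dots> = ennreal (B powr (p - 1)) * (\<integral>\<^sup>+ t. J t \<partial>N)"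
      by (rule nn_integral_cmult) measurable
    also have "\<dots> \<le> ennreal (B powr (p - 1)) * ennreal B"
      using B by (intro mult_left_mono order_trans[OF J_int] ennreal_leI) auto
    also have "\<dots> = ennreal (B powr p)"
      using B A(2) by (simp add: ennreal_mult[symmetric] powr_diff)
    finally show "(\<integral>\<^sup>+ t. ennreal (enn2real (\<integral>\<^sup>+ s. ennreal (G s t) \<partial>M) powr p) \<partial>N) \<le> ennreal (B powr p)"
      unfolding I_def .
  qed (use p A in auto)
qed

section \<open>Poisson majorants of the derivative\<close>

definition poisson_kernel :: "real \<Rightarrow> complex \<Rightarrow> real \<Rightarrow> real" where
  "poisson_kernel \<rho> z t = (\<rho>\<^sup>2 - (cmod z)\<^sup>2) / (2 * pi * (cmod (of_real \<rho> * cis t - z))\<^sup>2)"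

lemma poisson_kernel_nonneg: "cmod z \<le> \<rho> \<Longrightarrow> 0 \<le> poisson_kernel \<rho> z t"
  unfolding poisson_kernel_def by (intro divide_nonneg_nonneg) (auto simp: power_mono)

lemma circle_point_neq:
  assumes "cmod z < \<rho>" shows "of_real \<rho> * cis t \<noteq> z"
proof
  assume "of_real \<rho> * cis t = z"
  then have "cmod z = \<bar>\<rho>\<bar>" by (auto simp: norm_mult)
  then show False using assms by simp
qed

lemma continuous_on_poisson_kernel:
  assumes "cmod z < \<rho>" shows "continuous_on A (poisson_kernel \<rho> z)"
  unfolding poisson_kernel_def
  using circle_point_neq[OF assms] by (intro continuous_intros) auto

lemma poisson_kernel_measurable:
  assumes "cmod z < \<rho>" shows "poisson_kernel \<rho> z \<in> borel_measurable borel"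
  using continuous_on_poisson_kernel[OF assms] by (rule borel_measurable_continuous_onI)

text \<open>Cauchy's formula for g times (\<rho>^2 - |z|^2) / (\<rho>^2 - cnj z * w), whose pole
  lies outside the closed disc. The factor is 1 at w = z, and on the circle, where \<rho>^2 = w *
  cnj w, it turns the Cauchy kernel into the Poisson kernel.\<close>

lemma poisson_integral_formula:
  assumes g: "g holomorphic_on cball 0 \<rho>" and z: "cmod z < \<rho>"
  shows "((\<lambda>t. of_real (poisson_kernel \<rho> z t) * g (of_real \<rho> * cis t)) has_integral g z) {0..2*pi}"
proof -
  have \<rho>: "0 < \<rho>" using z norm_ge_zero[of z] by linarith
  define G where "G w = g w * of_real (\<rho>\<^sup>2 - (cmod z)\<^sup>2) / (of_real (\<rho>\<^sup>2) - cnj z * w)" for w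
  have nz: "of_real (\<rho>\<^sup>2) - cnj z * w \<noteq> 0" if "w \<in> cball 0 \<rho>" for w
  proof
    assume "of_real (\<rho>\<^sup>2) - cnj z * w = 0"
    then have "cmod (cnj z * w) = \<rho>\<^sup>2"
      using \<rho> by (metis eq_iff_diff_eq_0 norm_of_real abs_power2)
    moreover have "cmod (cnj z * w) < \<rho> * \<rho>"
    proof -
      have "cmod z * cmod w \<le> cmod z * \<rho>" using that by (intro mult_left_mono) auto
      also have "\<dots> < \<rho> * \<rho>" using z \<rho> by (intro mult_strict_right_mono)
      finally show ?thesis by (simp add: norm_mult)
    qed
    ultimately show False by (simp add: power2_eq_square)
  qed
  have "G holomorphic_on cball 0 \<rho>"
    unfolding G_def using nz by (intro holomorphic_intros g) auto
  then have "((\<lambda>u. G u / (u - z)) has_contour_integral (2 * of_real pi * \<i> * G z)) (circlepath 0 \<rho>)"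
    using z by (intro Cauchy_integral_circlepath_simple) auto
  then have "((\<lambda>t. G (0 + of_real \<rho> * cis t) / (0 + of_real \<rho> * cis t - z) * of_real \<rho> * \<i> * cis t)
      has_integral (2 * of_real pi * \<i> * G z)) {0..2*pi}"
    unfolding circlepath_def by (subst (asm) has_contour_integral_part_circlepath_iff) auto
  then have "((\<lambda>t. (1 / (2 * of_real pi * \<i>)) * (G (0 + of_real \<rho> * cis t) / (0 + of_real \<rho> * cis t - z) * of_real \<rho> * \<i> * cis t))
      has_integral ((1 / (2 * of_real pi * \<i>)) * (2 * of_real pi * \<i> * G z))) {0..2*pi}"
    by (rule has_integral_mult_right)
  moreover have "(1 / (2 * of_real pi * \<i>)) * (2 * of_real pi * \<i> * G z) = g z"
  proof -
    have "complex_of_real (\<rho>\<^sup>2) - cnj z * z = of_real (\<rho>\<^sup>2 - (cmod z)\<^sup>2)"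
      by (simp add: complex_norm_square[symmetric] mult.commute)
    moreover have "complex_of_real (\<rho>\<^sup>2) - cnj z * z \<noteq> 0" using nz[of z] z by simp
    ultimately have "G z = g z" unfolding G_def by auto
    then show ?thesis by simp
  qed
  moreover have "(1 / (2 * of_real pi * \<i>)) * (G (0 + of_real \<rho> * cis t) / (0 + of_real \<rho> * cis t - z) * of_real \<rho> * \<i> * cis t)
     = of_real (poisson_kernel \<rho> z t) * g (of_real \<rho> * cis t)" for t
  proof -
    define w where "w = of_real \<rho> * cis t"
    have w: "cmod w = \<rho>" using \<rho> by (simp add: w_def norm_mult)
    have wz: "w - z \<noteq> 0" using circle_point_neq[OF z, of t] by (simp add: w_def)
    have w0: "w \<noteq> 0" using w \<rho> by auto
    have ww: "of_real (\<rho>\<^sup>2) = w * cnj w" using w by (simp add: complex_norm_square[symmetric])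
    have den: "of_real (\<rho>\<^sup>2) - cnj z * w = w * cnj (w - z)" unfolding ww by (simp add: algebra_simps)
    have abs: "complex_of_real ((cmod (w - z))\<^sup>2) = (w - z) * cnj (w - z)"
      by (rule complex_norm_square)
    have "(1 / (2 * of_real pi * \<i>)) * (G w / (w - z) * (w * \<i>)) =
        g w * of_real (\<rho>\<^sup>2 - (cmod z)\<^sup>2) / (2 * of_real pi * ((w - z) * cnj (w - z)))"
      unfolding G_def den using w0 by simp
    also have "\<dots> = of_real (poisson_kernel \<rho> z t) * g w"
      unfolding abs[symmetric] poisson_kernel_def w_def[symmetric] by simp
    finally show ?thesis by (simp add: w_def mult_ac)
  qed
  ultimately show ?thesis by simp
qed

lemma poisson_kernel_integral:
  assumes "cmod z < \<rho>"
  shows "(\<integral>\<^sup>+ t\<in>{0..2*pi}. ennreal (poisson_kernel \<rho> z t) \<partial>lborel) = 1"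
proof -
  have "((\<lambda>t. complex_of_real (poisson_kernel \<rho> z t)) has_integral 1) {0..2*pi}"
    using poisson_integral_formula[of "\<lambda>_. 1" \<rho> z] assms by simp
  then have "((\<lambda>t. Re (complex_of_real (poisson_kernel \<rho> z t))) has_integral Re 1) {0..2*pi}"
    by (rule has_integral_Re)
  then have "((\<lambda>t. poisson_kernel \<rho> z t) has_integral 1) {0..2*pi}" by simp
  then have "(\<integral>\<^sup>+ t. ennreal (poisson_kernel \<rho> z t) * indicator {0..2*pi} t \<partial>lborel) = ennreal 1"
    using assms poisson_kernel_nonneg[of z \<rho>]
    by (intro nn_integral_has_integral_lebesgue') auto
  then show ?thesis by simp
qed

text \<open>Subharmonicity of \<open>cmod g\<close> in Poisson form. The formula is applied to g
  rotated by \<theta>, so the kernel is independent of \<theta> and the right-hand side is an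
  average of rotations; this is what makes Minkowski's inequality applicable to it.\<close>

lemma poisson_majorization:
  assumes g: "g holomorphic_on unit_disc" and z: "cmod z < \<rho>" and \<rho>: "\<rho> < 1"
  shows "ennreal (cmod (g (cis \<theta> * z))) \<le>
    (\<integral>\<^sup>+ t\<in>{0..2*pi}. ennreal (poisson_kernel \<rho> z t * cmod (g (of_real \<rho> * cis (\<theta> + t)))) \<partial>lborel)"
proof -
  have \<rho>0: "0 < \<rho>" using z norm_ge_zero[of z] by linarith
  define h where "h w = g (cis \<theta> * w)" for w
  have h: "h holomorphic_on cball 0 \<rho>"
  proof -
    have "(g \<circ> (\<lambda>w. cis \<theta> * w)) holomorphic_on cball 0 \<rho>"
      using \<rho> by (intro holomorphic_on_compose_gen[OF _ g] holomorphic_intros) (auto simp: norm_mult)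
    then show ?thesis unfolding h_def[abs_def] by (simp add: o_def)
  qed
  define H where "H t = poisson_kernel \<rho> z t * cmod (g (of_real \<rho> * cis (\<theta> + t)))" for t
  have Hh: "H t = norm (of_real (poisson_kernel \<rho> z t) * h (of_real \<rho> * cis t))" for t
    using poisson_kernel_nonneg[of z \<rho> t] z by (simp add: H_def h_def norm_mult cis_mult[symmetric] mult_ac)
  have contH: "continuous_on A H" for A
    unfolding H_def using z \<rho> \<rho>0
    by (intro continuous_intros continuous_on_poisson_kernel continuous_on_compose2[OF holomorphic_on_imp_continuous_on[OF g]])
       (auto simp: norm_mult)
  have int: "(H has_integral integral {0..2*pi} H) {0..2*pi}"
    using contH integrable_continuous_real integrable_integral by blast
  have "norm (h z) \<le> integral {0..2*pi} H \<bullet> 1"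
    by (rule has_integral_norm_bound_integral_component[OF poisson_integral_formula[OF h z] int])
       (simp add: Hh[symmetric])
  then have "ennreal (norm (h z)) \<le> ennreal (integral {0..2*pi} H)" by (simp add: ennreal_leI)
  also have "ennreal (integral {0..2*pi} H) = (\<integral>\<^sup>+ t. ennreal (H t) * indicator {0..2*pi} t \<partial>lborel)"
    by (rule nn_integral_has_integral_lebesgue'[OF _ int, symmetric]) (simp add: Hh)
  finally show ?thesis unfolding h_def H_def by simp
qed

section \<open>Dyadic radii and convex blocks of Stolz regions\<close>

definition dyadic_radius :: "nat \<Rightarrow> real" where
  "dyadic_radius n = 1 - (1/2) ^ n"

lemma dyadic_radius_nonneg: "0 \<le> dyadic_radius n"
  and dyadic_radius_less_1: "dyadic_radius n < 1"
  and one_minus_dyadic_radius: "1 - dyadic_radius n = (1/2) ^ n"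
  by (auto simp: dyadic_radius_def power_le_one)

lemma dyadic_radius_less: "m < n \<Longrightarrow> dyadic_radius m < dyadic_radius n"
  by (simp add: dyadic_radius_def power_strict_decreasing)

lemma dyadic_radius_le: "m \<le> n \<Longrightarrow> dyadic_radius m \<le> dyadic_radius n"
  by (simp add: dyadic_radius_def power_decreasing)

text \<open>Contains the points of the Stolz region of aperture A at vertex 1 whose modulus lies
  between x_n and x_(n+1). An intersection of two discs is used because it is convex, so that a
  derivative bound gives a Lipschitz bound; other vertices are reached by rotation.\<close>

definition stolz_block :: "real \<Rightarrow> nat \<Rightarrow> complex set" where
  "stolz_block A n = cball 0 (dyadic_radius (n + 1)) \<inter> cball 1 (A * (1/2) ^ n)"

lemma convex_stolz_block: "convex (stolz_block A n)"
  unfolding stolz_block_def by (intro convex_Int convex_cball)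

lemma stolz_block_subset: "stolz_block A n \<subseteq> unit_disc"
  using dyadic_radius_less_1[of "n + 1"] by (auto simp: stolz_block_def)

text \<open>The factor \<open>4 A\<close> compares the numerators of the two kernels, \<open>4 A + 5\<close> the distances in their denominators.\<close>

lemma poisson_kernel_stolz_block:
  assumes A: "1 \<le> A" and z: "z \<in> stolz_block A n"
  shows "poisson_kernel (dyadic_radius (n + 2)) z t \<le>
    4 * A * (4 * A + 5)\<^sup>2 * poisson_kernel (dyadic_radius (n + 2)) (of_real (dyadic_radius n)) t"
proof -
  define d where "d = (1/2 :: real) ^ n"
  define \<rho> where "\<rho> = dyadic_radius (n + 2)"
  define r where "r = dyadic_radius n"
  have d: "0 < d" "d \<le> 1" by (auto simp: d_def power_le_one)
  have \<rho>: "\<rho> = 1 - d / 4" and r: "r = 1 - d"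
    by (auto simp: \<rho>_def r_def dyadic_radius_def d_def)
  have z1: "cmod z \<le> 1 - d / 2" and z2: "cmod (z - 1) \<le> A * d"
    using z by (auto simp: stolz_block_def dyadic_radius_def d_def dist_norm norm_minus_commute)
  define w where "w = of_real \<rho> * cis t"
  have "0 \<le> \<rho>" unfolding \<rho>_def by (rule dyadic_radius_nonneg)
  then have w: "cmod w = \<rho>" by (simp add: w_def norm_mult)
  have wz: "d / 4 \<le> cmod (w - z)"
    using norm_triangle_ineq2[of w z] w z1 \<rho> by linarith
  have wr: "cmod (w - of_real r) \<le> (4 * A + 5) * cmod (w - z)"
  proof -
    have "cmod (w - of_real r) \<le> cmod (w - z) + cmod (z - 1) + cmod (1 - of_real r)"
      using norm_triangle_ineq[of "w - z" "z - 1"] norm_triangle_ineq[of "w - 1" "1 - of_real r"] by simp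
    also have "cmod (1 - of_real r) = d"
      using d unfolding r by simp
    also have "cmod (w - z) + cmod (z - 1) + d \<le> cmod (w - z) + (A + 1) * d"
      using z2 by (simp add: algebra_simps)
    also have "(A + 1) * d \<le> (A + 1) * (4 * cmod (w - z))"
      using wz A by (intro mult_left_mono) auto
    finally show ?thesis by (simp add: algebra_simps)
  qed
  have "1 - cmod z \<le> A * d"
    using norm_triangle_ineq2[of 1 "z"] z2 by (simp add: norm_minus_commute)
  then have num: "\<rho>\<^sup>2 - (cmod z)\<^sup>2 \<le> 4 * A * (\<rho>\<^sup>2 - r\<^sup>2)"
  proof -
    assume zA: "1 - cmod z \<le> A * d"
    have "\<rho>\<^sup>2 - (cmod z)\<^sup>2 \<le> 1 - (cmod z)\<^sup>2"
      using \<rho> d by (simp add: power_le_one)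
    also have "\<dots> = (1 - cmod z) * (1 + cmod z)" by (simp add: power2_eq_square algebra_simps)
    also have "\<dots> \<le> A * d * 2" using zA z1 d A by (intro mult_mono) auto
    also have "\<dots> \<le> 4 * A * (3/4 * d * (3/4))" using A d by simp
    also have "\<dots> \<le> 4 * A * ((\<rho> - r) * (\<rho> + r))"
      using A d \<rho> r by (intro mult_left_mono mult_mono) auto
    finally show ?thesis by (simp add: power2_eq_square algebra_simps)
  qed
  have wz0: "0 < cmod (w - z)" using wz d by linarith
  have wr0: "0 < cmod (w - of_real r)"
  proof -
    have "r < \<rho>" "0 \<le> r" using d \<rho> r by linarith+
    then show ?thesis using circle_point_neq[of "of_real r" \<rho> t] by (simp add: w_def)
  qed
  have nn: "0 \<le> 4 * A * (\<rho>\<^sup>2 - r\<^sup>2)" using A d \<rho> r by (intro mult_nonneg_nonneg) (auto intro!: power_mono)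
  have "poisson_kernel \<rho> z t = (\<rho>\<^sup>2 - (cmod z)\<^sup>2) / (2 * pi * (cmod (w - z))\<^sup>2)"
    by (simp add: poisson_kernel_def w_def)
  also have "\<dots> \<le> (4 * A * (\<rho>\<^sup>2 - r\<^sup>2)) / (2 * pi * (cmod (w - z))\<^sup>2)"
    using num by (intro divide_right_mono) auto
  also have "\<dots> \<le> (4 * A * (\<rho>\<^sup>2 - r\<^sup>2)) * ((4 * A + 5)\<^sup>2 / (2 * pi * (cmod (w - of_real r))\<^sup>2))"
  proof -
    have "(cmod (w - of_real r))\<^sup>2 \<le> (4 * A + 5)\<^sup>2 * (cmod (w - z))\<^sup>2"
      using power_mono[OF wr, of 2] by (simp add: power_mult_distrib)
    then have "1 / (2 * pi * (cmod (w - z))\<^sup>2) \<le> (4 * A + 5)\<^sup>2 / (2 * pi * (cmod (w - of_real r))\<^sup>2)"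
      using wz0 wr0 by (simp add: field_simps)
    from mult_left_mono[OF this nn] show ?thesis by simp
  qed
  also have "\<dots> = 4 * A * (4 * A + 5)\<^sup>2 * poisson_kernel \<rho> (of_real r) t"
    unfolding poisson_kernel_def w_def by simp
  finally show ?thesis by (simp add: \<rho>_def r_def)
qed

lemma holomorphic_circle_bounded:
  assumes g: "g holomorphic_on unit_disc" and \<rho>: "0 \<le> \<rho>" "\<rho> < 1"
  obtains B where "0 \<le> B" "\<And>t. cmod (g (of_real \<rho> * cis t)) \<le> B"
proof -
  have "compact (g ` cball 0 \<rho>)"
    using \<rho> by (intro compact_continuous_image holomorphic_on_imp_continuous_on holomorphic_on_subset[OF g]) auto
  then obtain B where "\<And>w. w \<in> cball 0 \<rho> \<Longrightarrow> cmod (g w) \<le> B"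
    using compact_imp_bounded bounded_iff by (metis imageI)
  then have "cmod (g (of_real \<rho> * cis t)) \<le> \<bar>B\<bar>" for t
    using \<rho> by (intro order_trans[OF _ abs_ge_self]) (auto simp: norm_mult)
  then show thesis by (intro that[of "\<bar>B\<bar>"]) auto
qed

definition circle_poisson :: "real \<Rightarrow> real \<Rightarrow> (complex \<Rightarrow> complex) \<Rightarrow> real \<Rightarrow> real" where
  "circle_poisson \<rho> r g \<theta> = enn2real (\<integral>\<^sup>+ t\<in>{0..2*pi}.
     ennreal (poisson_kernel \<rho> (of_real r) t * cmod (g (of_real \<rho> * cis (\<theta> + t)))) \<partial>lborel)"

lemma circle_poisson_nonneg: "0 \<le> circle_poisson \<rho> r g \<theta>"
  by (simp add: circle_poisson_def)

lemma ennreal_circle_poisson: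
  assumes g: "g holomorphic_on unit_disc" and r: "0 \<le> r" "r < \<rho>" "\<rho> < 1"
  shows "ennreal (circle_poisson \<rho> r g \<theta>) = (\<integral>\<^sup>+ t\<in>{0..2*pi}.
     ennreal (poisson_kernel \<rho> (of_real r) t * cmod (g (of_real \<rho> * cis (\<theta> + t)))) \<partial>lborel)"
    (is "_ = ?I")
proof -
  have "0 \<le> \<rho>" using r by simp
  then obtain B where B: "0 \<le> B" "\<And>t. cmod (g (of_real \<rho> * cis t)) \<le> B"
    using holomorphic_circle_bounded[OF g _ r(3)] by metis
  have r': "cmod (of_real r) < \<rho>" using r by simp
  note [measurable] = poisson_kernel_measurable[OF r']
  have "?I \<le> (\<integral>\<^sup>+ t. ennreal B * (ennreal (poisson_kernel \<rho> (of_real r) t) * indicator {0..2*pi} t) \<partial>lborel)"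
  proof (intro nn_integral_mono)
    fix t
    have "poisson_kernel \<rho> (of_real r) t * cmod (g (of_real \<rho> * cis (\<theta> + t))) \<le> B * poisson_kernel \<rho> (of_real r) t"
      by (subst mult.commute[of B]) (rule mult_left_mono[OF B(2) poisson_kernel_nonneg[OF less_imp_le[OF r']]])
    then show "ennreal (poisson_kernel \<rho> (of_real r) t * cmod (g (of_real \<rho> * cis (\<theta> + t)))) * indicator {0..2*pi} t
      \<le> ennreal B * (ennreal (poisson_kernel \<rho> (of_real r) t) * indicator {0..2*pi} t)"
      using B(1) by (auto simp: indicator_def ennreal_mult'[symmetric] intro!: ennreal_leI)
  qed
  also have "\<dots> = ennreal B"
    using poisson_kernel_integral[OF r'] by (subst nn_integral_cmult) simp_all
  finally have "?I \<noteq> top" by (auto simp: top_unique)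
  then show ?thesis by (simp add: circle_poisson_def less_top)
qed

text \<open>The circle has radius x_(n+2), not x_(n+1), so that it keeps distance 2^-n / 4 from
  block n. This is comparable to the size of the block, and therefore the kernels at all its points
  are dominated by the one at x_n.\<close>

definition poisson_majorant :: "(complex \<Rightarrow> complex) \<Rightarrow> nat \<Rightarrow> real \<Rightarrow> real" where
  "poisson_majorant g n = circle_poisson (dyadic_radius (n + 2)) (dyadic_radius n) g"

lemma poisson_majorant_nonneg: "0 \<le> poisson_majorant g n \<theta>"
  by (simp add: poisson_majorant_def circle_poisson_nonneg)

lemma ennreal_poisson_majorant:
  assumes g: "g holomorphic_on unit_disc"
  shows "ennreal (poisson_majorant g n \<theta>) = (\<integral>\<^sup>+ t\<in>{0..2*pi}.
     ennreal (poisson_kernel (dyadic_radius (n + 2)) (of_real (dyadic_radius n)) t *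
       cmod (g (of_real (dyadic_radius (n + 2)) * cis (\<theta> + t)))) \<partial>lborel)"
  unfolding poisson_majorant_def
  by (intro ennreal_circle_poisson g dyadic_radius_nonneg dyadic_radius_less_1 dyadic_radius_less) simp

text \<open>A Harnack estimate: one number controls g on a whole rotated block, up to a constant
  depending on the aperture only. In particular the majorant, and the null set where its series
  diverges, serve all apertures at once.\<close>

lemma cmod_le_poisson_majorant:
  assumes g: "g holomorphic_on unit_disc" and A: "1 \<le> A" and z: "z \<in> stolz_block A n"
  shows "cmod (g (cis \<theta> * z)) \<le> 4 * A * (4 * A + 5)\<^sup>2 * poisson_majorant g n \<theta>"
proof -
  define \<kappa> where "\<kappa> = 4 * A * (4 * A + 5)\<^sup>2"
  have \<kappa>: "0 \<le> \<kappa>" using A by (simp add: \<kappa>_def)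
  have r: "cmod (of_real (dyadic_radius n)) < dyadic_radius (n + 2)"
    using dyadic_radius_less[of n "n + 2"] dyadic_radius_nonneg[of n] by simp
  note [measurable] = poisson_kernel_measurable[OF r]
  have "continuous_on UNIV (\<lambda>t. g (of_real (dyadic_radius (n + 2)) * cis (\<theta> + t)))"
    using dyadic_radius_nonneg[of "n + 2"] dyadic_radius_less_1[of "n + 2"]
    by (intro continuous_intros continuous_on_compose2[OF holomorphic_on_imp_continuous_on[OF g]]) (auto simp: norm_mult)
  then have [measurable]: "(\<lambda>t. g (of_real (dyadic_radius (n + 2)) * cis (\<theta> + t))) \<in> borel_measurable borel"
    by (rule borel_measurable_continuous_onI)
  have "cmod z < dyadic_radius (n + 2)"
    using z dyadic_radius_less[of "n + 1" "n + 2"] by (auto simp: stolz_block_def)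
  then have "ennreal (cmod (g (cis \<theta> * z))) \<le> (\<integral>\<^sup>+ t\<in>{0..2*pi}. ennreal (poisson_kernel (dyadic_radius (n + 2)) z t *
       cmod (g (of_real (dyadic_radius (n + 2)) * cis (\<theta> + t)))) \<partial>lborel)"
    using poisson_majorization[OF g _ dyadic_radius_less_1] by blast
  also have "\<dots> \<le> (\<integral>\<^sup>+ t. ennreal \<kappa> * (ennreal (poisson_kernel (dyadic_radius (n + 2)) (of_real (dyadic_radius n)) t *
       cmod (g (of_real (dyadic_radius (n + 2)) * cis (\<theta> + t)))) * indicator {0..2*pi} t) \<partial>lborel)"
    using \<kappa> poisson_kernel_stolz_block[OF A z, folded \<kappa>_def]
    by (intro nn_integral_mono)
       (auto simp: indicator_def ennreal_mult'[symmetric] mult.assoc[symmetric] intro!: ennreal_leI mult_right_mono)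
  also have "\<dots> = ennreal \<kappa> * ennreal (poisson_majorant g n \<theta>)"
    unfolding ennreal_poisson_majorant[OF g] by (rule nn_integral_cmult) measurable
  also have "\<dots> = ennreal (\<kappa> * poisson_majorant g n \<theta>)"
    using \<kappa> by (simp add: ennreal_mult' poisson_majorant_nonneg)
  finally show ?thesis
    using \<kappa> poisson_majorant_nonneg[of g n \<theta>] by (simp add: \<kappa>_def ennreal_le_iff)
qed

lemma stolz_block_lipschitz:
  assumes f: "f holomorphic_on unit_disc" and A: "1 \<le> A" and z: "z \<in> stolz_block A n" "w \<in> stolz_block A n"
  shows "cmod (f (cis \<theta> * z) - f (cis \<theta> * w)) \<le>
    4 * A * (4 * A + 5)\<^sup>2 * poisson_majorant (deriv f) n \<theta> * cmod (z - w)"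
proof (rule field_differentiable_bound[where f = "\<lambda>z. f (cis \<theta> * z)" and f' = "\<lambda>z. deriv f (cis \<theta> * z) * cis \<theta>"])
  show "convex (stolz_block A n)" by (rule convex_stolz_block)
  fix u assume u: "u \<in> stolz_block A n"
  then have "cis \<theta> * u \<in> unit_disc" using stolz_block_subset[of A n] by (auto simp: norm_mult)
  then have "(f has_field_derivative deriv f (cis \<theta> * u)) (at (cis \<theta> * u))"
    by (rule holomorphic_derivI[OF f open_ball])
  then show "((\<lambda>z. f (cis \<theta> * z)) has_field_derivative deriv f (cis \<theta> * u) * cis \<theta>) (at u within stolz_block A n)"
    by (rule DERIV_chain2[OF _ DERIV_cmult_Id])
  have "deriv f holomorphic_on unit_disc" using f by (intro holomorphic_deriv) auto
  from cmod_le_poisson_majorant[OF this A u]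
  show "cmod (deriv f (cis \<theta> * u) * cis \<theta>) \<le> 4 * A * (4 * A + 5)\<^sup>2 * poisson_majorant (deriv f) n \<theta>"
    by (simp add: norm_mult)
qed (use z in auto)

section \<open>Non-tangential limits\<close>

lemma cmod_cis_minus_1: "cmod (cis h - 1) \<le> \<bar>h\<bar>"
proof -
  have "cis h - 1 = cis (h/2) * (cis (h/2) - cis (- (h/2)))"
    by (simp add: algebra_simps cis_mult)
  also have "cis (h/2) - cis (- (h/2)) = 2 * \<i> * of_real (sin (h/2))"
    by (simp add: complex_eq_iff)
  finally have "cmod (cis h - 1) = 2 * \<bar>sin (h/2)\<bar>" by (simp add: norm_mult)
  also have "\<dots> \<le> 2 * \<bar>h/2\<bar>" by (intro mult_left_mono abs_sin_x_le_abs_x) auto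
  finally show ?thesis by simp
qed

text \<open>Gives uniqueness of the limit, without which the description operator in
  \<open>boundary_value\<close> says nothing. The radius lies in every Stolz region; aperture 2 is
  one choice.\<close>

lemma has_nontangential_limit_radial:
  assumes L: "has_nontangential_limit f L \<zeta>" and \<zeta>: "cmod \<zeta> = 1"
  shows "(\<lambda>n. f (\<zeta> * of_real (dyadic_radius n))) \<longlonglongrightarrow> L"
proof -
  have "filterlim (\<lambda>n. \<zeta> * of_real (dyadic_radius n)) (at \<zeta> within stolz_region 2 \<zeta>) sequentially"
    unfolding filterlim_at
  proof
    show "(\<lambda>n. \<zeta> * of_real (dyadic_radius n)) \<longlonglongrightarrow> \<zeta>"
    proof -
      have "(\<lambda>n. \<zeta> * of_real (1 - (1/2) ^ n)) \<longlonglongrightarrow> \<zeta> * of_real (1 - 0)"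
        by (intro tendsto_intros LIMSEQ_power_zero) auto
      then show ?thesis by (simp add: dyadic_radius_def)
    qed
    show "\<forall>\<^sub>F n in sequentially. \<zeta> * of_real (dyadic_radius n) \<in> stolz_region 2 \<zeta>
        \<and> \<zeta> * of_real (dyadic_radius n) \<noteq> \<zeta>"
    proof (intro always_eventually allI)
      fix n
      have n: "cmod (\<zeta> * of_real (dyadic_radius n)) = dyadic_radius n"
        using \<zeta> dyadic_radius_nonneg[of n] by (simp add: norm_mult)
      have "\<zeta> * of_real (dyadic_radius n) - \<zeta> = - \<zeta> * of_real ((1/2)^n)"
        by (simp add: dyadic_radius_def algebra_simps)
      then have "cmod (\<zeta> * of_real (dyadic_radius n) - \<zeta>) = (1/2)^n"
        using \<zeta> by (simp add: norm_mult norm_power norm_divide del: of_real_power)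
      then show "\<zeta> * of_real (dyadic_radius n) \<in> stolz_region 2 \<zeta> \<and> \<zeta> * of_real (dyadic_radius n) \<noteq> \<zeta>"
        using n \<zeta> dyadic_radius_less_1[of n] one_minus_dyadic_radius[of n]
        by (auto simp: stolz_region_def right_diff_distrib)
    qed
  qed
  moreover have "(f \<longlongrightarrow> L) (at \<zeta> within stolz_region 2 \<zeta>)"
    using L by (simp add: has_nontangential_limit_def)
  ultimately show ?thesis by (rule filterlim_compose[rotated])
qed

lemma boundary_value_eqI:
  assumes L: "has_nontangential_limit f L \<zeta>" and \<zeta>: "cmod \<zeta> = 1"
  shows "boundary_value f \<zeta> = L"
  unfolding boundary_value_def
proof (rule the_equality)
  fix L' assume "has_nontangential_limit f L' \<zeta>"
  then show "L' = L"
    using has_nontangential_limit_radial[OF L \<zeta>] has_nontangential_limit_radial[of f L' \<zeta>] \<zeta>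
      LIMSEQ_unique by blast
qed (rule L)

lemma dyadic_radius_between:
  assumes "dyadic_radius N \<le> x" "x < 1"
  obtains n where "N \<le> n" "dyadic_radius n \<le> x" "x < dyadic_radius (n + 1)"
proof -
  have "\<exists>m. x < dyadic_radius m"
    using real_arch_pow_inv[of "1 - x" "1/2"] assms by (auto simp: dyadic_radius_def algebra_simps)
  define m where "m = (LEAST m. x < dyadic_radius m)"
  have m: "x < dyadic_radius m"
    unfolding m_def using \<open>\<exists>m. x < dyadic_radius m\<close> by (rule LeastI_ex)
  have "N < m"
    using m assms(1) dyadic_radius_le[of m N] by (meson leI le_less_trans less_irrefl order_trans)
  then obtain n where n: "m = Suc n" by (cases m) auto
  have "\<not> x < dyadic_radius n" using not_less_Least[of n "\<lambda>m. x < dyadic_radius m"] n by (simp add: m_def)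
  then show thesis using that[of n] m \<open>N < m\<close> n by auto
qed

lemma dyadic_radius_in_stolz_block:
  assumes "1 \<le> A"
  shows "of_real (dyadic_radius n) \<in> stolz_block A n" "of_real (dyadic_radius (n + 1)) \<in> stolz_block A n"
proof -
  have *: "cmod (1 - of_real (dyadic_radius m)) = (1/2) ^ m" for m
    using one_minus_dyadic_radius[of m] by (metis abs_of_nonneg norm_of_real of_real_1 of_real_diff zero_le_divide_1_iff zero_le_numeral zero_le_power)
  have "(1/2) ^ n \<le> A * (1/2) ^ n" "(1/2) ^ (n + 1) \<le> A * (1/2) ^ n"
    using mult_right_mono[OF assms, of "(1/2)^n"] by (auto intro: order_trans)
  then show "of_real (dyadic_radius n) \<in> stolz_block A n" "of_real (dyadic_radius (n + 1)) \<in> stolz_block A n"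
    unfolding stolz_block_def mem_cball Int_iff dist_norm *
    using dyadic_radius_nonneg dyadic_radius_le[of n "n + 1"] by auto
qed

definition majorant_tail :: "(complex \<Rightarrow> complex) \<Rightarrow> nat \<Rightarrow> real \<Rightarrow> real" where
  "majorant_tail g k \<theta> = (\<Sum>j. (1/2) ^ (k + j) * poisson_majorant g (k + j) \<theta>)"

text \<open>Along the radius the increments of f between x_n and x_(n+1) are bounded by a summable
  sequence, so f converges there and the tail of the series bounds the error. A point of a Stolz
  region with modulus in the n-th range lies in the same block as the radial point x_n, and the
  oscillation over that block tends to 0.\<close>

lemma nontangential_limit_exists:
  assumes f: "f holomorphic_on unit_disc"
    and S: "summable (\<lambda>n. (1/2) ^ n * poisson_majorant (deriv f) n \<theta>)"
  shows "has_nontangential_limit f (boundary_value f (cis \<theta>)) (cis \<theta>)" (is ?A)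
    and "cmod (boundary_value f (cis \<theta>) - f (cis \<theta> * of_real (dyadic_radius k)))
      \<le> 324 * majorant_tail (deriv f) k \<theta>" (is ?B)
proof -
  define u where "u n = (1/2) ^ n * poisson_majorant (deriv f) n \<theta>" for n
  define F where "F n = f (cis \<theta> * of_real (dyadic_radius n))" for n
  have u0: "0 \<le> u n" for n by (simp add: u_def poisson_majorant_nonneg)
  have su: "summable u" using S unfolding u_def .
  \<comment> \<open>324 = 4 * 1 * (4 * 1 + 5)^2 is the block constant for A = 1, enough for the
    radius itself.\<close>
  have step: "cmod (F (Suc n) - F n) \<le> 324 * u n" for n
  proof -
    have "cmod (F (Suc n) - F n) \<le> 4 * 1 * (4 * 1 + 5)\<^sup>2 * poisson_majorant (deriv f) n \<theta> *
        cmod (of_real (dyadic_radius (n + 1)) - of_real (dyadic_radius n))"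
      unfolding F_def using dyadic_radius_in_stolz_block[of 1 n]
      by (simp only: Suc_eq_plus1) (rule stolz_block_lipschitz[OF f]; simp)
    also have "\<dots> \<le> 4 * 1 * (4 * 1 + 5)\<^sup>2 * poisson_majorant (deriv f) n \<theta> * (1/2) ^ n"
    proof (rule mult_left_mono)
      have "cmod (of_real (dyadic_radius (n + 1)) - of_real (dyadic_radius n)) = \<bar>dyadic_radius (n + 1) - dyadic_radius n\<bar>"
        by (metis norm_of_real of_real_diff)
      then show "cmod (of_real (dyadic_radius (n + 1)) - of_real (dyadic_radius n)) \<le> (1/2) ^ n"
        by (simp add: dyadic_radius_def)
    qed (simp add: poisson_majorant_nonneg)
    finally show ?thesis by (simp add: u_def mult_ac)
  qed
  have sF: "summable (\<lambda>n. norm (F (Suc n) - F n))"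
    using step by (intro summable_comparison_test'[OF summable_mult[OF su, of 324], of 0]) auto
  then have "summable (\<lambda>n. F (Suc n) - F n)" by (rule summable_norm_cancel)
  then have "(\<lambda>n. (\<Sum>i<n. F (Suc i) - F i) + F 0) \<longlonglongrightarrow> (\<Sum>i. F (Suc i) - F i) + F 0"
    by (intro tendsto_intros summable_LIMSEQ)
  then obtain L where L: "F \<longlonglongrightarrow> L" by (simp add: sum_lessThan_telescope)
  have ntl: "has_nontangential_limit f L (cis \<theta>)"
    unfolding has_nontangential_limit_def
  proof (intro allI impI)
    fix a :: real assume a: "1 < a"
    \<comment> \<open>The block constant for aperture a, times the factor 2 a from the distance 2 a
      2^-n between a point of the block and its radial point.\<close>
    define \<kappa> where "\<kappa> = 4 * a * (4 * a + 5)\<^sup>2 * (2 * a)"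
    show "(f \<longlongrightarrow> L) (at (cis \<theta>) within stolz_region a (cis \<theta>))"
    proof (rule tendstoI)
      fix e :: real assume e: "0 < e"
      have "(\<lambda>n. \<kappa> * u n) \<longlonglongrightarrow> \<kappa> * 0" by (intro tendsto_intros summable_LIMSEQ_zero su)
      then have "\<forall>\<^sub>F n in sequentially. \<kappa> * u n < e / 2"
        using e by (intro order_tendstoD(2)) auto
      moreover have "\<forall>\<^sub>F n in sequentially. dist (F n) L < e / 2"
        using L e by (intro tendstoD) auto
      ultimately have "\<forall>\<^sub>F n in sequentially. \<kappa> * u n < e / 2 \<and> dist (F n) L < e / 2"
        by eventually_elim auto
      then obtain N where N: "\<And>n. N \<le> n \<Longrightarrow> \<kappa> * u n < e / 2" "\<And>n. N \<le> n \<Longrightarrow> dist (F n) L < e / 2"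
        unfolding eventually_sequentially by blast
      have close: "dist (f z) L < e" if z: "z \<in> stolz_region a (cis \<theta>)" "dist z (cis \<theta>) < (1/2) ^ N" for z
      proof -
        have zd: "cmod z < 1" "cmod (z - cis \<theta>) < a * (1 - cmod z)"
          using z(1) by (auto simp: stolz_region_def)
        have "1 - cmod z \<le> cmod (z - cis \<theta>)"
          using norm_triangle_ineq2[of "cis \<theta>" z] by (simp add: norm_minus_commute)
        then have "dyadic_radius N \<le> cmod z" using z(2) by (simp add: dyadic_radius_def dist_norm)
        then obtain n where n: "N \<le> n" "dyadic_radius n \<le> cmod z" "cmod z < dyadic_radius (n + 1)"
          using dyadic_radius_between zd(1) by blast
        define w where "w = cis (-\<theta>) * z"
        have zw: "z = cis \<theta> * w" by (simp add: w_def mult.assoc[symmetric] cis_mult)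
        have w1: "cmod w = cmod z" by (simp add: w_def norm_mult)
        have "w - 1 = cis (-\<theta>) * (z - cis \<theta>)" by (simp add: w_def algebra_simps cis_mult)
        then have "cmod (w - 1) = cmod (z - cis \<theta>)" by (simp add: norm_mult)
        also have "\<dots> \<le> a * (1 - cmod z)" using zd by simp
        also have "\<dots> \<le> a * (1/2) ^ n"
          using n(2) a by (intro mult_left_mono) (auto simp: dyadic_radius_def)
        finally have w2: "cmod (w - 1) \<le> a * (1/2) ^ n" .
        then have wb: "w \<in> stolz_block a n"
          using w1 n(3) by (simp add: stolz_block_def dist_norm norm_minus_commute)
        have rb: "of_real (dyadic_radius n) \<in> stolz_block a n"
          using dyadic_radius_in_stolz_block(1) a by simp
        have dist: "cmod (w - of_real (dyadic_radius n)) \<le> 2 * a * (1/2) ^ n"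
          using norm_triangle_ineq[of "w - 1" "1 - of_real (dyadic_radius n)"] w2 rb
          by (simp add: stolz_block_def dist_norm)
        have "cmod (f z - F n) \<le> 4 * a * (4 * a + 5)\<^sup>2 * poisson_majorant (deriv f) n \<theta> * cmod (w - of_real (dyadic_radius n))"
          unfolding zw F_def using stolz_block_lipschitz[OF f _ wb rb] a by simp
        also have "\<dots> \<le> 4 * a * (4 * a + 5)\<^sup>2 * poisson_majorant (deriv f) n \<theta> * (2 * a * (1/2) ^ n)"
          using dist a poisson_majorant_nonneg by (intro mult_left_mono) auto
        also have "\<dots> = \<kappa> * u n" by (simp add: \<kappa>_def u_def)
        finally have "dist (f z) (F n) < e / 2" using N(1)[OF n(1)] by (simp add: dist_norm)
        then show ?thesis using N(2)[OF n(1)] dist_triangle[of "f z" L "F n"] by simp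
      qed
      show "\<forall>\<^sub>F z in at (cis \<theta>) within stolz_region a (cis \<theta>). dist (f z) L < e"
        unfolding eventually_at using close by (intro exI[of _ "(1/2) ^ N"]) auto
    qed
  qed
  then have bv: "boundary_value f (cis \<theta>) = L" by (intro boundary_value_eqI) auto
  show ?A using ntl bv by simp
  have sums: "(\<lambda>j. F (Suc (k + j)) - F (k + j)) sums (L - F k)"
    using telescope_sums[of "\<lambda>j. F (k + j)" L] LIMSEQ_ignore_initial_segment[OF L, of k] by (simp add: add.commute)
  have "cmod (L - F k) \<le> (\<Sum>j. cmod (F (Suc (k + j)) - F (k + j)))"
    using summable_norm[of "\<lambda>j. F (Suc (k + j)) - F (k + j)"] sums_unique[OF sums]
      summable_ignore_initial_segment[OF sF, of k] by (simp add: add.commute)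
  also have "\<dots> \<le> (\<Sum>j. 324 * u (k + j))"
    using step summable_ignore_initial_segment[OF sF, of k] summable_ignore_initial_segment[OF su, of k]
    by (intro suminf_le summable_mult) (auto simp: add.commute)
  also have "\<dots> = 324 * (\<Sum>j. u (k + j))"
    using summable_ignore_initial_segment[OF su, of k] by (intro suminf_mult) (auto simp: add.commute)
  finally show ?B unfolding bv u_def F_def majorant_tail_def .
qed

text \<open>The two boundary points are joined by two radial segments down to radius x_k and an arc
  there. As h \<le> 2^-k = 1 - x_k, the arc's endpoints lie in a block of aperture 2. Each radial
  segment costs 324 and the arc 8 * 13^2 = 1352 times a tail, and 324 + 1352 \<le> 2000.\<close>

lemma boundary_value_difference:
  assumes f: "f holomorphic_on unit_disc"
    and S: "summable (\<lambda>n. (1/2) ^ n * poisson_majorant (deriv f) n \<theta>)"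
      "summable (\<lambda>n. (1/2) ^ n * poisson_majorant (deriv f) n (\<theta> + h))"
    and h: "0 \<le> h" "h \<le> (1/2) ^ k"
  shows "cmod (boundary_value f (cis (\<theta> + h)) - boundary_value f (cis \<theta>)) \<le> 2000 * (majorant_tail (deriv f) k \<theta> + majorant_tail (deriv f) k (\<theta> + h))"
proof -
  let ?T = "majorant_tail (deriv f)"
  define r where "r = dyadic_radius k"
  have r: "0 \<le> r" "r < 1" "1 - r = (1/2) ^ k"
    by (simp_all add: r_def dyadic_radius_nonneg dyadic_radius_less_1 one_minus_dyadic_radius)
  define z where "z = of_real r * cis h"
  have ch: "cmod (cis h - 1) \<le> (1/2) ^ k"
    using cmod_cis_minus_1[of h] h by linarith
  have z: "z \<in> stolz_block 2 k"
  proof -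
    have "z - 1 = (of_real r - 1) * cis h + (cis h - 1)" by (simp add: z_def algebra_simps)
    then have "cmod (z - 1) \<le> cmod ((of_real r - 1) * cis h) + cmod (cis h - 1)"
      by (metis norm_triangle_ineq)
    also have "cmod ((of_real r - 1) * cis h) = cmod (of_real (r - 1))" by (simp add: norm_mult)
    also have "\<dots> = (1/2) ^ k" using r by (subst norm_of_real) simp
    finally have "cmod (z - 1) \<le> 2 * (1/2) ^ k" using ch by simp
    moreover have "cmod z \<le> dyadic_radius (k + 1)"
      using r dyadic_radius_le[of k "k + 1"] by (simp add: z_def norm_mult r_def)
    ultimately show ?thesis by (simp add: stolz_block_def dist_norm norm_minus_commute)
  qed
  have rb: "of_real r \<in> stolz_block 2 k"
    unfolding r_def by (rule dyadic_radius_in_stolz_block) simp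
  have zr: "cmod (z - of_real r) \<le> (1/2) ^ k"
  proof -
    have "z - of_real r = of_real r * (cis h - 1)" by (simp add: z_def algebra_simps)
    then have "cmod (z - of_real r) = r * cmod (cis h - 1)" using r by (simp add: norm_mult)
    also have "\<dots> \<le> 1 * (1/2) ^ k" using r ch by (intro mult_mono) auto
    finally show ?thesis by simp
  qed
  have T0: "0 \<le> ?T k \<phi>" "(1/2) ^ k * poisson_majorant (deriv f) k \<phi> \<le> ?T k \<phi>"
    if "summable (\<lambda>n. (1/2) ^ n * poisson_majorant (deriv f) n \<phi>)" for \<phi>
  proof -
    have s: "summable (\<lambda>j. (1/2) ^ (k + j) * poisson_majorant (deriv f) (k + j) \<phi>)"
      using summable_ignore_initial_segment[OF that, of k] by (simp add: add.commute)
    then show "0 \<le> ?T k \<phi>" unfolding majorant_tail_def by (intro suminf_nonneg) (auto simp: poisson_majorant_nonneg)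
    show "(1/2) ^ k * poisson_majorant (deriv f) k \<phi> \<le> ?T k \<phi>"
      unfolding majorant_tail_def using sum_le_suminf[OF s, of "{0}"] by (auto simp: poisson_majorant_nonneg)
  qed
  have "cmod (f (cis \<theta> * z) - f (cis \<theta> * of_real r)) \<le>
      4 * 2 * (4 * 2 + 5)\<^sup>2 * poisson_majorant (deriv f) k \<theta> * cmod (z - of_real r)"
    by (rule stolz_block_lipschitz[OF f _ z rb]) simp
  also have "\<dots> \<le> 4 * 2 * (4 * 2 + 5)\<^sup>2 * poisson_majorant (deriv f) k \<theta> * (1/2) ^ k"
    using zr poisson_majorant_nonneg by (intro mult_left_mono) auto
  also have "\<dots> \<le> 1352 * ?T k \<theta>"
    using T0(2)[OF S(1)] by (simp add: mult_ac)
  finally have arc: "cmod (f (cis \<theta> * z) - f (cis \<theta> * of_real r)) \<le> 1352 * ?T k \<theta>" .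
  have "cmod (boundary_value f (cis \<theta>) - f (cis \<theta> * of_real r)) \<le> 324 * ?T k \<theta>"
    using nontangential_limit_exists(2)[OF f S(1), of k] unfolding r_def .
  moreover have "cmod (boundary_value f (cis (\<theta> + h)) - f (cis \<theta> * z)) \<le> 324 * ?T k (\<theta> + h)"
    using nontangential_limit_exists(2)[OF f S(2), of k] unfolding r_def z_def
    by (simp add: cis_mult[symmetric] mult_ac)
  moreover have "boundary_value f (cis (\<theta> + h)) - boundary_value f (cis \<theta>) =
      (boundary_value f (cis (\<theta> + h)) - f (cis \<theta> * z)) + (f (cis \<theta> * z) - f (cis \<theta> * of_real r))
      - (boundary_value f (cis \<theta>) - f (cis \<theta> * of_real r))" by simp
  then have "cmod (boundary_value f (cis (\<theta> + h)) - boundary_value f (cis \<theta>)) \<le>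
      cmod (boundary_value f (cis (\<theta> + h)) - f (cis \<theta> * z)) + cmod (f (cis \<theta> * z) - f (cis \<theta> * of_real r))
      + cmod (boundary_value f (cis \<theta>) - f (cis \<theta> * of_real r))"
    by (metis add_right_mono norm_triangle_ineq norm_triangle_ineq4 order_trans)
  ultimately show ?thesis using arc T0(1)[OF S(1)] T0(1)[OF S(2)] by simp
qed

section \<open>The modulus of continuity and integral means\<close>

lemma circle_mean_continuous:
  assumes g: "g holomorphic_on unit_disc" and r: "0 \<le> r" "r < 1"
  shows "continuous_on A (\<lambda>\<theta>. g (of_real r * cis (c + \<theta>)))"
  using r by (intro continuous_intros continuous_on_compose2[OF holomorphic_on_imp_continuous_on[OF g]]) (auto simp: norm_mult)

lemma nn_integral_circle_eq_integral_mean: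
  assumes g: "g holomorphic_on unit_disc" and r: "0 \<le> r" "r < 1" and p: "0 < p"
  shows "(\<integral>\<^sup>+ \<theta>\<in>{0..2*pi}. ennreal (cmod (g (of_real r * cis \<theta>)) powr p) \<partial>lborel) =
    ennreal (2 * pi * integral_mean p r g powr p)"
proof -
  define F where "F \<theta> = cmod (g (of_real r * cis \<theta>)) powr p" for \<theta>
  have cont: "continuous_on A F" for A
    unfolding F_def using p circle_mean_continuous[OF g r, of A 0]
    by (intro continuous_on_powr' continuous_intros) auto
  have [measurable]: "F \<in> borel_measurable borel" using cont by (rule borel_measurable_continuous_onI)
  have F0: "0 \<le> F \<theta>" for \<theta> by (simp add: F_def)
  have int: "set_integrable lborel {0..2*pi} F"
    using cont by (intro borel_integrable_atLeastAtMost') auto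
  define I where "I = (LINT \<theta>:{0..2*pi}|lborel. F \<theta>)"
  have "(LINT \<theta>:{0..2*pi}|lebesgue. F \<theta>) = I"
    unfolding I_def set_lebesgue_integral_def by (intro integral_completion) measurable
  then have mean: "integral_mean p r g = (1 / (2 * pi) * I) powr (1 / p)"
    by (simp add: integral_mean_def F_def)
  have "0 \<le> I" unfolding I_def set_lebesgue_integral_def by (intro integral_nonneg_AE) (auto simp: F0)
  then have "2 * pi * integral_mean p r g powr p = I"
    unfolding mean using p by (simp add: powr_powr)
  moreover have "(\<integral>\<^sup>+ \<theta>. ennreal (F \<theta>) * indicator {0..2*pi} \<theta> \<partial>lborel) = ennreal I"
  proof -
    have "(\<integral>\<^sup>+ \<theta>. ennreal (indicator {0..2*pi} \<theta> *\<^sub>R F \<theta>) \<partial>lborel) = ennreal I"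
      unfolding I_def set_lebesgue_integral_def
      using int F0 by (intro nn_integral_eq_integral) (auto simp: set_integrable_def)
    then show ?thesis by (simp add: nn_integral_set_ennreal mult.commute)
  qed
  ultimately show ?thesis by (simp add: F_def)
qed

lemma integral_mean_nonneg: "0 \<le> integral_mean p r g"
  by (simp add: integral_mean_def)

text \<open>Stating this for a function of \<open>cis \<theta>\<close> builds in the periodicity.
  The shifted interval is cut at 2 pi and the second piece is moved back by one period.\<close>

lemma nn_integral_circle_shift:
  fixes H :: "complex \<Rightarrow> ennreal" and a :: real
  assumes meas[measurable]: "(\<lambda>\<theta>. H (cis \<theta>)) \<in> borel_measurable borel"
  shows "(\<integral>\<^sup>+ \<theta>\<in>{0..2*pi}. H (cis (\<theta> + a)) \<partial>lborel) = (\<integral>\<^sup>+ \<theta>\<in>{0..2*pi}. H (cis \<theta>) \<partial>lborel)"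
proof -
  \<comment> \<open>The representative of the angle a modulo 2 pi in the base period.\<close>
  define b where "b = Arg2pi (cis a)"
  have b: "0 \<le> b" "b < 2 * pi" by (auto simp: b_def Arg2pi)
  have "cis b = cis a" using Arg2pi_eq[of "cis a"] by (simp add: b_def cis_conv_exp)
  then have cab: "cis (\<theta> + a) = cis (\<theta> + b)" for \<theta> by (simp add: cis_mult[symmetric])
  have per: "cis (\<theta> + 2 * pi) = cis \<theta>" for \<theta> by (simp add: cis_mult[symmetric])
  define F where "F \<theta> = H (cis \<theta>)" for \<theta>
  have [measurable]: "F \<in> borel_measurable borel" using meas by (simp add: F_def[abs_def])
  have shift: "(\<integral>\<^sup>+ x. G (x + c) \<partial>lborel) = (\<integral>\<^sup>+ x. G x \<partial>lborel)" if "G \<in> borel_measurable borel" for G :: "real \<Rightarrow> ennreal" and c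
    using nn_integral_real_affine[OF that, of 1 c] by (simp add: add.commute)
  have "(\<integral>\<^sup>+ \<theta>\<in>{0..2*pi}. H (cis (\<theta> + a)) \<partial>lborel) = (\<integral>\<^sup>+ x. F (x + b) * indicator {b..b + 2*pi} (x + b) \<partial>lborel)"
    unfolding cab F_def by (intro nn_integral_cong) (auto simp: indicator_def)
  also have "\<dots> = (\<integral>\<^sup>+ x. F x * indicator {b..b + 2*pi} x \<partial>lborel)"
    by (rule shift[of "\<lambda>x. F x * indicator {b..b + 2*pi} x"]) measurable
  also have "\<dots> = (\<integral>\<^sup>+ x. F x * indicator {b..<2*pi} x + F x * indicator {2*pi..b + 2*pi} x \<partial>lborel)"
    using b by (intro nn_integral_cong) (auto simp: indicator_def)
  also have "\<dots> = (\<integral>\<^sup>+ x. F x * indicator {b..<2*pi} x \<partial>lborel) + (\<integral>\<^sup>+ x. F x * indicator {2*pi..b + 2*pi} x \<partial>lborel)"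
    by (rule nn_integral_add) measurable
  also have "(\<integral>\<^sup>+ x. F x * indicator {2*pi..b + 2*pi} x \<partial>lborel) =
      (\<integral>\<^sup>+ x. F (x + 2*pi) * indicator {2*pi..b + 2*pi} (x + 2*pi) \<partial>lborel)"
    by (rule shift[symmetric, of "\<lambda>x. F x * indicator {2*pi..b + 2*pi} x"]) measurable
  also have "\<dots> = (\<integral>\<^sup>+ x. F x * indicator {0..b} x \<partial>lborel)"
    unfolding F_def per by (intro nn_integral_cong) (auto simp: indicator_def)
  also have "(\<integral>\<^sup>+ x. F x * indicator {b..<2*pi} x \<partial>lborel) + (\<integral>\<^sup>+ x. F x * indicator {0..b} x \<partial>lborel) =
      (\<integral>\<^sup>+ x. F x * indicator {b..<2*pi} x + F x * indicator {0..b} x \<partial>lborel)"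
    by (rule nn_integral_add[symmetric]) measurable
  \<comment> \<open>The point \<open>b\<close> is counted twice and \<open>2*pi\<close> is left out,
    so the integrands agree only almost everywhere.\<close>
  also have "\<dots> = (\<integral>\<^sup>+ x. F x * indicator {0..2*pi} x \<partial>lborel)"
    using AE_lborel_singleton[of b] AE_lborel_singleton[of "2*pi"]
  proof (intro nn_integral_cong_AE, eventually_elim)
    case (elim x)
    then show ?case using b by (auto simp: indicator_def)
  qed
  finally show ?thesis unfolding F_def .
qed

lemma circle_poisson_measurable:
  assumes g: "g holomorphic_on unit_disc" and r: "0 \<le> r" "r < \<rho>" "\<rho> < 1"
  shows "circle_poisson \<rho> r g \<in> borel_measurable borel"
proof -
  have [measurable]: "poisson_kernel \<rho> (of_real r) \<in> borel_measurable borel"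
    using r by (intro poisson_kernel_measurable) simp
  have "continuous_on UNIV (\<lambda>x::real. g (of_real \<rho> * cis x))"
    using circle_mean_continuous[OF g, of \<rho> UNIV 0] r by simp
  then have [measurable]: "(\<lambda>x. g (of_real \<rho> * cis x)) \<in> borel_measurable borel"
    by (rule borel_measurable_continuous_onI)
  have "(\<lambda>x. g (of_real \<rho> * cis (fst x + snd x))) \<in> borel_measurable (borel \<Otimes>\<^sub>M lborel)"
    by (rule measurable_compose[of "\<lambda>x. fst x + snd x" _ borel "\<lambda>x. g (of_real \<rho> * cis x)"]) measurable
  then have [measurable]: "(\<lambda>(x, y). g (of_real \<rho> * cis (x + y))) \<in> borel_measurable (borel \<Otimes>\<^sub>M lborel)"
    by (simp add: split_beta')
  show ?thesis unfolding circle_poisson_def[abs_def] by measurable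
qed

text \<open>The Poisson kernel has mass 1 and every rotation of g has the same mean on the circle,
  so averaging rotations is a contraction by Minkowski's inequality. The additional shift a lets the
  bound be used at \<theta> and at \<theta> + h alike.\<close>

lemma circle_poisson_Lp:
  assumes g: "g holomorphic_on unit_disc" and r: "0 \<le> r" "r < \<rho>" "\<rho> < 1" and p: "1 \<le> p"
  shows "(\<integral>\<^sup>+ \<theta>\<in>{0..2*pi}. ennreal (circle_poisson \<rho> r g (\<theta> + a) powr p) \<partial>lborel)
    \<le> ennreal (2 * pi * integral_mean p \<rho> g powr p)"
proof -
  define K where "K = poisson_kernel \<rho> (of_real r)"
  define N where "N = (2 * pi) powr (1/p) * integral_mean p \<rho> g"
  have N0: "0 \<le> N" by (simp add: N_def integral_mean_nonneg)
  have Np: "N powr p = 2 * pi * integral_mean p \<rho> g powr p"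
    using p by (simp add: N_def powr_mult powr_powr integral_mean_nonneg)
  have r': "cmod (of_real r) < \<rho>" using r by simp
  have [measurable]: "K \<in> borel_measurable borel"
    unfolding K_def by (rule poisson_kernel_measurable[OF r'])
  have K0: "0 \<le> K t" for t using poisson_kernel_nonneg[OF less_imp_le[OF r']] by (simp add: K_def)
  have "continuous_on UNIV (\<lambda>x::real. g (of_real \<rho> * cis x))"
    using circle_mean_continuous[OF g, of \<rho> UNIV 0] r by simp
  then have [measurable]: "(\<lambda>x. g (of_real \<rho> * cis x)) \<in> borel_measurable borel"
    by (rule borel_measurable_continuous_onI)
  have "(\<lambda>x. g (of_real \<rho> * cis (snd x + a + fst x))) \<in> borel_measurable (lborel \<Otimes>\<^sub>M lborel)"
    by (rule measurable_compose[of "\<lambda>x. snd x + a + fst x" _ borel "\<lambda>x. g (of_real \<rho> * cis x)"]) measurable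
  then have [measurable]: "(\<lambda>(t, \<theta>). g (of_real \<rho> * cis (\<theta> + a + t))) \<in> borel_measurable (lborel \<Otimes>\<^sub>M lborel)"
    by (simp add: split_beta')
  define G where "G t \<theta> = indicator {0..2*pi} t * K t * cmod (g (of_real \<rho> * cis (\<theta> + a + t))) * indicator {0..2*pi} \<theta>" for t \<theta> :: real
  \<comment> \<open>The L^p norm in \<theta> of the slice \<open>G t\<close>; N is the L^p norm of g
    on the circle of radius \<rho> with respect to d\<theta>, without the averaging factor 1 / (2
    pi).\<close>
  define c where "c t = indicator {0..2*pi} t * K t * N" for t :: real
  have inner: "(\<integral>\<^sup>+ t. ennreal (G t \<theta>) \<partial>lborel) = ennreal (circle_poisson \<rho> r g (\<theta> + a)) * indicator {0..2*pi} \<theta>" for \<theta>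
  proof -
    have "(\<integral>\<^sup>+ t. ennreal (G t \<theta>) \<partial>lborel) = (\<integral>\<^sup>+ t. ennreal (K t * cmod (g (of_real \<rho> * cis (\<theta> + a + t)))) * indicator {0..2*pi} t * indicator {0..2*pi} \<theta> \<partial>lborel)"
      by (intro nn_integral_cong) (auto simp: G_def indicator_def)
    also have "\<dots> = ennreal (circle_poisson \<rho> r g (\<theta> + a)) * indicator {0..2*pi} \<theta>"
      unfolding ennreal_circle_poisson[OF g r] K_def[symmetric] by (rule nn_integral_multc) measurable
    finally show ?thesis .
  qed
  have "(\<integral>\<^sup>+ \<theta>. ennreal (enn2real (\<integral>\<^sup>+ t. ennreal (G t \<theta>) \<partial>lborel) powr p) \<partial>lborel) \<le> ennreal (N powr p)"
  proof (rule Minkowski_integral_inequality(2)[where c = c])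
    show "(\<lambda>(s, t). G s t) \<in> borel_measurable (lborel \<Otimes>\<^sub>M lborel)"
      unfolding G_def by measurable
    show "c \<in> borel_measurable lborel" unfolding c_def by measurable
    show "(\<integral>\<^sup>+ \<theta>. ennreal (G t \<theta> powr p) \<partial>lborel) \<le> ennreal (c t powr p)" for t
    proof -
      have "(\<integral>\<^sup>+ \<theta>. ennreal (G t \<theta> powr p) \<partial>lborel) =
        (\<integral>\<^sup>+ \<theta>. ennreal ((indicator {0..2*pi} t * K t) powr p) *
          (ennreal (cmod (g (of_real \<rho> * cis (\<theta> + (a + t)))) powr p) * indicator {0..2*pi} \<theta>) \<partial>lborel)"
        using K0 p by (intro nn_integral_cong) (auto simp: G_def indicator_def powr_mult ennreal_mult' add.assoc)
      also have "\<dots> = ennreal ((indicator {0..2*pi} t * K t) powr p) *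
          (\<integral>\<^sup>+ \<theta>\<in>{0..2*pi}. ennreal (cmod (g (of_real \<rho> * cis (\<theta> + (a + t)))) powr p) \<partial>lborel)"
        by (rule nn_integral_cmult) measurable
      also have "(\<integral>\<^sup>+ \<theta>\<in>{0..2*pi}. ennreal (cmod (g (of_real \<rho> * cis (\<theta> + (a + t)))) powr p) \<partial>lborel) = ennreal (N powr p)"
        unfolding Np using r p
        by (subst nn_integral_circle_shift[of "\<lambda>z. ennreal (cmod (g (of_real \<rho> * z)) powr p)"])
           (auto simp: nn_integral_circle_eq_integral_mean[OF g])
      also have "ennreal ((indicator {0..2*pi} t * K t) powr p) * ennreal (N powr p) = ennreal (c t powr p)"
        using K0 N0 by (simp add: c_def powr_mult ennreal_mult'[symmetric])
      finally show ?thesis by simp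
    qed
    show "(\<integral>\<^sup>+ t. ennreal (c t) \<partial>lborel) \<le> ennreal N"
    proof -
      have "(\<integral>\<^sup>+ t. ennreal (c t) \<partial>lborel) = (\<integral>\<^sup>+ t. ennreal (K t) * indicator {0..2*pi} t * ennreal N \<partial>lborel)"
        using K0 N0 by (intro nn_integral_cong) (auto simp: c_def indicator_def ennreal_mult)
      also have "\<dots> = (\<integral>\<^sup>+ t\<in>{0..2*pi}. ennreal (K t) \<partial>lborel) * ennreal N"
        by (rule nn_integral_multc) measurable
      also have "\<dots> = ennreal N" using poisson_kernel_integral[OF r'] by (simp add: K_def)
      finally show ?thesis by simp
    qed
  qed (auto intro: lborel.sigma_finite_measure_axioms simp: p N0 G_def c_def K0)
  also have "(\<integral>\<^sup>+ \<theta>. ennreal (enn2real (\<integral>\<^sup>+ t. ennreal (G t \<theta>) \<partial>lborel) powr p) \<partial>lborel) =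
      (\<integral>\<^sup>+ \<theta>\<in>{0..2*pi}. ennreal (circle_poisson \<rho> r g (\<theta> + a) powr p) \<partial>lborel)"
    unfolding inner using p by (intro nn_integral_cong) (auto simp: indicator_def circle_poisson_nonneg)
  finally show ?thesis unfolding Np .
qed

text \<open>Pointwise Poisson majorization followed by the contraction property; this is where p
  \<ge> 1 enters.\<close>

lemma integral_mean_mono:
  assumes g: "g holomorphic_on unit_disc" and r: "0 \<le> r" "r \<le> \<rho>" "\<rho> < 1" and p: "1 \<le> p"
  shows "integral_mean p r g \<le> integral_mean p \<rho> g"
proof (cases "r = \<rho>")
  case False
  then have r': "0 \<le> r" "r < \<rho>" "\<rho> < 1" using r by auto
  have le: "cmod (g (of_real r * cis \<theta>)) \<le> circle_poisson \<rho> r g \<theta>" for \<theta>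
  proof -
    have "ennreal (cmod (g (cis \<theta> * of_real r))) \<le> ennreal (circle_poisson \<rho> r g \<theta>)"
      unfolding ennreal_circle_poisson[OF g r'] using r' by (intro poisson_majorization[OF g]) auto
    then show ?thesis by (simp add: circle_poisson_nonneg ennreal_le_iff mult.commute)
  qed
  have "ennreal (2 * pi * integral_mean p r g powr p) = (\<integral>\<^sup>+ \<theta>\<in>{0..2*pi}. ennreal (cmod (g (of_real r * cis \<theta>)) powr p) \<partial>lborel)"
    using r p by (subst nn_integral_circle_eq_integral_mean[OF g]) auto
  also have "\<dots> \<le> (\<integral>\<^sup>+ \<theta>\<in>{0..2*pi}. ennreal (circle_poisson \<rho> r g (\<theta> + 0) powr p) \<partial>lborel)"
    using le p by (intro nn_integral_mono mult_right_mono ennreal_leI powr_mono2) auto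
  also have "\<dots> \<le> ennreal (2 * pi * integral_mean p \<rho> g powr p)"
    by (rule circle_poisson_Lp[OF g r' p])
  finally have "integral_mean p r g powr p \<le> integral_mean p \<rho> g powr p"
    by (simp add: ennreal_le_iff)
  then show ?thesis
    using p integral_mean_nonneg[of p r g] integral_mean_nonneg[of p \<rho> g]
    by (meson powr_less_mono2 not_le less_le_trans zero_less_one)
qed simp

text \<open>Minkowski's inequality again, now with counting measure in the role of the averaging
  measure. Its finiteness conclusion for k = 0 is the almost everywhere convergence of the majorant
  series.\<close>

lemma majorant_tail_Lp:
  assumes g: "g holomorphic_on unit_disc" and p: "1 \<le> p"
    and S: "summable (\<lambda>j. (1/2) ^ j * integral_mean p (dyadic_radius (j + 2)) g)"
  shows "AE \<theta> in lborel. \<theta> \<in> {0..2*pi} \<longrightarrow> summable (\<lambda>j. (1/2) ^ j * poisson_majorant g j (\<theta> + a))" (is ?A)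
    and "(\<integral>\<^sup>+ \<theta>\<in>{0..2*pi}. ennreal (majorant_tail g k (\<theta> + a) powr p) \<partial>lborel) \<le>
      ennreal (2 * pi * (\<Sum>j. (1/2) ^ (k + j) * integral_mean p (dyadic_radius (k + j + 2)) g) powr p)" (is ?B)
proof -
  define m where "m j = integral_mean p (dyadic_radius (j + 2)) g" for j
  have m0: "0 \<le> m j" for j by (simp add: m_def integral_mean_nonneg)
  have [measurable]: "poisson_majorant g j \<in> borel_measurable borel" for j
    unfolding poisson_majorant_def
    by (intro circle_poisson_measurable g dyadic_radius_nonneg dyadic_radius_less dyadic_radius_less_1) simp
  define G where "G k j \<theta> = (1/2) ^ (k + j) * poisson_majorant g (k + j) (\<theta> + a) * indicator {0..2*pi} \<theta>" for k j \<theta>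
  define c where "c k j = (1/2) ^ (k + j) * ((2 * pi) powr (1/p) * m (k + j))" for k j
  define s where "s k = (\<Sum>j. (1/2) ^ (k + j) * m (k + j))" for k
  have sm: "summable (\<lambda>j. (1/2) ^ (k + j) * m (k + j))" for k
    using summable_ignore_initial_segment[OF S, of k] by (simp add: m_def add.commute)
  have s0: "0 \<le> s k" for k unfolding s_def using m0 by (intro suminf_nonneg sm) auto
  have G0: "0 \<le> G k j \<theta>" for k j \<theta> by (simp add: G_def poisson_majorant_nonneg)
  have meas: "(\<lambda>(j, \<theta>). G k j \<theta>) \<in> borel_measurable (count_space UNIV \<Otimes>\<^sub>M lborel)" for k
    by (rule measurable_pair_measure_countable1) (auto simp: G_def)
  have bound: "(\<integral>\<^sup>+ \<theta>. ennreal (G k j \<theta> powr p) \<partial>lborel) \<le> ennreal (c k j powr p)" for k j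
  proof -
    have "(\<integral>\<^sup>+ \<theta>. ennreal (G k j \<theta> powr p) \<partial>lborel) = (\<integral>\<^sup>+ \<theta>. ennreal (((1/2) ^ (k + j)) powr p) *
        (ennreal (poisson_majorant g (k + j) (\<theta> + a) powr p) * indicator {0..2*pi} \<theta>) \<partial>lborel)"
      using p by (intro nn_integral_cong) (auto simp: G_def indicator_def powr_mult ennreal_mult' poisson_majorant_nonneg)
    also have "\<dots> = ennreal (((1/2) ^ (k + j)) powr p) *
        (\<integral>\<^sup>+ \<theta>\<in>{0..2*pi}. ennreal (poisson_majorant g (k + j) (\<theta> + a) powr p) \<partial>lborel)"
      by (rule nn_integral_cmult) measurable
    also have "\<dots> \<le> ennreal (((1/2) ^ (k + j)) powr p) * ennreal (2 * pi * m (k + j) powr p)"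
      unfolding poisson_majorant_def m_def
      by (intro mult_left_mono circle_poisson_Lp g p dyadic_radius_nonneg dyadic_radius_less dyadic_radius_less_1) auto
    also have "\<dots> = ennreal (c k j powr p)"
      using p m0 by (simp add: c_def powr_mult powr_powr ennreal_mult'[symmetric])
    finally show ?thesis .
  qed
  have total: "(\<integral>\<^sup>+ j. ennreal (c k j) \<partial>count_space UNIV) \<le> ennreal ((2 * pi) powr (1/p) * s k)" for k
  proof -
    have "(\<integral>\<^sup>+ j. ennreal (c k j) \<partial>count_space UNIV) = (\<Sum>j. ennreal ((2 * pi) powr (1/p) * ((1/2) ^ (k + j) * m (k + j))))"
      unfolding nn_integral_count_space_nat by (simp add: c_def mult_ac)
    also have "\<dots> = ennreal (\<Sum>j. (2 * pi) powr (1/p) * ((1/2) ^ (k + j) * m (k + j)))"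
      using m0 sm by (intro suminf_ennreal2 summable_mult) auto
    also have "\<dots> = ennreal ((2 * pi) powr (1/p) * s k)"
      unfolding s_def using sm by (subst suminf_mult) auto
    finally show ?thesis by simp
  qed
  note mink = Minkowski_integral_inequality[OF sigma_finite_measure_count_space lborel.sigma_finite_measure_axioms p
      meas G0 _ _ bound total]
  have fin: "AE \<theta> in lborel. (\<Sum>j. ennreal (G k j \<theta>)) < \<infinity>" for k
    using mink(1)[of k] m0 s0 by (simp add: nn_integral_count_space_nat c_def)
  have sumG: "summable (\<lambda>j. G k j \<theta>)" if "(\<Sum>j. ennreal (G k j \<theta>)) < \<infinity>" for k \<theta>
    using that G0 by (intro summable_suminf_not_top) auto
  show ?A using fin[of 0]
  proof eventually_elim
    case (elim \<theta>)
    show ?case using sumG[OF elim] by (auto simp: G_def)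
  qed
  have "(\<integral>\<^sup>+ \<theta>. ennreal (enn2real (\<Sum>j. ennreal (G k j \<theta>)) powr p) \<partial>lborel) \<le> ennreal (((2 * pi) powr (1/p) * s k) powr p)"
    using mink(2)[of k] m0 s0 by (simp add: nn_integral_count_space_nat c_def)
  moreover have "(\<integral>\<^sup>+ \<theta>\<in>{0..2*pi}. ennreal (majorant_tail g k (\<theta> + a) powr p) \<partial>lborel) =
      (\<integral>\<^sup>+ \<theta>. ennreal (enn2real (\<Sum>j. ennreal (G k j \<theta>)) powr p) \<partial>lborel)"
    using fin[of k]
  proof (intro nn_integral_cong_AE, eventually_elim)
    case (elim \<theta>)
    have "(\<Sum>j. ennreal (G k j \<theta>)) = ennreal (\<Sum>j. G k j \<theta>)"
      using G0 sumG[OF elim(2)] by (intro suminf_ennreal2) auto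
    then have "enn2real (\<Sum>j. ennreal (G k j \<theta>)) = (\<Sum>j. G k j \<theta>)"
      using G0 sumG[OF elim(2)] by (simp add: suminf_nonneg)
    then show ?case using p by (auto simp: G_def majorant_tail_def indicator_def)
  qed
  moreover have "((2 * pi) powr (1/p) * s k) powr p = 2 * pi * s k powr p"
    using p s0 by (simp add: powr_mult powr_powr)
  ultimately show ?B by (simp add: s_def m_def)
qed

text \<open>A function that is not integrable has Bochner integral 0, so the bound holds for every
  nonnegative f. It is applied to the difference of boundary values, whose measurability has not
  been established.\<close>

lemma integral_le_enn2real_nn_integral:
  fixes f :: "'a \<Rightarrow> real"
  assumes "\<And>x. 0 \<le> f x"
  shows "(LINT x|M. f x) \<le> enn2real (\<integral>\<^sup>+ x. ennreal (f x) \<partial>M)"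
proof (cases "integrable M f")
  case True
  then show ?thesis using assms by (subst integral_eq_nn_integral) auto
qed (simp add: not_integrable_integral_eq)

text \<open>Constants: 2000 times the sum of two tails is at most 4000 times their maximum, whose
  p-th power is at most the sum of the p-th powers. Each of these integrates to at most 2 pi s^p,
  and (4 pi)^(1/p) \<le> 4 pi gives 4000 * 4 pi. Nonnegativity is stated as well because a real
  supremum requires boundedness before it can be compared with its members, and powers are monotone
  only on nonnegative bases.\<close>

lemma modulus_of_continuity_le:
  assumes f: "f holomorphic_on unit_disc" and p: "1 \<le> p" and t: "0 < t" "t \<le> (1/2) ^ k"
    and S: "summable (\<lambda>j. (1/2) ^ j * integral_mean p (dyadic_radius (j + 2)) (deriv f))"
  shows "0 \<le> modulus_of_continuity p t f"
    and "modulus_of_continuity p t f \<le>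
      16000 * pi * (\<Sum>j. (1/2) ^ (k + j) * integral_mean p (dyadic_radius (k + j + 2)) (deriv f))"
proof -
  define s where "s = (\<Sum>j. (1/2) ^ (k + j) * integral_mean p (dyadic_radius (k + j + 2)) (deriv f))"
  define T where "T = majorant_tail (deriv f) k"
  have s0: "0 \<le> s" unfolding s_def
    using summable_ignore_initial_segment[OF S, of k]
    by (intro suminf_nonneg) (auto simp: integral_mean_nonneg add_ac)
  have g: "deriv f holomorphic_on unit_disc" using f by (intro holomorphic_deriv) auto
  have bound: "(LINT \<theta>:{0..2*pi}|lebesgue. cmod (boundary_value f (cis (\<theta> + h)) - boundary_value f (cis \<theta>)) powr p) powr (1 / p)
      \<le> 16000 * pi * s" if h: "h \<in> {0<..<t}" for h
  proof -
    define D where "D \<theta> = cmod (boundary_value f (cis (\<theta> + h)) - boundary_value f (cis \<theta>)) powr p" for \<theta>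
    have pw: "AE \<theta> in lborel. \<theta> \<in> {0..2*pi} \<longrightarrow> D \<theta> \<le> 4000 powr p * (T (\<theta> + 0) powr p + T (\<theta> + h) powr p)"
      using majorant_tail_Lp(1)[OF g p S, of 0] majorant_tail_Lp(1)[OF g p S, of h]
    proof eventually_elim
      case (elim \<theta>)
      show ?case
      proof
        assume \<theta>: "\<theta> \<in> {0..2*pi}"
        have S1: "summable (\<lambda>n. (1/2) ^ n * poisson_majorant (deriv f) n \<theta>)"
          and S2: "summable (\<lambda>n. (1/2) ^ n * poisson_majorant (deriv f) n (\<theta> + h))"
          using elim \<theta> by auto
        have T0: "0 \<le> T \<phi>" if "summable (\<lambda>n. (1/2) ^ n * poisson_majorant (deriv f) n \<phi>)" for \<phi>
          unfolding T_def majorant_tail_def using summable_ignore_initial_segment[OF that, of k]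
          by (intro suminf_nonneg) (auto simp: poisson_majorant_nonneg add_ac)
        define x where "x = max (T \<theta>) (T (\<theta> + h))"
        have x0: "0 \<le> x" using T0[OF S1] by (simp add: x_def)
        have "D \<theta> \<le> (2000 * (T \<theta> + T (\<theta> + h))) powr p"
          unfolding D_def T_def using h t p
          by (intro powr_mono2 boundary_value_difference[OF f S1 S2]) auto
        also have "\<dots> \<le> (4000 * x) powr p"
          using p T0[OF S1] T0[OF S2] by (intro powr_mono2) (auto simp: x_def max_def)
        also have "\<dots> = 4000 powr p * x powr p" using x0 by (simp add: powr_mult)
        also have "x powr p \<le> T \<theta> powr p + T (\<theta> + h) powr p"
          by (auto simp: x_def max_def)
        finally show "D \<theta> \<le> 4000 powr p * (T (\<theta> + 0) powr p + T (\<theta> + h) powr p)" by simp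
      qed
    qed
    have Tmeas: "(\<lambda>\<theta>. T (\<theta> + b)) \<in> borel_measurable borel" for b
    proof -
      have [measurable]: "poisson_majorant (deriv f) j \<in> borel_measurable borel" for j
        unfolding poisson_majorant_def
        by (intro circle_poisson_measurable g dyadic_radius_nonneg dyadic_radius_less dyadic_radius_less_1) simp
      show ?thesis unfolding T_def majorant_tail_def by measurable
    qed
    note [measurable] = Tmeas[of 0, simplified] Tmeas[of h]
    have "(LINT \<theta>:{0..2*pi}|lebesgue. D \<theta>) \<le> enn2real (\<integral>\<^sup>+ \<theta>. ennreal (indicator {0..2*pi} \<theta> *\<^sub>R D \<theta>) \<partial>lebesgue)"
      unfolding set_lebesgue_integral_def by (rule integral_le_enn2real_nn_integral) (simp add: D_def)
    \<comment> \<open>Valid for arbitrary integrands: the nonnegative integral is a supremum over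
      simple functions below, and completion does not change it.\<close>
    also have "(\<integral>\<^sup>+ \<theta>. ennreal (indicator {0..2*pi} \<theta> *\<^sub>R D \<theta>) \<partial>lebesgue) =
        (\<integral>\<^sup>+ \<theta>. ennreal (indicator {0..2*pi} \<theta> *\<^sub>R D \<theta>) \<partial>lborel)"
      by (rule nn_integral_completion)
    also have "enn2real \<dots> \<le> 4000 powr p * (4 * pi * s powr p)"
    proof (rule enn2real_leI)
      have "(\<integral>\<^sup>+ \<theta>. ennreal (indicator {0..2*pi} \<theta> *\<^sub>R D \<theta>) \<partial>lborel) \<le>
          (\<integral>\<^sup>+ \<theta>. ennreal (4000 powr p) * (ennreal (T (\<theta> + 0) powr p) * indicator {0..2*pi} \<theta>
             + ennreal (T (\<theta> + h) powr p) * indicator {0..2*pi} \<theta>) \<partial>lborel)"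
        using pw
      proof (intro nn_integral_mono_AE, eventually_elim)
        case (elim \<theta>)
        then show ?case
          by (auto simp: indicator_def ennreal_mult'[symmetric] ennreal_plus[symmetric] simp del: ennreal_plus intro!: ennreal_leI)
      qed
      also have "\<dots> = ennreal (4000 powr p) * ((\<integral>\<^sup>+ \<theta>\<in>{0..2*pi}. ennreal (T (\<theta> + 0) powr p) \<partial>lborel)
             + (\<integral>\<^sup>+ \<theta>\<in>{0..2*pi}. ennreal (T (\<theta> + h) powr p) \<partial>lborel))"
        by (subst nn_integral_cmult, measurable, subst nn_integral_add, measurable)
      also have "\<dots> \<le> ennreal (4000 powr p) * (ennreal (2 * pi * s powr p) + ennreal (2 * pi * s powr p))"
        unfolding T_def s_def by (intro mult_left_mono add_mono majorant_tail_Lp(2)[OF g p S]) auto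
      also have "\<dots> = ennreal (4000 powr p * (4 * pi * s powr p))"
        by (simp add: ennreal_mult'[symmetric] ennreal_plus[symmetric] del: ennreal_plus)
      finally show "(\<integral>\<^sup>+ \<theta>. ennreal (indicator {0..2*pi} \<theta> *\<^sub>R D \<theta>) \<partial>lborel) \<le> ennreal (4000 powr p * (4 * pi * s powr p))" .
    qed simp
    finally have "(LINT \<theta>:{0..2*pi}|lebesgue. D \<theta>) powr (1/p) \<le> (4000 powr p * (4 * pi * s powr p)) powr (1/p)"
      using p by (intro powr_mono2) (auto simp: set_lebesgue_integral_def D_def)
    also have "\<dots> = 4000 * (4 * pi) powr (1/p) * s"
      using p s0 by (simp add: powr_mult powr_powr)
    also have "\<dots> \<le> 4000 * (4 * pi) powr 1 * s"
      using p s0 pi_ge_two by (intro mult_right_mono mult_left_mono powr_mono) auto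
    finally show ?thesis by (simp add: D_def)
  qed
  show "modulus_of_continuity p t f \<le>
      16000 * pi * (\<Sum>j. (1/2) ^ (k + j) * integral_mean p (dyadic_radius (k + j + 2)) (deriv f))"
    unfolding modulus_of_continuity_def s_def[symmetric]
    using bound t by (intro cSUP_least) auto
  have "bdd_above ((\<lambda>h. (LINT \<theta>:{0..2*pi}|lebesgue.
      cmod (boundary_value f (cis (\<theta> + h)) - boundary_value f (cis \<theta>)) powr p) powr (1 / p)) ` {0<..<t})"
    using bound by (intro bdd_aboveI2) blast
  from cSUP_upper[OF _ this, of "t/2"] show "0 \<le> modulus_of_continuity p t f"
    unfolding modulus_of_continuity_def using t by (auto intro: order_trans[OF powr_ge_zero])
qed

section \<open>A discrete Hardy inequality\<close>

text \<open>The hypothesis reads S_(j+1) \<le> D (S_(j+1) - S_j) for the partial sums S, that is S_j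
  \<le> (1 - 1/D) S_(j+1). Since u_k \<le> S_k and S_(k+i) \<le> D u_(k+i), the geometric growth
  passes from S to u.\<close>

lemma partial_sum_bound_imp_geometric:
  fixes u :: "nat \<Rightarrow> real"
  assumes u: "\<And>k. 0 < u k" and D: "1 < D" and sum: "\<And>j. (\<Sum>k\<le>j. u k) \<le> D * u j"
  shows "u k \<le> (1 - 1/D) ^ i * (D * u (k + i))"
proof -
  define S where "S j = (\<Sum>k\<le>j. u k)" for j
  have step: "S j \<le> (1 - 1/D) * S (Suc j)" for j
  proof -
    have "S (Suc j) \<le> D * (S (Suc j) - S j)" using sum[of "Suc j"] by (simp add: S_def)
    then show ?thesis using D by (simp add: field_simps)
  qed
  have "S k \<le> (1 - 1/D) ^ i * S (k + i)"
  proof (induction i)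
    case (Suc i)
    have "(1 - 1/D) ^ i * S (k + i) \<le> (1 - 1/D) ^ i * ((1 - 1/D) * S (Suc (k + i)))"
      using D by (intro mult_left_mono step) auto
    then show ?case using Suc by (simp add: mult_ac)
  qed simp
  moreover have "u k \<le> S k"
    unfolding S_def using u by (intro member_le_sum) (auto intro: less_imp_le)
  moreover have "(1 - 1/D) ^ i * S (k + i) \<le> (1 - 1/D) ^ i * (D * u (k + i))"
    using D sum[of "k + i"] by (intro mult_left_mono) (auto simp: S_def)
  ultimately show ?thesis by linarith
qed

text \<open>One argument covers q < 1 and q \<ge> 1. Geometric growth gives u_k^(1/q) a_(k+i) \<le>
  E^(1/q) \<mu>^i u_(k+i)^(1/q) a_(k+i), and \<mu> = \<kappa>^2 is split. One factor \<kappa>^i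
  turns the remaining term into the root of \<eta>^i b_(k+i), with b_j = a_j^q u_j and \<eta> =
  \<kappa>^q, hence at most the root of T_k, the sum of all these; the other factor sums over i to 1
  / (1 - \<kappa>). Finally the T_k sum to at most B / (1 - \<eta>), where B is the sum of the
  b_j.\<close>

lemma discrete_Hardy_inequality:
  fixes u :: "nat \<Rightarrow> real" and q :: real
  assumes u: "\<And>k. 0 < u k" and D: "\<And>j. (\<Sum>k\<le>j. u k) \<le> D * u j" and q: "0 < q"
  shows "\<exists>C>0. \<forall>a. (\<forall>j. 0 \<le> a j) \<longrightarrow> summable (\<lambda>j. a j powr q * u j) \<longrightarrow>
    summable a \<and> summable (\<lambda>k. u k * (\<Sum>j. a (k + j)) powr q) \<and>
    (\<Sum>k. u k * (\<Sum>j. a (k + j)) powr q) \<le> C * (\<Sum>j. a j powr q * u j)"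
proof -
  \<comment> \<open>Enlarges D so that 1 - 1/E lies strictly between 0 and 1.\<close>
  define E where "E = max D 0 + 2"
  have E: "1 < E" by (simp add: E_def)
  have sumE: "(\<Sum>k\<le>j. u k) \<le> E * u j" for j
  proof -
    have "D * u j \<le> E * u j" using u[of j] by (intro mult_right_mono) (auto simp: E_def)
    then show ?thesis using D[of j] by linarith
  qed
  define \<mu> where "\<mu> = (1 - 1/E) powr (1/q)"
  have \<mu>: "0 < \<mu>" "\<mu> < 1"
    unfolding \<mu>_def using E q powr_less_mono2[of "1/q" "1 - 1/E" 1] by auto
  define \<kappa> where "\<kappa> = sqrt \<mu>"
  have \<kappa>: "0 < \<kappa>" "\<kappa> < 1" "\<mu> = \<kappa> * \<kappa>"
    using \<mu> by (auto simp: \<kappa>_def)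
  define \<eta> where "\<eta> = \<kappa> powr q"
  have \<eta>: "0 < \<eta>" "\<eta> < 1" using \<kappa> q powr_less_mono2[of q \<kappa> 1] by (auto simp: \<eta>_def)
  have geo: "u k powr (1/q) \<le> E powr (1/q) * (\<kappa> ^ i * \<kappa> ^ i) * u (k + i) powr (1/q)" for k i
  proof -
    have "u k powr (1/q) \<le> ((1 - 1/E) ^ i * (E * u (k + i))) powr (1/q)"
      using q u partial_sum_bound_imp_geometric[OF u E sumE, of k i] by (intro powr_mono2) (auto intro: less_imp_le)
    also have "\<dots> = ((1 - 1/E) ^ i) powr (1/q) * (E powr (1/q) * u (k + i) powr (1/q))"
      using E u[of "k + i"] by (simp add: powr_mult)
    also have "((1 - 1/E) ^ i) powr (1/q) = \<mu> ^ i"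
      using E by (simp add: \<mu>_def powr_powr powr_realpow[symmetric] mult.commute)
    also have "\<mu> ^ i = \<kappa> ^ i * \<kappa> ^ i" by (simp add: \<kappa>(3) power_mult_distrib)
    finally show ?thesis by (simp add: mult_ac)
  qed
  define C where "C = E / (1 - \<kappa>) powr q / (1 - \<eta>)"
  have C: "0 < C" using E \<kappa> \<eta> by (simp add: C_def)
  show ?thesis
  proof (intro exI[of _ C] conjI allI impI C)
    fix a :: "nat \<Rightarrow> real"
    assume a: "\<forall>j. 0 \<le> a j" and sm: "summable (\<lambda>j. a j powr q * u j)"
    define b where "b j = a j powr q * u j" for j
    have b0: "0 \<le> b j" for j using u[of j] by (simp add: b_def)
    have sb: "summable b" using sm by (simp add: b_def[abs_def])
    define B where "B = suminf b"
    define T where "T k = (\<Sum>i. \<eta> ^ i * b (k + i))" for k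
    have sb': "summable (\<lambda>i. b (k + i))" for k
      using summable_ignore_initial_segment[OF sb, of k] by (simp add: add.commute)
    have sT: "summable (\<lambda>i. \<eta> ^ i * b (k + i))" for k
      using \<eta> b0 by (intro summable_comparison_test'[OF sb'[of k], of 0]) (auto simp: mult_left_le_one_le power_le_one)
    have T0: "0 \<le> T k" for k
      unfolding T_def using \<eta> b0 by (intro suminf_nonneg sT) auto
    have T_ge: "\<eta> ^ i * b (k + i) \<le> T k" for k i
      unfolding T_def using sum_le_suminf[OF sT, of "{i}" k] \<eta> b0 by auto
    have root: "\<kappa> ^ i * (a (k + i) * u (k + i) powr (1/q)) \<le> T k powr (1/q)" for k i
    proof -
      have "\<kappa> ^ i * (a (k + i) * u (k + i) powr (1/q)) = (\<eta> ^ i * b (k + i)) powr (1/q)"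
        using a u[of "k + i"] \<kappa> q
        by (simp add: \<eta>_def b_def powr_mult powr_powr powr_realpow[symmetric] mult.commute)
      also have "\<dots> \<le> T k powr (1/q)"
        using q \<eta> b0 by (intro powr_mono2 T_ge) auto
      finally show ?thesis .
    qed
    have le: "u k powr (1/q) * a (k + i) \<le> E powr (1/q) * T k powr (1/q) * \<kappa> ^ i" for k i
    proof -
      have "u k powr (1/q) * a (k + i) \<le> E powr (1/q) * (\<kappa> ^ i * \<kappa> ^ i) * u (k + i) powr (1/q) * a (k + i)"
        using a geo by (intro mult_right_mono) auto
      also have "\<dots> = E powr (1/q) * \<kappa> ^ i * (\<kappa> ^ i * (a (k + i) * u (k + i) powr (1/q)))" by simp
      also have "\<dots> \<le> E powr (1/q) * \<kappa> ^ i * T k powr (1/q)"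
        using \<kappa> root by (intro mult_left_mono) auto
      finally show ?thesis by (simp add: mult_ac)
    qed
    have geom: "summable (\<lambda>i. E powr (1/q) * T k powr (1/q) * \<kappa> ^ i)" for k
      using \<kappa> by (intro summable_mult summable_geometric) auto
    have su: "summable (\<lambda>i. u k powr (1/q) * a (k + i))" for k
      using a le by (intro summable_comparison_test'[OF geom[of k], of 0]) auto
    have sa: "summable (\<lambda>i. a (k + i))" for k
      \<comment> \<open>Convergence of the original series is a conclusion, obtained by dividing the
        dominated series by the positive number u_k^(1/q).\<close>
      using summable_mult[OF su[of k], of "1 / u k powr (1/q)"] u[of k] by simp
    show "summable a" using sa[of 0] by simp
    have pw: "u k * (\<Sum>j. a (k + j)) powr q \<le> E / (1 - \<kappa>) powr q * T k" for k
    proof -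
      have A0: "0 \<le> (\<Sum>j. a (k + j))" using a by (intro suminf_nonneg sa) auto
      have "u k powr (1/q) * (\<Sum>j. a (k + j)) = (\<Sum>j. u k powr (1/q) * a (k + j))"
        by (rule suminf_mult[symmetric, OF sa])
      also have "\<dots> \<le> (\<Sum>i. E powr (1/q) * T k powr (1/q) * \<kappa> ^ i)"
        by (intro suminf_le le su geom)
      also have "\<dots> = E powr (1/q) * T k powr (1/q) / (1 - \<kappa>)"
        using \<kappa> by (subst suminf_mult) (auto simp: suminf_geometric summable_geometric)
      finally have "(u k powr (1/q) * (\<Sum>j. a (k + j))) powr q \<le> (E powr (1/q) * T k powr (1/q) / (1 - \<kappa>)) powr q"
        using q A0 by (intro powr_mono2) auto
      then show ?thesis
        using q A0 T0 E \<kappa> u[of k] by (simp add: powr_mult powr_divide powr_powr)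
    qed
    have sumT: "(\<Sum>k<n. T k) \<le> B / (1 - \<eta>)" for n
    proof -
      have "(\<Sum>k<n. T k) = (\<Sum>i. \<Sum>k<n. \<eta> ^ i * b (k + i))"
        unfolding T_def by (rule suminf_sum[symmetric]) (rule sT)
      also have "\<dots> \<le> (\<Sum>i. B * \<eta> ^ i)"
      proof (rule suminf_le)
        fix i
        have "(\<Sum>k<n. b (k + i)) = (\<Sum>k\<in>{i..<n + i}. b k)"
          using sum.shift_bounds_nat_ivl[of b 0 i n] by (simp add: atLeast0LessThan)
        also have "\<dots> \<le> B" unfolding B_def using b0 sb by (intro sum_le_suminf) auto
        finally have "\<eta> ^ i * (\<Sum>k<n. b (k + i)) \<le> \<eta> ^ i * B" using \<eta> by (intro mult_left_mono) auto
        then show "(\<Sum>k<n. \<eta> ^ i * b (k + i)) \<le> B * \<eta> ^ i" by (simp add: sum_distrib_left mult.commute)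
      qed (use \<eta> sT in \<open>auto intro!: summable_sum summable_mult summable_geometric\<close>)
      also have "\<dots> = B / (1 - \<eta>)"
        using \<eta> by (subst suminf_mult) (auto simp: suminf_geometric summable_geometric)
      finally show ?thesis .
    qed
    have part: "(\<Sum>k<n. u k * (\<Sum>j. a (k + j)) powr q) \<le> C * B" for n
    proof -
      have "(\<Sum>k<n. u k * (\<Sum>j. a (k + j)) powr q) \<le> (\<Sum>k<n. E / (1 - \<kappa>) powr q * T k)"
        by (intro sum_mono pw)
      also have "\<dots> = E / (1 - \<kappa>) powr q * (\<Sum>k<n. T k)" by (rule sum_distrib_left[symmetric])
      also have "\<dots> \<le> E / (1 - \<kappa>) powr q * (B / (1 - \<eta>))"
        using E by (intro mult_left_mono sumT) auto
      finally show ?thesis by (simp add: C_def)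
    qed
    have nn: "0 \<le> u k * (\<Sum>j. a (k + j)) powr q" for k using u[of k] by simp
    show sk: "summable (\<lambda>k. u k * (\<Sum>j. a (k + j)) powr q)"
      by (rule summableI_nonneg_bounded[OF nn part])
    show "(\<Sum>k. u k * (\<Sum>j. a (k + j)) powr q) \<le> C * (\<Sum>j. a j powr q * u j)"
      using suminf_le_const[OF sk part] by (simp add: B_def b_def[abs_def])
  qed
qed

section \<open>Radial weights\<close>

text \<open>Polar coordinates for radial integrands. Both measures are finite on the half-lines
  {x<..} and agree there: each gives the area of the annulus between x and 1.\<close>

lemma distr_cmod_unit_disc:
  "distr (restrict_space lborel unit_disc) borel cmod =
     density lborel (\<lambda>s. ennreal (2 * pi * s) * indicator {0..<1} s)"
  (is "?M = ?N")
proof (rule measure_eqI_lessThan)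
  have meas: "cmod \<in> restrict_space lborel unit_disc \<rightarrow>\<^sub>M borel"
    by (intro measurable_restrict_space1) simp
  have M: "emeasure ?M {x<..} = emeasure lborel ({z. x < cmod z} \<inter> unit_disc)" for x
  proof -
    have "emeasure ?M {x<..} = emeasure (restrict_space lborel unit_disc) ({z. x < cmod z} \<inter> unit_disc)"
      using meas by (subst emeasure_distr) (auto simp: space_restrict_space vimage_def)
    also have "\<dots> = emeasure lborel ({z. x < cmod z} \<inter> unit_disc)"
      by (subst emeasure_restrict_space) auto
    finally show ?thesis .
  qed
  have ball: "emeasure lborel (ball (0::complex) 1) = ennreal pi"
    by (simp add: emeasure_ball unit_ball_vol_2)
  have N: "emeasure ?N {x<..} = (\<integral>\<^sup>+ s. ennreal (2 * pi * s) * indicator {0..<1} s * indicator {x<..} s \<partial>lborel)" for x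
    by (subst emeasure_density) auto
  show "emeasure ?M {x<..} < \<infinity>" for x
  proof -
    have "emeasure ?M {x<..} \<le> emeasure lborel (ball (0::complex) 1)"
      unfolding M by (intro emeasure_mono) auto
    then show ?thesis using ball by (auto simp: le_less_trans)
  qed
  show "emeasure ?M {x<..} = emeasure ?N {x<..}" for x :: real
  proof -
    \<comment> \<open>Clamping x to [0,1] treats half-lines that begin outside the range of the
      modulus together with the others.\<close>
    define y where "y = min 1 (max 0 x)"
    have y: "0 \<le> y" "y \<le> 1" by (auto simp: y_def)
    have "emeasure ?N {x<..} = (\<integral>\<^sup>+ s. ennreal (2 * pi * s) * indicator {y..1} s \<partial>lborel)"
      unfolding N
    proof (rule nn_integral_cong_AE)
      show "AE s in lborel. ennreal (2 * pi * s) * indicator {0..<1} s * indicator {x<..} s =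
         ennreal (2 * pi * s) * indicator {y..1} s"
        using AE_lborel_singleton[of y] AE_lborel_singleton[of 1] AE_lborel_singleton[of 0]
        by eventually_elim (auto simp: y_def indicator_def min_def max_def split: if_splits)
    qed
    also have "\<dots> = ennreal (pi * 1^2 - pi * y^2)"
      using y by (intro nn_integral_FTC_Icc) (auto intro!: derivative_eq_intros)
    also have "\<dots> = emeasure lborel ({z. x < cmod z} \<inter> unit_disc)"
    proof (cases "x < 0")
      case True
      then have "{z. x < cmod z} \<inter> unit_disc = unit_disc"
        using norm_ge_zero by (auto intro: less_le_trans)
      then show ?thesis using ball True by (simp add: y_def)
    next
      case False
      have eq: "{z. x < cmod z} \<inter> unit_disc = ball 0 1 - cball 0 y"
        using False by (auto simp: y_def min_def max_def)
      have "emeasure lborel (ball (0::complex) 1 - ball 0 1 \<inter> cball 0 y) =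
          emeasure lborel (ball (0::complex) 1) - emeasure lborel (ball 0 1 \<inter> cball (0::complex) y)"
        by (intro emeasure_Diff) (use emeasure_bounded_finite[of "ball 0 1 \<inter> cball (0::complex) y"] in \<open>auto simp: bounded_Int\<close>)
      moreover have "ball (0::complex) 1 - ball 0 1 \<inter> cball 0 y = ball (0::complex) 1 - cball 0 y"
        by auto
      moreover have "emeasure lborel (ball 0 1 \<inter> cball (0::complex) y) = ennreal (pi * y^2)"
      proof (cases "y = 1")
        case True
        then have "ball 0 1 \<inter> cball (0::complex) y = ball 0 1" by auto
        then show ?thesis using True ball by simp
      next
        case False
        then have "ball 0 1 \<inter> cball (0::complex) y = cball 0 y" using y by auto
        then show ?thesis using y by (simp add: emeasure_cball unit_ball_vol_2)
      qed
      ultimately show ?thesis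
        unfolding eq using ball y by (simp add: ennreal_minus)
    qed
    finally show ?thesis unfolding M by simp
  qed
qed auto

lemma nn_integral_radial:
  assumes [measurable]: "F \<in> borel_measurable (borel :: real measure)"
  shows "(\<integral>\<^sup>+ z\<in>unit_disc. F (cmod z) \<partial>lborel) = (\<integral>\<^sup>+ s\<in>{0..<1}. ennreal (2 * pi * s) * F s \<partial>lborel)"
proof -
  have meas: "cmod \<in> restrict_space lborel unit_disc \<rightarrow>\<^sub>M borel"
    by (intro measurable_restrict_space1) simp
  have "(\<integral>\<^sup>+ z\<in>unit_disc. F (cmod z) \<partial>lborel) = (\<integral>\<^sup>+ z. F (cmod z) \<partial>restrict_space lborel unit_disc)"
    by (subst nn_integral_restrict_space) auto
  also have "\<dots> = (\<integral>\<^sup>+ s. F s \<partial>distr (restrict_space lborel unit_disc) borel cmod)"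
    using meas by (subst nn_integral_distr) auto
  also have "\<dots> = (\<integral>\<^sup>+ s\<in>{0..<1}. ennreal (2 * pi * s) * F s \<partial>lborel)"
    unfolding distr_cmod_unit_disc by (subst nn_integral_density) (auto simp: mult_ac)
  finally show ?thesis .
qed

text \<open>The density 2 pi s of the radial measure vanishes only at s = 0, a null point.\<close>

lemma radial_null_iff:
  assumes B: "B \<in> sets borel" "B \<subseteq> {0..<1::real}"
  shows "{z. cmod z \<in> B} \<in> null_sets lborel \<longleftrightarrow> B \<in> null_sets lborel"
proof -
  have [measurable]: "B \<in> sets borel" by fact
  have sets: "{z::complex. cmod z \<in> B} \<in> sets borel" by measurable
  have "emeasure lborel {z::complex. cmod z \<in> B} = (\<integral>\<^sup>+ z\<in>unit_disc. indicator B (cmod z) \<partial>lborel)"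
  proof -
    have "emeasure lborel {z::complex. cmod z \<in> B} = (\<integral>\<^sup>+ z. indicator {z. cmod z \<in> B} z \<partial>lborel)"
      using sets by simp
    also have "\<dots> = (\<integral>\<^sup>+ z\<in>unit_disc. indicator B (cmod z) \<partial>lborel)"
      using B(2) by (intro nn_integral_cong) (auto simp: indicator_def)
    finally show ?thesis .
  qed
  also have "\<dots> = (\<integral>\<^sup>+ s\<in>{0..<1}. ennreal (2 * pi * s) * indicator B s \<partial>lborel)"
    by (rule nn_integral_radial) auto
  finally have eq: "emeasure lborel {z::complex. cmod z \<in> B} = 0 \<longleftrightarrow>
      (AE s in lborel. ennreal (2 * pi * s) * indicator B s * indicator {0..<1} s = 0)"
    by (simp add: nn_integral_0_iff_AE)
  also have "\<dots> \<longleftrightarrow> (AE s in lborel. s \<notin> B)"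
  proof
    assume "AE s in lborel. ennreal (2 * pi * s) * indicator B s * indicator {0..<1} s = 0"
    then show "AE s in lborel. s \<notin> B"
      using AE_lborel_singleton[of 0]
    proof eventually_elim
      case (elim s)
      have "0 < 2 * pi * s" if "s \<in> B" using that B(2) elim(2) by force
      then show ?case using elim B(2) by (auto simp: indicator_def ennreal_eq_0_iff split: if_splits)
    qed
  next
    assume "AE s in lborel. s \<notin> B"
    then show "AE s in lborel. ennreal (2 * pi * s) * indicator B s * indicator {0..<1} s = 0"
      by eventually_elim auto
  qed
  also have "\<dots> \<longleftrightarrow> B \<in> null_sets lborel"
    using B(1) by (subst AE_iff_null_sets) auto
  finally show ?thesis using sets by (auto simp: null_sets_def)
qed

section \<open>Measurability and integrability of a radial weight along a radius\<close>

lemma fsigma_cmod_image: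
  assumes "fsigma C"
  shows "cmod ` C \<in> sets borel"
proof -
  from assms[unfolded fsigma_Union_compact]
  obtain F :: "nat \<Rightarrow> complex set" where F: "range F \<subseteq> Collect compact" "C = (\<Union>n. F n)"
    by (elim exE conjE)
  have "cmod ` C = (\<Union>n. cmod ` F n)" using F(2) by auto
  moreover have "cmod ` F n \<in> sets borel" for n
    using F(1) by (intro borel_compact compact_continuous_image continuous_on_norm_id) auto
  ultimately show ?thesis by auto
qed

text \<open>The planar set and its complement in the disc are exhausted up to null sets by F-sigma
  sets C and C', whose moduli form Borel sets, one inside E and one disjoint from it. Any radius in
  neither image corresponds to a full circle inside the two exceptional null sets, so the uncertain
  radii R form a Borel null set and E is Borel up to a subset of R.\<close>

lemma lebesgue_radial_set:
  fixes E :: "real set"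
  assumes E: "E \<subseteq> {0..<1}" and A: "{z. cmod z \<in> E} \<in> sets lebesgue"
  shows "E \<in> sets lebesgue"
proof -
  obtain C T where C: "fsigma C" "T \<in> null_sets lebesgue" "C \<union> T = {z. cmod z \<in> E}"
    using lebesgue_set_almost_fsigma[OF A] by metis
  have A': "{z. cmod z \<in> {0..<1} - E} \<in> sets lebesgue"
  proof -
    have "{z. cmod z \<in> {0..<1} - E} = unit_disc - {z. cmod z \<in> E}" by auto
    then show ?thesis using A by (metis lmeasurable_ball fmeasurableD sets.Diff)
  qed
  obtain C' T' where C': "fsigma C'" "T' \<in> null_sets lebesgue" "C' \<union> T' = {z. cmod z \<in> {0..<1} - E}"
    using lebesgue_set_almost_fsigma[OF A'] by metis
  define R where "R = {0..<1} - cmod ` C - cmod ` C'"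
  have B: "cmod ` C \<in> sets borel" "cmod ` C' \<in> sets borel"
    using C(1) C'(1) fsigma_cmod_image by auto
  have R: "R \<in> sets borel" "R \<subseteq> {0..<1}" using B by (auto simp: R_def)
  have "{z. cmod z \<in> R} \<subseteq> T \<union> T'"
    using C(3) C'(3) unfolding R_def by blast
  then have "{z::complex. cmod z \<in> R} \<in> null_sets lebesgue"
    using null_sets_completion_subset[of "{z. cmod z \<in> R}" "T \<union> T'" lborel] C(2) C'(2) by auto
  moreover have "{z::complex. cmod z \<in> R} \<in> sets lborel" using R(1) by measurable
  ultimately have "R \<in> null_sets lborel"
    using radial_null_iff[OF R] null_sets_completion_iff by blast
  then have Rn: "R \<in> null_sets lebesgue" by (rule null_sets_completionI)
  have "cmod ` C \<subseteq> E" "cmod ` C' \<inter> E = {}" using C(3) C'(3) by auto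
  then have "E - cmod ` C \<subseteq> R" using E by (auto simp: R_def)
  then have "E - cmod ` C \<in> null_sets lebesgue" using Rn by (rule null_sets_completion_subset)
  then have "(E - cmod ` C) \<union> cmod ` C \<in> sets lebesgue" using B by (intro sets.Un) auto
  then show ?thesis using \<open>cmod ` C \<subseteq> E\<close> by (simp add: Un_absorb2)
qed

text \<open>Restricting a planar measurable function to a radius proves nothing, a radius being
  null. Instead each superlevel set in the disc is a union of circles, to which
  \<open>lebesgue_radial_set\<close> applies.\<close>

lemma radial_weight_measurable:
  assumes "radial_weight \<nu>"
  shows "(\<lambda>s. \<nu> (of_real s) * indicator {0..<1} s) \<in> borel_measurable lebesgue"
proof -
  have nn: "\<And>z. z \<in> unit_disc \<Longrightarrow> 0 \<le> \<nu> z" and rad: "\<And>z. z \<in> unit_disc \<Longrightarrow> \<nu> z = \<nu> (of_real (cmod z))"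
    and int: "set_integrable lebesgue unit_disc \<nu>"
    using assms unfolding radial_weight_def by blast+
  have meas: "(\<lambda>z. indicat_real unit_disc z * \<nu> z) \<in> borel_measurable lebesgue"
    using int by (simp add: set_integrable_def borel_measurable_integrable)
  have "{s. a < \<nu> (of_real s) * indicator {0..<1} s} \<in> sets lebesgue" for a :: real
  proof -
    define E where "E = {s\<in>{0..<1}. a < \<nu> (of_real s)}"
    have "{z\<in>space lebesgue. a < indicat_real unit_disc z * \<nu> z} \<in> sets lebesgue"
      by (rule borel_measurable_iff_greater[THEN iffD1, OF meas, rule_format])
    then have "{z. a < indicat_real unit_disc z * \<nu> z} \<inter> unit_disc \<in> sets lebesgue"
      by (intro sets.Int) simp_all
    moreover have "{z. a < indicat_real unit_disc z * \<nu> z} \<inter> unit_disc = {z. cmod z \<in> E}"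
    proof (rule set_eqI)
      fix z :: complex
      show "z \<in> {z. a < indicat_real unit_disc z * \<nu> z} \<inter> unit_disc \<longleftrightarrow> z \<in> {z. cmod z \<in> E}"
      proof (cases "z \<in> unit_disc")
        case True
        show ?thesis using True unfolding E_def mem_Collect_eq Int_iff rad[OF True, symmetric] by simp
      qed (auto simp: E_def)
    qed
    ultimately have "{z. cmod z \<in> E} \<in> sets lebesgue" by simp
    then have E: "E \<in> sets lebesgue"
      by (intro lebesgue_radial_set) (auto simp: E_def)
    have "{s. a < \<nu> (of_real s) * indicator {0..<1} s} = (if a < 0 then E \<union> - {0..<1} else E)"
      by (auto simp: E_def indicator_def)
    then show ?thesis using E by auto
  qed
  then show ?thesis
    by (intro borel_measurable_iff_greater[THEN iffD2]) simp
qed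

text \<open>For s \<ge> 1/2 the polar density 2 pi s is at least pi, so pi times the tail is
  dominated by the integral over the disc.\<close>

lemma tail_integral_half_finite:
  assumes "radial_weight \<nu>"
  shows "tail_integral \<nu> (1/2) < \<infinity>"
proof -
  have nn: "\<And>z. z \<in> unit_disc \<Longrightarrow> 0 \<le> \<nu> z" and rad: "\<And>z. z \<in> unit_disc \<Longrightarrow> \<nu> z = \<nu> (of_real (cmod z))"
    and int: "set_integrable lebesgue unit_disc \<nu>"
    using assms unfolding radial_weight_def by blast+
  define v where "v s = ennreal (\<nu> (of_real s) * indicator {0..<1} s)" for s
  have "v \<in> borel_measurable lebesgue"
    using radial_weight_measurable[OF assms] unfolding v_def by measurable
  \<comment> \<open>The polar formula is stated for Borel functions. The weight is replaced by a
    Borel version, and the exceptional set of radii pulls back to a planar null set.\<close>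
  then obtain g where g[measurable]: "g \<in> borel_measurable lborel" and AEg: "AE s in lborel. v s = g s"
    using completion_ex_borel_measurable by blast
  obtain N where N: "N \<in> null_sets lborel" "\<And>s. s \<notin> N \<Longrightarrow> v s = g s"
    using AEg by (auto elim: AE_E3)
  have N': "N \<inter> {0..<1} \<in> null_sets lborel" using N(1) by (intro null_set_Int2) auto
  then have "{z. cmod z \<in> N \<inter> {0..<1}} \<in> null_sets lborel"
    by (subst radial_null_iff) (auto simp: null_sets_def)
  then have AE: "AE z in lborel. cmod z \<notin> N \<inter> {0..<1}"
    using AE_not_in by fastforce
  have "ennreal pi * tail_integral \<nu> (1/2) = (\<integral>\<^sup>+ s. ennreal pi * (g s * indicator {1/2..<1} s) \<partial>lborel)"
  proof -
    have "tail_integral \<nu> (1/2) = (\<integral>\<^sup>+ s. g s * indicator {1/2..<1} s \<partial>lborel)"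
      unfolding tail_integral_def nn_integral_completion
      using AEg by (intro nn_integral_cong_AE) (auto simp: v_def indicator_def elim!: eventually_mono)
    then show ?thesis by (subst nn_integral_cmult) auto
  qed
  also have "\<dots> \<le> (\<integral>\<^sup>+ s\<in>{0..<1}. ennreal (2 * pi * s) * g s \<partial>lborel)"
  proof (intro nn_integral_mono)
    fix s :: real
    show "ennreal pi * (g s * indicator {1/2..<1} s) \<le> ennreal (2 * pi * s) * g s * indicator {0..<1} s"
      by (auto simp: indicator_def intro!: mult_right_mono ennreal_leI)
  qed
  also have "\<dots> = (\<integral>\<^sup>+ z\<in>unit_disc. g (cmod z) \<partial>lborel)"
    by (subst nn_integral_radial) auto
  also have "\<dots> = (\<integral>\<^sup>+ z. ennreal (norm (indicat_real unit_disc z *\<^sub>R \<nu> z)) \<partial>lborel)"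
  proof (rule nn_integral_cong_AE)
    show "AE z in lborel. g (cmod z) * indicator unit_disc z = ennreal (norm (indicat_real unit_disc z *\<^sub>R \<nu> z))"
      using AE
    proof eventually_elim
      case (elim z)
      show ?case
      proof (cases "z \<in> unit_disc")
        case True
        then have "cmod z \<notin> N" using elim by auto
        then have "g (cmod z) = v (cmod z)" using N(2) by auto
        also have "\<dots> = ennreal (\<nu> z)" using True rad[OF True] by (simp add: v_def)
        finally show ?thesis using True nn[OF True] by simp
      qed auto
    qed
  qed
  also have "\<dots> < \<infinity>"
    using int unfolding set_integrable_def integrable_iff_bounded nn_integral_completion by simp
  finally show ?thesis
    by (cases "tail_integral \<nu> (1/2)") (auto simp: ennreal_mult_top pi_gt_zero)
qed

section \<open>Doubling weights on dyadic annuli\<close>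

definition dyadic_block :: "nat \<Rightarrow> real set" where
  "dyadic_block k = {dyadic_radius k..<dyadic_radius (k + 1)}"

definition block_mass :: "(complex \<Rightarrow> real) \<Rightarrow> nat \<Rightarrow> ennreal" where
  "block_mass \<nu> k = (\<integral>\<^sup>+ s\<in>dyadic_block k. ennreal (\<nu> (of_real s)) \<partial>lebesgue)"

lemma disjoint_dyadic_blocks: "disjoint_family dyadic_block"
proof -
  have "dyadic_block m \<inter> dyadic_block n = {}" if "m < n" for m n
    using dyadic_radius_le[of "m + 1" n] that by (auto simp: dyadic_block_def)
  then show ?thesis unfolding disjoint_family_on_def by (metis Int_commute linorder_neqE_nat)
qed

lemma dyadic_block_subset: "dyadic_block k \<subseteq> {0..<1}"
  using dyadic_radius_nonneg[of k] dyadic_radius_less_1[of "k + 1"] by (auto simp: dyadic_block_def)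

lemma dyadic_block_exists:
  assumes "0 \<le> s" "s < 1" obtains k where "s \<in> dyadic_block k"
  using dyadic_radius_between[of 0 s] assms by (auto simp: dyadic_radius_def dyadic_block_def)

lemma dyadic_step_eq: "s \<in> dyadic_block k \<Longrightarrow> (\<Sum>j. c j * indicator (dyadic_block j) s) = (c k :: ennreal)"
  by (rule suminf_cmult_indicator[OF disjoint_dyadic_blocks]) auto

lemma dyadic_step_zero:
  assumes "s \<notin> {0..<1}" shows "(\<Sum>j. c j * indicator (dyadic_block j) s) = (0 :: ennreal)"
proof -
  have "s \<notin> dyadic_block j" for j using dyadic_block_subset assms by blast
  then show ?thesis by simp
qed

lemma weight_indicator_measurable:
  assumes "radial_weight \<nu>" "S \<in> sets borel" "S \<subseteq> {0..<1}"
  shows "(\<lambda>s. ennreal (\<nu> (of_real s)) * indicator S s) \<in> borel_measurable lebesgue"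
proof -
  note [measurable] = radial_weight_measurable[OF assms(1)]
  have [measurable]: "S \<in> sets lebesgue" using assms(2) by simp
  have "(\<lambda>s. ennreal (\<nu> (of_real s) * indicator {0..<1} s) * indicator S s) \<in> borel_measurable lebesgue"
    by measurable
  also have "(\<lambda>s. ennreal (\<nu> (of_real s) * indicator {0..<1} s) * indicator S s) = (\<lambda>s. ennreal (\<nu> (of_real s)) * indicator S s)"
    using assms(3) by (intro ext) (auto simp: indicator_def)
  finally show ?thesis .
qed

text \<open>The bridge between integrals and series: integrands are compared with functions constant
  on dyadic blocks, and those are integrated here.\<close>

lemma nn_integral_dyadic_step:
  assumes "radial_weight \<nu>"
  shows "(\<integral>\<^sup>+ s. (\<Sum>k. c k * indicator (dyadic_block k) s) * ennreal (\<nu> (of_real s)) \<partial>lebesgue) = (\<Sum>k. c k * block_mass \<nu> k)"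
proof -
  have [measurable]: "(\<lambda>s. ennreal (\<nu> (of_real s)) * indicator (dyadic_block k) s) \<in> borel_measurable lebesgue" for k
    using dyadic_block_subset by (intro weight_indicator_measurable assms) (auto simp: dyadic_block_def)
  have "(\<integral>\<^sup>+ s. (\<Sum>k. c k * indicator (dyadic_block k) s) * ennreal (\<nu> (of_real s)) \<partial>lebesgue) =
      (\<integral>\<^sup>+ s. (\<Sum>k. c k * (ennreal (\<nu> (of_real s)) * indicator (dyadic_block k) s)) \<partial>lebesgue)"
    by (intro nn_integral_cong, subst mult.commute, subst ennreal_suminf_cmult[symmetric]) (simp add: mult_ac)
  also have "\<dots> = (\<Sum>k. \<integral>\<^sup>+ s. c k * (ennreal (\<nu> (of_real s)) * indicator (dyadic_block k) s) \<partial>lebesgue)"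
    by (rule nn_integral_suminf) measurable
  also have "\<dots> = (\<Sum>k. c k * block_mass \<nu> k)"
    unfolding block_mass_def by (intro suminf_cong nn_integral_cmult) measurable
  finally show ?thesis .
qed

lemma tail_integral_antimono:
  assumes "r \<le> r'" shows "tail_integral \<nu> r' \<le> tail_integral \<nu> r"
  unfolding tail_integral_def using assms by (intro nn_integral_mono mult_left_mono) (auto simp: indicator_def)

lemma tail_integral_dyadic:
  assumes "radial_weight \<nu>"
  shows "tail_integral \<nu> (dyadic_radius k) = block_mass \<nu> k + tail_integral \<nu> (dyadic_radius (k + 1))"
proof -
  have "tail_integral \<nu> (dyadic_radius k) = (\<integral>\<^sup>+ s. ennreal (\<nu> (of_real s)) * indicator (dyadic_block k) s
      + ennreal (\<nu> (of_real s)) * indicator {dyadic_radius (k + 1)..<1} s \<partial>lebesgue)"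
    unfolding tail_integral_def using dyadic_radius_le[of k "k + 1"] dyadic_radius_less_1[of "k + 1"]
    by (intro nn_integral_cong) (auto simp: indicator_def dyadic_block_def)
  also have "\<dots> = block_mass \<nu> k + tail_integral \<nu> (dyadic_radius (k + 1))"
    unfolding block_mass_def tail_integral_def
    using dyadic_block_subset[of k] dyadic_radius_nonneg[of "k + 1"]
    by (intro nn_integral_add weight_indicator_measurable assms) (auto simp: dyadic_block_def)
  finally show ?thesis .
qed

text \<open>All that is used of the weight, in real numbers. Finiteness of the tail at 0 comes from
  upper doubling and the tail at 1/2. The last clause is the usable form of lower doubling: one
  block may carry no mass, but L consecutive blocks carry a fixed share of the tail.\<close>

lemma two_sided_doubling_dyadic:
  assumes "\<nu> \<in> two_sided_doubling"
  obtains V W :: "nat \<Rightarrow> real" and C D :: real and L :: nat where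
    "\<And>k. tail_integral \<nu> (dyadic_radius k) = ennreal (V k)" "\<And>k. 0 < V k"
    "\<And>k. block_mass \<nu> k = ennreal (W k)" "\<And>k. 0 \<le> W k" "\<And>k. V k = W k + V (Suc k)"
    "1 \<le> C" "\<And>k. V k \<le> C * V (Suc k)" "0 < D" "\<And>k. V k \<le> D * (\<Sum>i<L. W (k + i))"
proof -
  have rw: "radial_weight \<nu>" and ud: "\<nu> \<in> upper_doubling" and ld: "\<nu> \<in> lower_doubling"
    using assms by (auto simp: two_sided_doubling_def upper_doubling_def)
  obtain C where C: "C > 0" "\<And>r. r \<in> {0..<1} \<Longrightarrow> tail_integral \<nu> r \<le> ennreal C * tail_integral \<nu> ((1 + r) / 2)"
    using ud unfolding upper_doubling_def by blast
  obtain K c where K: "1 < K" "1 < c" "\<And>r. r \<in> {0..<1} \<Longrightarrow> ennreal c * tail_integral \<nu> (1 - (1 - r) / K) \<le> tail_integral \<nu> r"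
    using ld unfolding lower_doubling_def by blast
  have rad: "dyadic_radius k \<in> {0..<1}" for k by (simp add: dyadic_radius_nonneg dyadic_radius_less_1)
  have "tail_integral \<nu> 0 \<le> ennreal C * tail_integral \<nu> (1/2)" using C(2)[of 0] by simp
  also have "\<dots> < \<infinity>" using tail_integral_half_finite[OF rw] by (simp add: ennreal_mult_less_top)
  finally have fin: "tail_integral \<nu> (dyadic_radius k) < \<infinity>" for k
    using tail_integral_antimono[of 0 "dyadic_radius k" \<nu>] dyadic_radius_nonneg[of k] by (auto intro: le_less_trans)
  define V where "V k = enn2real (tail_integral \<nu> (dyadic_radius k))" for k
  have V: "tail_integral \<nu> (dyadic_radius k) = ennreal (V k)" for k
    using fin[of k] by (simp add: V_def less_top)
  have V0: "0 < V k" for k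
  proof -
    have "0 < tail_integral \<nu> (dyadic_radius k)" using rw rad[of k] unfolding radial_weight_def by blast
    then show ?thesis by (simp add: V)
  qed
  define W where "W k = V k - V (Suc k)" for k
  have dec: "V (Suc k) \<le> V k" for k
    using tail_integral_antimono[OF dyadic_radius_le[of k "Suc k"], of \<nu>] V0[of k] by (simp add: V ennreal_le_iff)
  have W: "block_mass \<nu> k = ennreal (W k)" for k
  proof -
    have eq: "ennreal (V k) = block_mass \<nu> k + ennreal (V (Suc k))"
      using tail_integral_dyadic[OF rw, of k] by (simp add: V)
    then have "block_mass \<nu> k = ennreal (V k) - ennreal (V (Suc k))"
      by (simp add: ennreal_add_diff_cancel_right)
    also have "\<dots> = ennreal (W k)" using V0[of "Suc k"] by (simp add: W_def ennreal_minus less_imp_le)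
    finally show ?thesis .
  qed
  have half: "(1 + dyadic_radius k) / 2 = dyadic_radius (Suc k)" for k by (simp add: dyadic_radius_def field_simps)
  have up: "V k \<le> max 1 C * V (Suc k)" for k
  proof -
    have "ennreal (V k) \<le> ennreal (C * V (Suc k))"
      using C(2)[OF rad[of k]] C(1) by (simp add: V half ennreal_mult' del: max.absorb1)
    then have "V k \<le> C * V (Suc k)" using V0[of "Suc k"] C(1) by (simp add: ennreal_le_iff)
    also have "\<dots> \<le> max 1 C * V (Suc k)" using V0[of "Suc k"] by (intro mult_right_mono) auto
    finally show ?thesis .
  qed
  \<comment> \<open>Passing from 1 - r to (1 - r) / K moves at most L dyadic steps outwards.\<close>
  obtain L where L: "K < 2 ^ L" using real_arch_pow[of 2 K] by auto
  have low: "c * V (k + L) \<le> V k" for k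
  proof -
    have "(1 - dyadic_radius k) / K \<ge> (1/2) ^ (k + L)"
    proof -
      have "(1/2) ^ (k + L) = (1/2) ^ k / (2::real) ^ L" by (simp add: power_add power_one_over)
      also have "\<dots> \<le> (1/2) ^ k / K" using L K by (intro divide_left_mono) auto
      finally show ?thesis by (simp add: one_minus_dyadic_radius)
    qed
    then have "1 - (1 - dyadic_radius k) / K \<le> dyadic_radius (k + L)" by (simp add: dyadic_radius_def)
    then have "ennreal c * tail_integral \<nu> (dyadic_radius (k + L)) \<le> ennreal c * tail_integral \<nu> (1 - (1 - dyadic_radius k) / K)"
      by (intro mult_left_mono tail_integral_antimono) auto
    also have "\<dots> \<le> tail_integral \<nu> (dyadic_radius k)" by (rule K(3)[OF rad])
    finally have "ennreal (c * V (k + L)) \<le> ennreal (V k)" using K(2) by (simp add: V ennreal_mult')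
    then show ?thesis using V0[of k] by (simp add: ennreal_le_iff)
  qed
  have tel: "(\<Sum>i<n. W (k + i)) = V k - V (k + n)" for k n
    by (induction n) (auto simp: W_def)
  \<comment> \<open>From c V_(k+L) \<le> V_k the telescoped mass V_k - V_(k+L) is at least (1 - 1/c)
    V_k.\<close>
  have mass: "V k \<le> (c / (c - 1)) * (\<Sum>i<L. W (k + i))" for k
    using low[of k] K(2) unfolding tel by (simp add: field_simps)
  have "0 \<le> W k" for k using dec[of k] by (simp add: W_def)
  moreover have "V k = W k + V (Suc k)" for k by (simp add: W_def)
  moreover have "1 \<le> max 1 C" by simp
  moreover have "0 < c / (c - 1)" using K(2) by simp
  ultimately show thesis by (rule that[OF V V0 W _ _ _ up _ mass])
qed

text \<open>On block l the factor (1 - s)^(-q) lies between 2^(lq) and 2^((l+1)q), so the integral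
  in the class condition at x_k equals the dyadic sum up to a factor 2^q. For r between x_k and
  x_(k+1) the tail is squeezed between V_(k+1) and V_k.\<close>

lemma upper_doubling_q_dyadic:
  assumes \<nu>: "\<nu> \<in> two_sided_doubling" and q: "0 < q"
    and V: "\<And>k. tail_integral \<nu> (dyadic_radius k) = ennreal (V k)" "\<And>k. 0 < V k"
    and W: "\<And>k. block_mass \<nu> k = ennreal (W k)" "\<And>k. 0 \<le> W k"
  shows "\<nu> \<in> upper_doubling_q q \<longleftrightarrow> (\<exists>M. \<forall>k. (\<Sum>l<k. (2 powr q) ^ l * W l) \<le> M * ((2 powr q) ^ k * V k))"
proof -
  have rw: "radial_weight \<nu>" and ud: "\<nu> \<in> upper_doubling"
    using \<nu> by (auto simp: two_sided_doubling_def upper_doubling_def)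
  have nn: "0 \<le> \<nu> (of_real s)" if "s \<in> {0..<1}" for s
  proof -
    have "\<forall>z\<in>unit_disc. 0 \<le> \<nu> z" using rw unfolding radial_weight_def by blast
    then show ?thesis using that by auto
  qed
  define I where "I r = (\<integral>\<^sup>+ s\<in>{0..r}. ennreal (\<nu> (of_real s) / (1 - s) powr q) \<partial>lebesgue)" for r
  define Q where "Q r = ennreal ((1 - r) powr q) / tail_integral \<nu> r * I r" for r
  have mem: "\<nu> \<in> upper_doubling_q q \<longleftrightarrow> (SUP r\<in>{0..<1}. Q r) < \<infinity>"
    using ud by (simp add: upper_doubling_q_def Q_def I_def)
  have pw: "((1/2) ^ k) powr q = 1 / (2 powr q) ^ k" for k
    by (simp add: powr_realpow[symmetric] powr_powr powr_divide mult.commute)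
  have rad: "dyadic_radius k \<in> {0..<1}" for k by (simp add: dyadic_radius_nonneg dyadic_radius_less_1)
  have ge: "ennreal (\<Sum>l<k. (2 powr q) ^ l * W l) \<le> I (dyadic_radius k)" for k
  proof -
    define c where "c l = (if l < k then ennreal ((2 powr q) ^ l) else 0)" for l
    have "ennreal (\<Sum>l<k. (2 powr q) ^ l * W l) = (\<Sum>l<k. c l * block_mass \<nu> l)"
      using W(2) by (subst sum_ennreal[symmetric]) (auto simp: c_def W(1) ennreal_mult)
    also have "\<dots> \<le> (\<Sum>l. c l * block_mass \<nu> l)"
      by (rule sum_le_suminf) auto
    also have "\<dots> = (\<integral>\<^sup>+ s. (\<Sum>l. c l * indicator (dyadic_block l) s) * ennreal (\<nu> (of_real s)) \<partial>lebesgue)"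
      by (rule nn_integral_dyadic_step[OF rw, symmetric])
    also have "\<dots> \<le> I (dyadic_radius k)"
      unfolding I_def
    proof (rule nn_integral_mono)
      fix s :: real
      show "(\<Sum>l. c l * indicator (dyadic_block l) s) * ennreal (\<nu> (of_real s))
          \<le> ennreal (\<nu> (of_real s) / (1 - s) powr q) * indicator {0..dyadic_radius k} s"
      proof (cases "s \<in> {0..<1}")
        case True
        then obtain l where l: "s \<in> dyadic_block l" using dyadic_block_exists[of s] by auto
        show ?thesis
        proof (cases "l < k")
          case True
          have s: "0 \<le> s" "s < dyadic_radius (l + 1)" "dyadic_radius l \<le> s" "s < 1"
            using l \<open>s \<in> {0..<1}\<close> by (auto simp: dyadic_block_def)
          have "s \<le> dyadic_radius k" using s dyadic_radius_le[of "l + 1" k] True by simp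
          moreover have "(2 powr q) ^ l * \<nu> (of_real s) \<le> \<nu> (of_real s) / (1 - s) powr q"
          proof -
            have "(1 - s) powr q \<le> ((1/2) ^ l) powr q"
              using s q one_minus_dyadic_radius[of l] by (intro powr_mono2) auto
            then have "(2 powr q) ^ l \<le> 1 / (1 - s) powr q"
              using s unfolding pw by (simp add: field_simps)
            from mult_right_mono[OF this nn[OF \<open>s \<in> {0..<1}\<close>]] show ?thesis by simp
          qed
          ultimately show ?thesis
            unfolding dyadic_step_eq[OF l] using True s
            by (simp add: c_def ennreal_mult'[symmetric] ennreal_leI)
        qed (simp add: dyadic_step_eq[OF l] c_def)
      qed (simp add: dyadic_step_zero)
    qed
    finally show ?thesis .
  qed
  have le: "I r \<le> ennreal (2 powr q * (\<Sum>l<k. (2 powr q) ^ l * W l))" if r: "r < dyadic_radius k" for r k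
  proof -
    \<comment> \<open>\<open>Suc l\<close> because 1 - s on block l is only bounded below by
      2^-(l+1).\<close>
    define c where "c l = (if l < k then ennreal ((2 powr q) ^ Suc l) else 0)" for l
    have "I r \<le> (\<integral>\<^sup>+ s. (\<Sum>l. c l * indicator (dyadic_block l) s) * ennreal (\<nu> (of_real s)) \<partial>lebesgue)"
      unfolding I_def
    proof (rule nn_integral_mono)
      fix s :: real
      show "ennreal (\<nu> (of_real s) / (1 - s) powr q) * indicator {0..r} s
        \<le> (\<Sum>l. c l * indicator (dyadic_block l) s) * ennreal (\<nu> (of_real s))"
      proof (cases "s \<in> {0..r}")
        case True
        then have s01: "s \<in> {0..<1}" using r dyadic_radius_less_1[of k] by auto
        then obtain l where l: "s \<in> dyadic_block l" using dyadic_block_exists[of s] by auto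
        have s: "s < dyadic_radius (l + 1)" "dyadic_radius l \<le> s" "s < 1"
          using l s01 by (auto simp: dyadic_block_def)
        have lk: "l < k"
          using s(2) True r dyadic_radius_le[of k l] by (meson atLeastAtMost_iff leI le_less_trans less_irrefl order_trans)
        have "\<nu> (of_real s) / (1 - s) powr q \<le> (2 powr q) ^ Suc l * \<nu> (of_real s)"
        proof -
          have "((1/2) ^ Suc l) powr q \<le> (1 - s) powr q"
            using s q one_minus_dyadic_radius[of "Suc l"] by (intro powr_mono2) auto
          then have "1 / (1 - s) powr q \<le> (2 powr q) ^ Suc l"
            using s unfolding pw by (simp add: field_simps del: power_Suc)
          from mult_right_mono[OF this nn[OF s01]] show ?thesis by simp
        qed
        then show ?thesis
          unfolding dyadic_step_eq[OF l] using True lk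
          by (simp add: c_def ennreal_mult'[symmetric] ennreal_leI del: power_Suc)
      qed simp
    qed
    also have "\<dots> = (\<Sum>l. c l * block_mass \<nu> l)" by (rule nn_integral_dyadic_step[OF rw])
    also have "\<dots> = (\<Sum>l<k. c l * block_mass \<nu> l)"
      by (rule suminf_finite) (auto simp: c_def)
    also have "\<dots> = ennreal (\<Sum>l<k. (2 powr q) ^ Suc l * W l)"
      using W(2) by (subst sum_ennreal[symmetric]) (auto simp: c_def W(1) ennreal_mult simp del: power_Suc)
    also have "(\<Sum>l<k. (2 powr q) ^ Suc l * W l) = 2 powr q * (\<Sum>l<k. (2 powr q) ^ l * W l)"
      by (simp add: sum_distrib_left mult_ac)
    finally show ?thesis .
  qed
  show ?thesis
  proof
    assume "\<nu> \<in> upper_doubling_q q"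
    then have "(SUP r\<in>{0..<1}. Q r) < \<infinity>" using mem by simp
    then obtain M where M: "(SUP r\<in>{0..<1}. Q r) = ennreal M" "0 \<le> M"
      by (metis infinity_ennreal_def less_top_ennreal)
    have "(\<Sum>l<k. (2 powr q) ^ l * W l) \<le> M * ((2 powr q) ^ k * V k)" for k
    proof -
      have "ennreal ((1 / (2 powr q) ^ k) / V k * (\<Sum>l<k. (2 powr q) ^ l * W l)) \<le> Q (dyadic_radius k)"
      proof -
        have "ennreal ((1 / (2 powr q) ^ k) / V k * (\<Sum>l<k. (2 powr q) ^ l * W l)) =
            ennreal (1 / (2 powr q) ^ k) / ennreal (V k) * ennreal (\<Sum>l<k. (2 powr q) ^ l * W l)"
          using V(2)[of k] by (subst ennreal_mult') (simp_all add: divide_ennreal)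
        also have "\<dots> \<le> Q (dyadic_radius k)"
          unfolding Q_def V(1) one_minus_dyadic_radius pw by (intro mult_left_mono ge) simp
        finally show ?thesis .
      qed
      also have "\<dots> \<le> ennreal M" unfolding M(1)[symmetric] using rad by (intro SUP_upper) auto
      finally have "(1 / (2 powr q) ^ k) / V k * (\<Sum>l<k. (2 powr q) ^ l * W l) \<le> M" using M(2) by (simp add: ennreal_le_iff)
      then show ?thesis using V(2)[of k] by (simp add: field_simps)
    qed
    then show "\<exists>M. \<forall>k. (\<Sum>l<k. (2 powr q) ^ l * W l) \<le> M * ((2 powr q) ^ k * V k)" by blast
  next
    assume "\<exists>M. \<forall>k. (\<Sum>l<k. (2 powr q) ^ l * W l) \<le> M * ((2 powr q) ^ k * V k)"
    then obtain M where M: "\<And>k. (\<Sum>l<k. (2 powr q) ^ l * W l) \<le> M * ((2 powr q) ^ k * V k)" by blast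
    have M0: "0 \<le> M"
      using M[of 0] V(2)[of 0] by (simp add: zero_le_mult_iff)
    have "Q r \<le> ennreal (2 powr q * 2 powr q * M)" if r: "r \<in> {0..<1}" for r
    proof -
      obtain k where k: "r \<in> dyadic_block k" using dyadic_block_exists[of r] r by auto
      have kr: "dyadic_radius k \<le> r" "r < dyadic_radius (Suc k)" using k by (auto simp: dyadic_block_def)
      \<comment> \<open>The dyadic condition is taken at \<open>Suc k\<close>: then its factor
        V_(k+1) cancels against the lower bound for the tail at r. The two factors 2^q come from the
        step function and from the shift of index.\<close>
      have I: "I r \<le> ennreal (2 powr q * (M * ((2 powr q) ^ Suc k * V (Suc k))))"
        using le[OF kr(2)] M[of "Suc k"] by (meson ennreal_leI mult_left_mono order_trans powr_ge_zero)
      have t: "ennreal (V (Suc k)) \<le> tail_integral \<nu> r"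
        unfolding V(1)[symmetric] using kr by (intro tail_integral_antimono) simp
      have "ennreal ((1 - r) powr q) / tail_integral \<nu> r \<le> ennreal (1 / (2 powr q) ^ k) / ennreal (V (Suc k))"
      proof -
        have "(1 - r) powr q \<le> ((1/2) ^ k) powr q"
          using r q kr one_minus_dyadic_radius[of k] by (intro powr_mono2) auto
        moreover have "tail_integral \<nu> r \<le> ennreal (V k)"
          unfolding V(1)[symmetric] using kr by (intro tail_integral_antimono) simp
        then obtain x where x: "tail_integral \<nu> r = ennreal x" "0 \<le> x"
          by (cases "tail_integral \<nu> r") (auto simp: top_unique)
        have "V (Suc k) \<le> x" using t x by (simp add: ennreal_le_iff)
        ultimately have "(1 - r) powr q / x \<le> (1 / (2 powr q) ^ k) / V (Suc k)"
          unfolding pw using V(2)[of "Suc k"] by (intro frac_le) simp_all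
        moreover have "0 < x" using \<open>V (Suc k) \<le> x\<close> V(2)[of "Suc k"] by linarith
        ultimately show ?thesis
          unfolding x(1) using V(2)[of "Suc k"]
          by (simp only: divide_ennreal powr_ge_zero ennreal_leI zero_le_divide_1_iff zero_le_power)
      qed
      then have "Q r \<le> ennreal (1 / (2 powr q) ^ k) / ennreal (V (Suc k)) * ennreal (2 powr q * (M * ((2 powr q) ^ Suc k * V (Suc k))))"
        unfolding Q_def by (rule mult_mono[OF _ I]) simp_all
      also have "\<dots> = ennreal ((1 / (2 powr q) ^ k) / V (Suc k)) * ennreal (2 powr q * (M * ((2 powr q) ^ Suc k * V (Suc k))))"
        using V(2)[of "Suc k"] by (simp only: divide_ennreal powr_ge_zero zero_le_divide_1_iff zero_le_power)
      also have "\<dots> = ennreal ((1 / (2 powr q) ^ k) / V (Suc k) * (2 powr q * (M * ((2 powr q) ^ Suc k * V (Suc k)))))"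
        using V(2)[of "Suc k"] by (intro ennreal_mult'[symmetric]) simp
      also have "(1 / (2 powr q) ^ k) / V (Suc k) * (2 powr q * (M * ((2 powr q) ^ Suc k * V (Suc k)))) = 2 powr q * 2 powr q * M"
      proof -
        have "(1 / a ^ k) / v * (b * (M * (a ^ Suc k * v))) = b * a * M" if "0 < a" "0 < v" for a b v :: real
          using that by (simp add: field_simps)
        then show ?thesis using V(2)[of "Suc k"] by simp
      qed
      finally show ?thesis .
    qed
    then have "(SUP r\<in>{0..<1}. Q r) \<le> ennreal (2 powr q * 2 powr q * M)" by (rule SUP_least)
    also have "\<dots> < \<infinity>" by simp
    finally show "\<nu> \<in> upper_doubling_q q" using mem by simp
  qed
qed

section \<open>Sufficiency\<close>

text \<open>Means increase with the radius, so each block contributes at least its left endpoint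
  value times its mass.\<close>

lemma ennreal_mixed_norm_ge:
  assumes rw: "radial_weight \<nu>" and g: "g holomorphic_on unit_disc" and p: "1 \<le> p" and q: "0 < q"
  shows "(\<Sum>k. ennreal (integral_mean p (dyadic_radius k) g powr q) * block_mass \<nu> k) \<le> mixed_norm_pow p q \<nu> g"
proof -
  define c where "c k = ennreal (integral_mean p (dyadic_radius k) g powr q)" for k
  have "(\<Sum>k. c k * block_mass \<nu> k) = (\<integral>\<^sup>+ s. (\<Sum>l. c l * indicator (dyadic_block l) s) * ennreal (\<nu> (of_real s)) \<partial>lebesgue)"
    by (rule nn_integral_dyadic_step[OF rw, symmetric])
  also have "\<dots> \<le> mixed_norm_pow p q \<nu> g"
    unfolding mixed_norm_pow_def
  proof (rule nn_integral_mono)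
    fix s :: real
    show "(\<Sum>l. c l * indicator (dyadic_block l) s) * ennreal (\<nu> (of_real s))
      \<le> ennreal (integral_mean p s g powr q * \<nu> (of_real s)) * indicator {0..<1} s"
    proof (cases "s \<in> {0..<1}")
      case True
      then obtain k where k: "s \<in> dyadic_block k" using dyadic_block_exists[of s] by auto
      have "integral_mean p (dyadic_radius k) g \<le> integral_mean p s g"
        using k True by (intro integral_mean_mono g p dyadic_radius_nonneg) (auto simp: dyadic_block_def)
      then have "integral_mean p (dyadic_radius k) g powr q \<le> integral_mean p s g powr q"
        using q by (intro powr_mono2 integral_mean_nonneg) auto
      then show ?thesis
        unfolding dyadic_step_eq[OF k] using True
        by (simp add: c_def ennreal_mult' mult_right_mono ennreal_leI)
    qed (simp add: dyadic_step_zero)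
  qed
  finally show ?thesis by (simp add: c_def)
qed

text \<open>The class condition and lower doubling make u_k = 2^(kq) V_k satisfy the hypothesis of
  the discrete Hardy inequality. This is applied to 2^-j m(x_(j+2)), whose tails bound the modulus
  of continuity. The resulting sum of m(x_(j+2))^q V_j is brought back to the mixed norm by upper
  doubling, lower doubling and monotonicity of m.\<close>

lemma modulus_integral_bound:
  fixes p q :: real and \<nu> :: "complex \<Rightarrow> real"
  assumes p: "1 \<le> p" and q: "0 < q" and \<nu>: "\<nu> \<in> two_sided_doubling" and \<nu>q: "\<nu> \<in> upper_doubling_q q"
  shows "\<exists>C>0. \<forall>f. f holomorphic_on unit_disc \<longrightarrow>
       (\<integral>\<^sup>+ r\<in>{1/2..<1}. ennreal (modulus_of_continuity p (1 - r) f powr q *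
            (\<nu> (of_real r) / (1 - r) powr q)) \<partial>lebesgue)
         \<le> ennreal C * mixed_norm_pow p q \<nu> (deriv f)"
proof -
  have rw: "radial_weight \<nu>" using \<nu> by (auto simp: two_sided_doubling_def upper_doubling_def)
  obtain V W :: "nat \<Rightarrow> real" and C D :: real and L :: nat where
    V: "\<And>k. tail_integral \<nu> (dyadic_radius k) = ennreal (V k)" "\<And>k. 0 < V k" and
    W: "\<And>k. block_mass \<nu> k = ennreal (W k)" "\<And>k. 0 \<le> W k" and VW: "\<And>k. V k = W k + V (Suc k)" and
    C: "1 \<le> C" "\<And>k. V k \<le> C * V (Suc k)" and D: "0 < D" "\<And>k. V k \<le> D * (\<Sum>i<L. W (k + i))"
    using two_sided_doubling_dyadic[OF \<nu>] by metis
  define a where "a = 2 powr q"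
  have a: "1 \<le> a" using q by (simp add: a_def ge_one_powr_ge_zero)
  obtain M where M: "\<And>k. (\<Sum>l<k. a ^ l * W l) \<le> M * (a ^ k * V k)"
    using \<nu>q upper_doubling_q_dyadic[OF \<nu> q V W] unfolding a_def by blast
  have M0: "0 \<le> M" using M[of 0] V(2)[of 0] by (simp add: zero_le_mult_iff)
  have Vdec: "V (k + n) \<le> V k" for k n
  proof (induction n)
    case (Suc n)
    then show ?case using VW[of "k + n"] W(2)[of "k + n"] by simp
  qed simp
  define u where "u k = a ^ k * V k" for k
  have u0: "0 < u k" for k using a V(2)[of k] by (simp add: u_def)
  have usum: "(\<Sum>k\<le>j. u k) \<le> (D * (real L * (M * a ^ Suc L))) * u j" for j
  proof -
    \<comment> \<open>Each tail is replaced by L consecutive masses. After exchanging the sums,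
      every inner sum runs over indices k + i < j + L and falls under the class condition at j + L +
      1; V_(j+L+1) \<le> V_j then returns to u_j.\<close>
    have "(\<Sum>k\<le>j. u k) \<le> (\<Sum>k\<le>j. D * (\<Sum>i<L. a ^ (k + i) * W (k + i)))"
    proof (rule sum_mono)
      fix k
      have "u k \<le> a ^ k * (D * (\<Sum>i<L. W (k + i)))"
        unfolding u_def using a by (intro mult_left_mono D) auto
      also have "\<dots> = D * (\<Sum>i<L. a ^ k * W (k + i))" by (simp add: sum_distrib_left mult_ac)
      also have "\<dots> \<le> D * (\<Sum>i<L. a ^ (k + i) * W (k + i))"
        using a D W(2) by (intro mult_left_mono sum_mono mult_right_mono power_increasing) auto
      finally show "u k \<le> D * (\<Sum>i<L. a ^ (k + i) * W (k + i))" .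
    qed
    also have "\<dots> = D * (\<Sum>i<L. \<Sum>k\<le>j. a ^ (k + i) * W (k + i))"
      by (simp add: sum_distrib_left[symmetric] sum.swap[of _ "{..j}"])
    also have "\<dots> \<le> D * (\<Sum>i<L. M * (a ^ (j + Suc L) * V (j + Suc L)))"
    proof (intro mult_left_mono sum_mono)
      fix i assume i: "i \<in> {..<L}"
      have "(\<Sum>k\<le>j. a ^ (k + i) * W (k + i)) = (\<Sum>l\<in>(\<lambda>k. k + i) ` {..j}. a ^ l * W l)"
        by (subst sum.reindex) (auto simp: inj_on_def)
      also have "\<dots> \<le> (\<Sum>l<j + Suc L. a ^ l * W l)"
        using i a W(2) by (intro sum_mono2) auto
      also have "\<dots> \<le> M * (a ^ (j + Suc L) * V (j + Suc L))" by (rule M)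
      finally show "(\<Sum>k\<le>j. a ^ (k + i) * W (k + i)) \<le> M * (a ^ (j + Suc L) * V (j + Suc L))" .
    qed (use D in auto)
    also have "\<dots> \<le> D * (\<Sum>i<L. M * (a ^ (j + Suc L) * V j))"
      using D M0 a by (intro mult_left_mono sum_mono Vdec) auto
    also have "\<dots> = (D * (real L * (M * a ^ Suc L))) * u j"
      by (simp add: u_def power_add mult_ac)
    finally show ?thesis .
  qed
  obtain H where H: "0 < H" "\<And>b. (\<And>j. 0 \<le> b j) \<Longrightarrow> summable (\<lambda>j. b j powr q * u j) \<Longrightarrow>
      summable b \<and> summable (\<lambda>k. u k * (\<Sum>j. b (k + j)) powr q) \<and>
      (\<Sum>k. u k * (\<Sum>j. b (k + j)) powr q) \<le> H * (\<Sum>j. b j powr q * u j)"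
    using discrete_Hardy_inequality[OF u0 usum q] by blast
  define E where "E = (16000 * pi) powr q * a * (H * (C * C * (D * real L)))"
  have E0: "0 \<le> E" using a H C D by (simp add: E_def)
  show ?thesis
  proof (intro exI[of _ "E + 1"] conjI allI impI)
    show "0 < E + 1" using E0 by simp
    fix f assume f: "f holomorphic_on unit_disc"
    have g: "deriv f holomorphic_on unit_disc" using f by (intro holomorphic_deriv) auto
    let ?LHS = "\<integral>\<^sup>+ r\<in>{1/2..<1}. ennreal (modulus_of_continuity p (1 - r) f powr q *
            (\<nu> (of_real r) / (1 - r) powr q)) \<partial>lebesgue"
    show "?LHS \<le> ennreal (E + 1) * mixed_norm_pow p q \<nu> (deriv f)"
    proof (cases "mixed_norm_pow p q \<nu> (deriv f) = top")
      case True
      then show ?thesis using E0 by (simp add: ennreal_mult_top)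
    next
      case False
      then obtain N where N: "mixed_norm_pow p q \<nu> (deriv f) = ennreal N" "0 \<le> N"
        by (cases "mixed_norm_pow p q \<nu> (deriv f)") auto
      define m where "m k = integral_mean p (dyadic_radius k) (deriv f)" for k
      have m0: "0 \<le> m k" for k by (simp add: m_def integral_mean_nonneg)
      have mW_le: "(\<Sum>k. ennreal (m k powr q * W k)) \<le> ennreal N"
        using ennreal_mixed_norm_ge[OF rw g p q] by (simp add: N(1) m_def W(1) ennreal_mult')
      have mW: "summable (\<lambda>k. m k powr q * W k)"
        using mW_le W(2) by (intro summable_suminf_not_top) (auto simp: top_unique)
      then have mWN: "(\<Sum>k. m k powr q * W k) \<le> N"
        using mW_le W(2) N(2) by (subst (asm) suminf_ennreal2) (auto simp: ennreal_le_iff)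
      have mmono: "m j \<le> m k" if "j \<le> k" for j k
        unfolding m_def using that by (intro integral_mean_mono g p dyadic_radius_nonneg dyadic_radius_le dyadic_radius_less_1)
      have shift: "summable (\<lambda>k. m (k + i) powr q * W (k + i))" for i
        using summable_ignore_initial_segment[OF mW, of i] .
      have shiftN: "(\<Sum>k. m (k + i) powr q * W (k + i)) \<le> N" for i
        using suminf_split_initial_segment[OF mW, of i] mWN W(2) sum_nonneg[of "{..<i}" "\<lambda>k. m k powr q * W k"] by simp
      \<comment> \<open>The passage from masses to tails: m_k \<le> m_(k+i) lets the L masses
        bounding V_k carry the means of their own blocks, so the right-hand side consists of shifted
        pieces of the mixed norm.\<close>
      have mV_pw: "m k powr q * V k \<le> D * (\<Sum>i<L. m (k + i) powr q * W (k + i))" for k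
      proof -
        have "m k powr q * V k \<le> m k powr q * (D * (\<Sum>i<L. W (k + i)))"
          by (intro mult_left_mono D) auto
        also have "\<dots> = D * (\<Sum>i<L. m k powr q * W (k + i))" by (simp add: sum_distrib_left mult_ac)
        also have "\<dots> \<le> D * (\<Sum>i<L. m (k + i) powr q * W (k + i))"
          using D W(2) q m0 mmono by (intro mult_left_mono sum_mono mult_right_mono powr_mono2) auto
        finally show ?thesis .
      qed
      have mVs: "summable (\<lambda>k. D * (\<Sum>i<L. m (k + i) powr q * W (k + i)))"
        by (intro summable_mult summable_sum shift)
      have mV: "summable (\<lambda>k. m k powr q * V k)"
        using mV_pw V(2) by (intro summable_comparison_test'[OF mVs, of 0]) (auto simp: less_imp_le)
      have mVN: "(\<Sum>k. m k powr q * V k) \<le> D * (real L * N)"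
      proof -
        have "(\<Sum>k. m k powr q * V k) \<le> (\<Sum>k. D * (\<Sum>i<L. m (k + i) powr q * W (k + i)))"
          by (rule suminf_le[OF mV_pw mV mVs])
        also have "\<dots> = D * (\<Sum>i<L. \<Sum>k. m (k + i) powr q * W (k + i))"
          by (subst suminf_mult[OF summable_sum[OF shift]], subst suminf_sum[OF shift]) simp
        also have "\<dots> \<le> D * (\<Sum>i<L. N)" using D by (intro mult_left_mono sum_mono shiftN) auto
        finally show ?thesis by simp
      qed
      \<comment> \<open>The terms of the bound for the modulus of continuity; (2^-j)^q cancels the
        factor 2^(jq) in u_j.\<close>
      define b where "b j = (1/2) ^ j * m (j + 2)" for j
      have b0: "0 \<le> b j" for j using m0 by (simp add: b_def)
      have bu: "b j powr q * u j = m (j + 2) powr q * V j" for j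
      proof -
        have "((1/2) ^ j) powr q * a ^ j = 1"
          by (simp add: a_def powr_realpow[symmetric] powr_powr powr_divide mult.commute)
        then have "((1/2) ^ j) powr q * m (j + 2) powr q * (a ^ j * V j) = m (j + 2) powr q * V j"
          by (metis (no_types, opaque_lifting) mult.assoc mult.commute mult.left_neutral)
        then show ?thesis using m0 by (simp add: b_def u_def powr_mult)
      qed
      \<comment> \<open>Upper doubling twice, to match the index of the tail with the index j + 2 of
        the mean.\<close>
      have bu_le: "b j powr q * u j \<le> C * C * (m (j + 2) powr q * V (j + 2))" for j
      proof -
        have "V j \<le> C * (C * V (Suc (Suc j)))"
          using C(2)[of j] mult_left_mono[OF C(2)[of "Suc j"], of C] C(1) by linarith
        then have "m (j + 2) powr q * V j \<le> m (j + 2) powr q * (C * (C * V (Suc (Suc j))))"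
          by (intro mult_left_mono) auto
        then show ?thesis unfolding bu by (simp add: mult_ac)
      qed
      have mV2: "summable (\<lambda>j. C * C * (m (j + 2) powr q * V (j + 2)))"
        by (intro summable_mult summable_ignore_initial_segment[OF mV])
      have bs: "summable (\<lambda>j. b j powr q * u j)"
        using bu_le u0 by (intro summable_comparison_test'[OF mV2, of 0]) (auto simp: less_imp_le)
      have bsN: "(\<Sum>j. b j powr q * u j) \<le> C * C * (D * (real L * N))"
      proof -
        have "(\<Sum>j. b j powr q * u j) \<le> (\<Sum>j. C * C * (m (j + 2) powr q * V (j + 2)))"
          by (rule suminf_le[OF bu_le bs mV2])
        also have "\<dots> = C * C * (\<Sum>j. m (j + 2) powr q * V (j + 2))"
          by (rule suminf_mult[OF summable_ignore_initial_segment[OF mV]])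
        also have "(\<Sum>j. m (j + 2) powr q * V (j + 2)) \<le> (\<Sum>k. m k powr q * V k)"
          using suminf_split_initial_segment[OF mV, of 2] V(2) sum_nonneg[of "{..<2}" "\<lambda>k. m k powr q * V k"]
          by (simp add: less_imp_le)
        also note mVN
        finally show ?thesis using C(1) by (simp add: mult_left_mono)
      qed
      define s where "s k = (\<Sum>j. b (k + j))" for k
      have hardy: "summable b" "summable (\<lambda>k. u k * s k powr q)" "(\<Sum>k. u k * s k powr q) \<le> H * (\<Sum>j. b j powr q * u j)"
        using H(2)[OF b0 bs] by (auto simp: s_def)
      have s0: "0 \<le> s k" for k
        unfolding s_def using summable_ignore_initial_segment[OF hardy(1), of k] b0
        by (intro suminf_nonneg) (auto simp: add.commute)
      \<comment> \<open>Bounds the integrand on block k: the modulus at 1 - r \<le> 2^-k by s_k, and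
        (1 - r)^(-q) by 2^((k+1)q).\<close>
      define c where "c k = ennreal ((16000 * pi * s k) powr q * a ^ Suc k)" for k
      have "?LHS \<le> (\<integral>\<^sup>+ r. (\<Sum>k. c k * indicator (dyadic_block k) r) * ennreal (\<nu> (of_real r)) \<partial>lebesgue)"
      proof (rule nn_integral_mono)
        fix r :: real
        show "ennreal (modulus_of_continuity p (1 - r) f powr q * (\<nu> (of_real r) / (1 - r) powr q)) * indicator {1/2..<1} r
          \<le> (\<Sum>k. c k * indicator (dyadic_block k) r) * ennreal (\<nu> (of_real r))"
        proof (cases "r \<in> {1/2..<1}")
          case True
          then obtain k where k: "r \<in> dyadic_block k" using dyadic_block_exists[of r] by auto
          have r: "0 < 1 - r" "1 - r \<le> (1/2) ^ k" "(1/2) ^ Suc k \<le> 1 - r"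
            using k True by (auto simp: dyadic_block_def dyadic_radius_def)
          have \<nu>0: "0 \<le> \<nu> (of_real r)"
          proof -
            have "\<forall>z\<in>unit_disc. 0 \<le> \<nu> z" using rw unfolding radial_weight_def by blast
            then show ?thesis using True by auto
          qed
          have "summable (\<lambda>j. (1/2) ^ j * integral_mean p (dyadic_radius (j + 2)) (deriv f))"
            using hardy(1) by (simp add: b_def[abs_def] m_def)
          note mod = modulus_of_continuity_le[OF f p r(1,2) this]
          have "modulus_of_continuity p (1 - r) f powr q \<le> (16000 * pi * s k) powr q"
            using mod q by (intro powr_mono2) (auto simp: s_def b_def m_def)
          moreover have "1 / (1 - r) powr q \<le> a ^ Suc k"
          proof -
            have "((1/2) ^ Suc k) powr q \<le> (1 - r) powr q"
              using r(3) q by (intro powr_mono2) auto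
            moreover have "((1/2) ^ Suc k) powr q = 1 / a ^ Suc k"
              unfolding a_def by (simp add: powr_realpow[symmetric] powr_powr powr_divide mult.commute del: power_Suc)
            ultimately have "1 / a ^ Suc k \<le> (1 - r) powr q" by metis
            moreover have "0 < (1 - r) powr q" "0 < a ^ Suc k" using r a by (simp_all del: power_Suc)
            ultimately show ?thesis by (simp add: field_simps del: power_Suc)
          qed
          ultimately have "modulus_of_continuity p (1 - r) f powr q * (1 / (1 - r) powr q) \<le> (16000 * pi * s k) powr q * a ^ Suc k"
            by (intro mult_mono) auto
          from mult_right_mono[OF this \<nu>0]
          show ?thesis
            unfolding dyadic_step_eq[OF k] using True \<nu>0 a
            by (simp add: c_def ennreal_mult'[symmetric] ennreal_leI del: power_Suc)
        qed simp
      qed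
      also have "\<dots> = (\<Sum>k. c k * block_mass \<nu> k)" by (rule nn_integral_dyadic_step[OF rw])
      also have "\<dots> \<le> (\<Sum>k. ennreal ((16000 * pi) powr q * a * (u k * s k powr q)))"
      proof (intro suminf_le summableI)
        fix k
        have "W k \<le> V k" using VW[of k] V(2)[of "Suc k"] by linarith
        then have "(16000 * pi * s k) powr q * a ^ Suc k * W k \<le> (16000 * pi * s k) powr q * a ^ Suc k * V k"
          using a by (intro mult_left_mono) auto
        also have "\<dots> = (16000 * pi) powr q * a * (u k * s k powr q)"
          using s0 by (simp add: u_def powr_mult mult_ac)
        finally show "c k * block_mass \<nu> k \<le> ennreal ((16000 * pi) powr q * a * (u k * s k powr q))"
          using a by (simp add: c_def W(1) ennreal_mult'[symmetric] ennreal_leI del: power_Suc)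
      qed
      also have "\<dots> = ennreal ((16000 * pi) powr q * a * (\<Sum>k. u k * s k powr q))"
        using u0 a hardy(2) by (subst suminf_ennreal2) (auto simp: less_imp_le suminf_mult)
      also have "\<dots> \<le> ennreal ((16000 * pi) powr q * a * (H * (C * C * (D * (real L * N)))))"
        using a H(1) hardy(3) bsN by (intro ennreal_leI mult_left_mono order_trans[OF hardy(3)] mult_left_mono) auto
      also have "\<dots> = ennreal (E * N)" by (simp add: E_def mult_ac)
      also have "\<dots> \<le> ennreal ((E + 1) * N)" using N(2) by (intro ennreal_leI mult_right_mono) auto
      also have "\<dots> = ennreal (E + 1) * mixed_norm_pow p q \<nu> (deriv f)"
        using E0 by (simp add: N(1) ennreal_mult')
      finally show ?thesis .
    qed
  qed
qed

section \<open>Necessity\<close>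

lemma integral_mean_monomial:
  fixes c :: complex
  assumes "0 < p" "0 \<le> r"
  shows "integral_mean p r (\<lambda>z. c * z ^ n) = cmod c * r ^ n"
proof -
  have "(LINT \<theta>:{0..2*pi}|lebesgue. cmod (c * (of_real r * cis \<theta>) ^ n) powr p) = 2 * pi * (cmod c * r ^ n) powr p"
    using assms by (simp add: norm_mult norm_power set_integral_const)
  then show ?thesis using assms by (simp add: integral_mean_def powr_powr)
qed

lemma boundary_value_monomial:
  assumes "cmod \<zeta> = 1"
  shows "boundary_value (\<lambda>z. z ^ n) \<zeta> = \<zeta> ^ n"
  using assms
  by (intro boundary_value_eqI) (auto simp: has_nontangential_limit_def intro!: tendsto_intros)

lemma monomial_in_hardy_space:
  assumes "0 < p" shows "(\<lambda>z. z ^ n) \<in> hardy_space p"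
proof -
  have "hardy_norm p (\<lambda>z. z ^ n) \<le> 1"
    unfolding hardy_norm_def
  proof (rule SUP_least)
    fix r :: real assume "r \<in> {0..<1}"
    then show "ennreal (integral_mean p r (\<lambda>z. z ^ n)) \<le> 1"
      using integral_mean_monomial[OF assms, of r 1 n] by (simp add: power_le_one ennreal_le_1)
  qed
  then have "hardy_norm p (\<lambda>z. z ^ n) < \<infinity>" by (auto intro: le_less_trans)
  then show ?thesis by (auto simp: hardy_space_def intro!: holomorphic_intros)
qed

text \<open>At h = pi/n the values of z^n at the two points are opposite, so the difference has
  modulus 2 for every \<theta>. Boundedness in h is checked first, as the real supremum requires
  it.\<close>

lemma modulus_of_continuity_monomial:
  assumes p: "1 \<le> p" and n: "0 < n" and t: "pi / real n < t"
  shows "1 \<le> modulus_of_continuity p t (\<lambda>z. z ^ n)"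
proof -
  define G where "G h = (LINT \<theta>:{0..2*pi}|lebesgue.
     cmod (boundary_value (\<lambda>z. z ^ n) (cis (\<theta> + h)) - boundary_value (\<lambda>z. z ^ n) (cis \<theta>)) powr p) powr (1 / p)" for h
  have G: "G h = (2 * pi * cmod (cis (real n * h) - 1) powr p) powr (1/p)" for h
  proof -
    have "cmod (boundary_value (\<lambda>z. z ^ n) (cis (\<theta> + h)) - boundary_value (\<lambda>z. z ^ n) (cis \<theta>)) = cmod (cis (real n * h) - 1)" for \<theta>
    proof -
      have "cis (\<theta> + h) ^ n - cis \<theta> ^ n = cis \<theta> ^ n * (cis (real n * h) - 1)"
        using Complex.DeMoivre[of h n] by (simp only: cis_mult[symmetric] power_mult_distrib right_diff_distrib mult_1_right)
      then show ?thesis by (simp add: boundary_value_monomial norm_mult norm_power)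
    qed
    then show ?thesis by (simp add: G_def set_integral_const)
  qed
  have bdd: "bdd_above (G ` {0<..<t})"
  proof (intro bdd_aboveI2)
    fix h
    have "cmod (cis (real n * h) - 1) \<le> 2" using norm_triangle_ineq4[of "cis (real n * h)" 1] by simp
    then show "G h \<le> (2 * pi * 2 powr p) powr (1/p)"
      unfolding G using p by (intro powr_mono2 mult_left_mono) auto
  qed
  have "cis (real n * (pi / real n)) = -1" using n by simp
  then have "G (pi / real n) = (2 * pi * 2 powr p) powr (1/p)" unfolding G by simp
  moreover have "1 \<le> (2 * pi * 2 powr p) powr (1/p)"
  proof (rule ge_one_powr_ge_zero)
    have "1 * 1 \<le> (2 * pi) * 2 powr p"
      using p pi_ge_two by (intro mult_mono ge_one_powr_ge_zero) auto
    then show "1 \<le> 2 * pi * 2 powr p" by simp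
  qed (use p in auto)
  moreover have "G (pi / real n) \<le> (SUP h\<in>{0<..<t}. G h)"
    using n t by (intro cSUP_upper bdd) auto
  ultimately show ?thesis by (simp add: modulus_of_continuity_def G_def)
qed

text \<open>A single term y^N / N! of the exponential series at y = q 2^i suffices: with 2^N > 2 C
  the factor 2^(-iN) turns C^i into at most 2^-i.\<close>

lemma doubling_exp_summable:
  fixes C q :: real
  assumes "0 < q" "0 \<le> C"
  shows "summable (\<lambda>i. exp (- (q * 2 ^ i)) * C ^ i)"
proof -
  obtain N where N: "2 * C < 2 ^ N" using real_arch_pow[of 2 "2 * C"] by auto
  have bound: "exp (- (q * 2 ^ i)) * C ^ i \<le> fact N / q ^ N * (1/2) ^ i" for i :: nat
  proof -
    have y: "0 < q * 2 ^ i" using assms by simp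
    have "(q * 2 ^ i) ^ N / fact N \<le> exp (q * 2 ^ i)"
    proof -
      have "(\<Sum>n\<in>{N}. (q * 2 ^ i) ^ n /\<^sub>R fact n) \<le> (\<Sum>n. (q * 2 ^ i) ^ n /\<^sub>R fact n)"
        using y by (intro sum_le_suminf summable_exp_generic) auto
      then show ?thesis by (simp add: exp_def divide_inverse mult.commute)
    qed
    then have "inverse (exp (q * 2 ^ i)) \<le> inverse ((q * 2 ^ i) ^ N / fact N)"
      using y by (intro le_imp_inverse_le) (auto intro!: divide_pos_pos zero_less_power)
    then have "exp (- (q * 2 ^ i)) \<le> fact N / (q * 2 ^ i) ^ N"
      by (simp only: exp_minus inverse_divide)
    then have "exp (- (q * 2 ^ i)) * C ^ i \<le> fact N / (q * 2 ^ i) ^ N * C ^ i"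
      using assms by (intro mult_right_mono) auto
    also have "\<dots> = fact N / q ^ N * (C / 2 ^ N) ^ i"
      by (simp add: power_mult_distrib power_divide power_mult[symmetric] mult.commute)
    also have "\<dots> \<le> fact N / q ^ N * (1/2) ^ i"
      using assms N by (intro mult_left_mono power_mono) (auto simp: field_simps)
    finally show ?thesis .
  qed
  have "summable (\<lambda>i. fact N / q ^ N * (1/2 :: real) ^ i)"
    by (intro summable_mult summable_geometric) auto
  then show ?thesis
    by (rule summable_comparison_test'[where N = 0]) (use bound assms in auto)
qed

text \<open>For z^n with n = 2^(k+2) the left-hand side dominates the sum of 2^(lq) W_l over 1 \<le>
  l < k. The mixed norm is at most n^q (1 + S) V_k: blocks from k on have total mass at most V_k,
  and on inner blocks the decay of z^(n-1) beats the growth V_j \<le> C^(k-j) V_k. Since n^q is a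
  multiple of 2^(kq), this is the dyadic class condition apart from block 0.\<close>

lemma upper_doubling_q_necessary:
  fixes p q :: real and \<nu> :: "complex \<Rightarrow> real"
  assumes p: "1 \<le> p" and q: "0 < q" and \<nu>: "\<nu> \<in> two_sided_doubling" and B: "0 < B"
    and ineq: "\<And>f. f \<in> hardy_space p \<Longrightarrow>
       (\<integral>\<^sup>+ r\<in>{1/2..<1}. ennreal (modulus_of_continuity p (1 - r) f powr q *
            (\<nu> (of_real r) / (1 - r) powr q)) \<partial>lebesgue)
         \<le> ennreal B * mixed_norm_pow p q \<nu> (deriv f)"
  shows "\<nu> \<in> upper_doubling_q q"
proof -
  have rw: "radial_weight \<nu>" using \<nu> by (auto simp: two_sided_doubling_def upper_doubling_def)
  have nn: "0 \<le> \<nu> (of_real s)" if "s \<in> {0..<1}" for s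
  proof -
    have "\<forall>z\<in>unit_disc. 0 \<le> \<nu> z" using rw unfolding radial_weight_def by blast
    then show ?thesis using that by auto
  qed
  obtain V W :: "nat \<Rightarrow> real" and C D :: real and L :: nat where
    V: "\<And>k. tail_integral \<nu> (dyadic_radius k) = ennreal (V k)" "\<And>k. 0 < V k" and
    W: "\<And>k. block_mass \<nu> k = ennreal (W k)" "\<And>k. 0 \<le> W k" and VW: "\<And>k. V k = W k + V (Suc k)" and
    C: "1 \<le> C" "\<And>k. V k \<le> C * V (Suc k)" and D: "0 < D" "\<And>k. V k \<le> D * (\<Sum>i<L. W (k + i))"
    using two_sided_doubling_dyadic[OF \<nu>] by metis
  define a where "a = 2 powr q"
  have a: "1 \<le> a" using q by (simp add: a_def ge_one_powr_ge_zero)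
  have apow: "((1/2) ^ k) powr q = 1 / a ^ k" for k
    unfolding a_def by (simp add: powr_realpow[symmetric] powr_powr powr_divide mult.commute)
  have Vdec: "V (k + n) \<le> V k" for k n
  proof (induction n)
    case (Suc n)
    then show ?case using VW[of "k + n"] W(2)[of "k + n"] by simp
  qed simp
  have Vpow: "V j \<le> C ^ i * V (j + i)" for i j
  proof (induction i)
    case (Suc i)
    have "C ^ i * V (j + i) \<le> C ^ i * (C * V (Suc (j + i)))" using C(1) by (intro mult_left_mono C) auto
    then show ?case using Suc by (simp add: mult_ac)
  qed simp
  have Wsum: "(\<Sum>j<n. W (k + j)) = V k - V (k + n)" for k n
  proof (induction n)
    case (Suc n)
    then show ?case using VW[of "k + n"] by simp
  qed simp
  define S where "S = (\<Sum>i. exp (- (q * 2 ^ Suc i)) * C ^ Suc i)"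
  have Ssum: "summable (\<lambda>i. exp (- (q * 2 ^ Suc i)) * C ^ Suc i)"
    using doubling_exp_summable[OF q, of C] C(1) by (subst summable_Suc_iff) auto
  have S0: "0 \<le> S" unfolding S_def using C(1) by (intro suminf_nonneg Ssum) auto
  \<comment> \<open>The largest value on block j of the q-th power of the mean of f', with the
    factor n^q removed.\<close>
  define e where "e k j = (dyadic_radius (Suc j) ^ (2 ^ (k + 2) - 1)) powr q" for k j :: nat
  have e0: "0 \<le> e k j" for k j by (simp add: e_def)
  have e1: "e k j \<le> 1" for k j
    unfolding e_def using q dyadic_radius_nonneg[of "Suc j"] dyadic_radius_less_1[of "Suc j"]
    by (intro powr_le1) (auto intro!: power_le_one)
  \<comment> \<open>From x_(j+1) \<le> exp(-2^-(j+1)) and the exponent 2^(k+2) - 1 \<ge> 2^(k+1):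
    double exponential decay in k - j.\<close>
  have e_le: "e k j \<le> exp (- (q * 2 ^ (k - j)))" if "j < k" for k j
  proof -
    define x where "x = (1/2 :: real) ^ Suc j"
    define N :: nat where "N = 2 ^ (k + 2) - 1"
    have N: "real (2 ^ (k + 1)) \<le> real N"
      unfolding N_def by (subst of_nat_le_iff) (simp add: nat_power_eq_Suc_0_iff)
    have "dyadic_radius (Suc j) \<le> exp (- x)"
      using exp_ge_add_one_self[of "-x"] by (simp add: dyadic_radius_def x_def)
    then have "e k j \<le> (exp (- x) ^ N) powr q"
      unfolding e_def N_def using q dyadic_radius_nonneg by (intro powr_mono2 power_mono) auto
    also have "\<dots> = exp (- (q * (real N * x)))"
      by (simp add: exp_powr_real exp_of_nat_mult[symmetric] mult_ac)
    also have "\<dots> \<le> exp (- (q * 2 ^ (k - j)))"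
    proof -
      have "2 ^ (k - j) = real (2 ^ (k + 1)) * x"
        using that by (simp add: x_def power_diff power_one_over field_simps)
      also have "\<dots> \<le> real N * x" using N by (intro mult_right_mono) (auto simp: x_def)
      finally show ?thesis using q by simp
    qed
    finally show ?thesis .
  qed
  have eW: "(\<Sum>j<n. e k j * W j) \<le> (1 + S) * V k" for k n
  proof -
    have "(\<Sum>j<n. e k j * W j) \<le> (\<Sum>j<k + n. e k j * W j)"
      using e0 W(2) by (intro sum_mono2) auto
    also have "\<dots> = (\<Sum>j<k. e k j * W j) + (\<Sum>j<n. e k (k + j) * W (k + j))"
    proof -
      have "(\<Sum>j<k + n. e k j * W j) = (\<Sum>j=0..<k. e k j * W j) + (\<Sum>j=k..<k + n. e k j * W j)"
        unfolding lessThan_atLeast0 by (rule sum.atLeastLessThan_concat[symmetric]) auto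
      also have "(\<Sum>j=k..<k + n. e k j * W j) = (\<Sum>j<n. e k (k + j) * W (k + j))"
        using sum.shift_bounds_nat_ivl[of "\<lambda>j. e k j * W j" 0 k n]
        by (simp add: add.commute lessThan_atLeast0)
      finally show ?thesis by (simp add: lessThan_atLeast0)
    qed
    also have "(\<Sum>j<n. e k (k + j) * W (k + j)) \<le> (\<Sum>j<n. 1 * W (k + j))"
      using e1 W(2) by (intro sum_mono mult_right_mono) auto
    also have "\<dots> \<le> V k" using Wsum[of k n] V(2)[of "k + n"] by simp
    \<comment> \<open>The exponent k - j is written as \<open>Suc (k - Suc j)\<close> so that
      reflecting the summation index yields an initial segment of the series S, which does not
      depend on k.\<close>
    also have "(\<Sum>j<k. e k j * W j) \<le> (\<Sum>j<k. exp (- (q * 2 ^ Suc (k - Suc j))) * C ^ Suc (k - Suc j) * V k)"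
    proof (rule sum_mono)
      fix j assume j: "j \<in> {..<k}"
      have "W j \<le> V j" using VW[of j] V(2)[of "Suc j"] by linarith
      also have "V j \<le> C ^ (k - j) * V k" using Vpow[of j "k - j"] j by simp
      finally have "e k j * W j \<le> exp (- (q * 2 ^ (k - j))) * (C ^ (k - j) * V k)"
        using j W(2) by (intro mult_mono e_le) auto
      moreover have "Suc (k - Suc j) = k - j" using j by auto
      ultimately show "e k j * W j \<le> exp (- (q * 2 ^ Suc (k - Suc j))) * C ^ Suc (k - Suc j) * V k"
        by (simp only: mult.assoc)
    qed
    also have "\<dots> = (\<Sum>i<k. exp (- (q * 2 ^ Suc i)) * C ^ Suc i * V k)"
      by (rule sum.nat_diff_reindex)
    also have "\<dots> = (\<Sum>i<k. exp (- (q * 2 ^ Suc i)) * C ^ Suc i) * V k"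
      by (rule sum_distrib_right[symmetric])
    also have "\<dots> \<le> S * V k"
      unfolding S_def using C(1) V(2)[of k] by (intro mult_right_mono sum_le_suminf Ssum) auto
    finally show ?thesis by (simp add: algebra_simps)
  qed
  define F where "F = B * (4 powr q * (1 + S))"
  have F0: "0 \<le> F" using B S0 by (simp add: F_def)
  have main: "(\<Sum>l\<in>{1..<k}. a ^ l * W l) \<le> F * (a ^ k * V k)" for k
  proof -
    define n :: nat where "n = 2 ^ (k + 2)"
    have n: "0 < n" by (simp add: n_def)
    define f where "f = (\<lambda>z::complex. z ^ n)"
    have f: "f \<in> hardy_space p" unfolding f_def using p by (intro monomial_in_hardy_space) auto
    have df: "deriv f = (\<lambda>z. of_nat n * z ^ (n - 1))"
      unfolding f_def by (intro ext DERIV_imp_deriv) (auto intro!: derivative_eq_intros)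
    define c where "c l = (if 1 \<le> l \<and> l < k then ennreal (a ^ l) else 0)" for l
    have "ennreal (\<Sum>l\<in>{1..<k}. a ^ l * W l) = (\<Sum>l\<in>{1..<k}. c l * block_mass \<nu> l)"
      using W(2) a by (subst sum_ennreal[symmetric]) (auto simp: c_def W(1) ennreal_mult)
    also have "\<dots> \<le> (\<Sum>l. c l * block_mass \<nu> l)"
      by (rule sum_le_suminf) auto
    also have "\<dots> = (\<integral>\<^sup>+ s. (\<Sum>l. c l * indicator (dyadic_block l) s) * ennreal (\<nu> (of_real s)) \<partial>lebesgue)"
      by (rule nn_integral_dyadic_step[OF rw, symmetric])
    also have "\<dots> \<le> (\<integral>\<^sup>+ r\<in>{1/2..<1}. ennreal (modulus_of_continuity p (1 - r) f powr q *
            (\<nu> (of_real r) / (1 - r) powr q)) \<partial>lebesgue)"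
    proof (rule nn_integral_mono)
      fix s :: real
      show "(\<Sum>l. c l * indicator (dyadic_block l) s) * ennreal (\<nu> (of_real s))
        \<le> ennreal (modulus_of_continuity p (1 - s) f powr q * (\<nu> (of_real s) / (1 - s) powr q)) * indicator {1/2..<1} s"
      proof (cases "s \<in> {0..<1}")
        case True
        then obtain l where l: "s \<in> dyadic_block l" using dyadic_block_exists[of s] by auto
        show ?thesis
        proof (cases "1 \<le> l \<and> l < k")
          case lk: True
          have s: "dyadic_radius l \<le> s" "s < dyadic_radius (l + 1)" using l by (auto simp: dyadic_block_def)
          have s2: "1/2 \<le> s" using s(1) dyadic_radius_le[of 1 l] lk by (simp add: dyadic_radius_def)
          have "(1/2) ^ k < 1 - s"
            using s(2) dyadic_radius_le[of "l + 1" k] lk one_minus_dyadic_radius[of k] by simp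
          \<comment> \<open>With n = 4 * 2^k this is pi < 4. Thus the antipodal shift pi/n is
            admissible for every radius s below x_k.\<close>
          moreover have "pi / real n \<le> (1/2) ^ k"
            using pi_less_4 by (simp add: n_def power_add power_one_over field_simps)
          ultimately have "1 \<le> modulus_of_continuity p (1 - s) f"
            unfolding f_def by (intro modulus_of_continuity_monomial p n) linarith
          then have m1: "1 \<le> modulus_of_continuity p (1 - s) f powr q"
            using q by (intro ge_one_powr_ge_zero) auto
          have "(1 - s) powr q \<le> ((1/2) ^ l) powr q"
            using s True q one_minus_dyadic_radius[of l] by (intro powr_mono2) auto
          then have al: "a ^ l \<le> 1 / (1 - s) powr q"
            unfolding apow using True a by (simp add: field_simps)
          have "a ^ l * \<nu> (of_real s) \<le> 1 / (1 - s) powr q * \<nu> (of_real s)"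
            using al nn[OF True] by (rule mult_right_mono)
          also have "\<dots> = 1 * (\<nu> (of_real s) / (1 - s) powr q)" by simp
          also have "\<dots> \<le> modulus_of_continuity p (1 - s) f powr q * (\<nu> (of_real s) / (1 - s) powr q)"
            using m1 nn[OF True] by (intro mult_right_mono) auto
          finally show ?thesis
            unfolding dyadic_step_eq[OF l] using True s2 lk a nn[OF True]
            by (simp add: c_def ennreal_mult'[symmetric] ennreal_leI)
        next
          case False
          then have "c l = 0" unfolding c_def by (rule if_not_P)
          then show ?thesis unfolding dyadic_step_eq[OF l] by simp
        qed
      qed (simp add: dyadic_step_zero)
    qed
    also have "\<dots> \<le> ennreal B * mixed_norm_pow p q \<nu> (deriv f)" by (rule ineq[OF f])
    also have "\<dots> \<le> ennreal B * ennreal (real n powr q * ((1 + S) * V k))"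
    proof (rule mult_left_mono)
      define d where "d j = ennreal (real n powr q * e k j)" for j
      have "mixed_norm_pow p q \<nu> (deriv f) \<le> (\<integral>\<^sup>+ s. (\<Sum>j. d j * indicator (dyadic_block j) s) * ennreal (\<nu> (of_real s)) \<partial>lebesgue)"
        unfolding mixed_norm_pow_def
      proof (rule nn_integral_mono)
        fix s :: real
        show "ennreal (integral_mean p s (deriv f) powr q * \<nu> (of_real s)) * indicator {0..<1} s
          \<le> (\<Sum>j. d j * indicator (dyadic_block j) s) * ennreal (\<nu> (of_real s))"
        proof (cases "s \<in> {0..<1}")
          case True
          then obtain j where j: "s \<in> dyadic_block j" using dyadic_block_exists[of s] by auto
          have "integral_mean p s (deriv f) = real n * s ^ (n - 1)"
            unfolding df using p True by (subst integral_mean_monomial) auto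
          also have "\<dots> \<le> real n * dyadic_radius (Suc j) ^ (n - 1)"
            using j True by (intro mult_left_mono power_mono) (auto simp: dyadic_block_def)
          finally have "integral_mean p s (deriv f) powr q \<le> (real n * dyadic_radius (Suc j) ^ (n - 1)) powr q"
            using q by (intro powr_mono2 integral_mean_nonneg) auto
          also have "\<dots> = real n powr q * e k j"
            using dyadic_radius_nonneg[of "Suc j"] by (simp add: e_def n_def powr_mult)
          finally have "integral_mean p s (deriv f) powr q * \<nu> (of_real s) \<le> real n powr q * e k j * \<nu> (of_real s)"
            using nn[OF True] by (rule mult_right_mono)
          then show ?thesis
            unfolding dyadic_step_eq[OF j] using True e0 nn[OF True]
            by (simp add: d_def ennreal_mult'[symmetric] ennreal_leI)
        qed simp
      qed
      also have "\<dots> = (\<Sum>j. d j * block_mass \<nu> j)" by (rule nn_integral_dyadic_step[OF rw])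
      also have "\<dots> \<le> ennreal (real n powr q * ((1 + S) * V k))"
      proof (rule suminf_le_const)
        fix N
        have "(\<Sum>j<N. d j * block_mass \<nu> j) = ennreal (\<Sum>j<N. real n powr q * e k j * W j)"
          using e0 W(2) by (subst sum_ennreal[symmetric]) (auto simp: d_def W(1) ennreal_mult)
        also have "(\<Sum>j<N. real n powr q * e k j * W j) = real n powr q * (\<Sum>j<N. e k j * W j)"
          by (simp add: sum_distrib_left mult.assoc)
        also have "ennreal \<dots> \<le> ennreal (real n powr q * ((1 + S) * V k))"
          by (intro ennreal_leI mult_left_mono eW) auto
        finally show "(\<Sum>j<N. d j * block_mass \<nu> j) \<le> ennreal (real n powr q * ((1 + S) * V k))" .
      qed simp
      finally show "mixed_norm_pow p q \<nu> (deriv f) \<le> ennreal (real n powr q * ((1 + S) * V k))" .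
    qed simp
    also have "ennreal B * ennreal (real n powr q * ((1 + S) * V k)) = ennreal (F * (a ^ k * V k))"
    proof -
      have "real n powr q = 4 powr q * a ^ k"
      proof -
        have "real n = 4 * 2 ^ k" by (simp add: n_def power_add)
        then have "real n powr q = 4 powr q * (2 ^ k) powr q" by (simp add: powr_mult)
        also have "(2 ^ k) powr q = a ^ k"
          unfolding a_def by (simp add: powr_realpow[symmetric] powr_powr mult.commute)
        finally show ?thesis .
      qed
      then show ?thesis using B by (simp add: F_def ennreal_mult'[symmetric] mult_ac)
    qed
    finally have "ennreal (\<Sum>l\<in>{1..<k}. a ^ l * W l) \<le> ennreal (F * (a ^ k * V k))" .
    then show ?thesis using F0 a V(2)[of k] by (simp add: ennreal_le_iff)
  qed
  \<comment> \<open>Lower doubling at x_1 provides a block of positive mass beyond block 0. Its mass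
    is seen by the test functions and serves to absorb W_0.\<close>
  obtain i where i: "1 \<le> i" "0 < W i"
  proof -
    have "0 < (\<Sum>i<L. W (1 + i))" using D(1) D(2)[of 1] V(2)[of 1] by (metis less_le_trans zero_less_mult_pos)
    then obtain j where "0 < W (1 + j)" by (metis not_less sum_nonpos)
    then show thesis using that[of "1 + j"] by simp
  qed
  \<comment> \<open>The first summand settles the finitely many k \<le> i, where V_i \<le> V_k. The
    second settles k > i, where block i belongs to the tested sum and W_0 is a fixed multiple of its
    contribution.\<close>
  define G where "G = W 0 / V i + W 0 / (a ^ i * W i) * F"
  have G0: "0 \<le> G" using W(2) i F0 a V(2)[of i] by (simp add: G_def)
  have "(\<Sum>l<k. a ^ l * W l) \<le> (G + F) * (a ^ k * V k)" for k
  proof -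
    have ak: "1 \<le> a ^ k" using a by (rule one_le_power)
    have "(\<Sum>l<k. a ^ l * W l) \<le> W 0 + (\<Sum>l\<in>{1..<k}. a ^ l * W l)"
    proof (cases k)
      case 0
      then show ?thesis using W(2)[of 0] by simp
    next
      case (Suc k')
      then show ?thesis by (simp add: lessThan_atLeast0 sum.atLeast_Suc_lessThan)
    qed
    moreover have "W 0 \<le> G * (a ^ k * V k)"
    proof (cases "k \<le> i")
      case True
      have "V i \<le> 1 * V k" using Vdec[of k "i - k"] True by simp
      also have "\<dots> \<le> a ^ k * V k" using ak V(2)[of k] by (intro mult_right_mono) auto
      finally have "W 0 / V i * V i \<le> W 0 / V i * (a ^ k * V k)" using W(2)[of 0] V(2)[of i] by (intro mult_left_mono) auto
      also have "\<dots> \<le> G * (a ^ k * V k)"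
        using W(2) i F0 a V(2)[of k] by (intro mult_right_mono) (auto simp: G_def)
      finally show ?thesis using V(2)[of i] by simp
    next
      case False
      have "a ^ i * W i \<le> (\<Sum>l\<in>{1..<k}. a ^ l * W l)"
        using False i a W(2) by (intro member_le_sum) auto
      also have "\<dots> \<le> F * (a ^ k * V k)" by (rule main)
      finally have "W 0 / (a ^ i * W i) * (a ^ i * W i) \<le> W 0 / (a ^ i * W i) * (F * (a ^ k * V k))"
        using W(2)[of 0] i a by (intro mult_left_mono) auto
      also have "\<dots> \<le> G * (a ^ k * V k)"
        using W(2)[of 0] V(2)[of i] V(2)[of k] ak by (simp add: G_def algebra_simps)
      finally show ?thesis using i a by simp
    qed
    ultimately show ?thesis using main[of k] by (simp add: algebra_simps)
  qed
  then show ?thesis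
    using upper_doubling_q_dyadic[OF \<nu> q V W] unfolding a_def by blast
qed

theorem theorem1:
  fixes p q :: real and \<nu> :: "complex \<Rightarrow> real"
  assumes "1 \<le> p" and "0 < q" and "\<nu> \<in> two_sided_doubling"
  shows "\<nu> \<in> upper_doubling_q q \<longleftrightarrow>
    (\<exists>C>0. \<forall>f\<in>hardy_space p.
       (\<integral>\<^sup>+ r\<in>{1/2..<1}. ennreal (modulus_of_continuity p (1 - r) f powr q *
            (\<nu> (of_real r) / (1 - r) powr q)) \<partial>lebesgue)
         \<le> ennreal C * mixed_norm_pow p q \<nu> (deriv f))"
proof
  assume "\<nu> \<in> upper_doubling_q q"
  then show "\<exists>C>0. \<forall>f\<in>hardy_space p.
       (\<integral>\<^sup>+ r\<in>{1/2..<1}. ennreal (modulus_of_continuity p (1 - r) f powr q *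
            (\<nu> (of_real r) / (1 - r) powr q)) \<partial>lebesgue)
         \<le> ennreal C * mixed_norm_pow p q \<nu> (deriv f)"
    using modulus_integral_bound[OF assms] unfolding hardy_space_def by blast
next
  assume "\<exists>C>0. \<forall>f\<in>hardy_space p.
       (\<integral>\<^sup>+ r\<in>{1/2..<1}. ennreal (modulus_of_continuity p (1 - r) f powr q *
            (\<nu> (of_real r) / (1 - r) powr q)) \<partial>lebesgue)
         \<le> ennreal C * mixed_norm_pow p q \<nu> (deriv f)"
  then show "\<nu> \<in> upper_doubling_q q"
    using upper_doubling_q_necessary[OF assms] by blast
qed

end
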